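(* Let $\alpha\ge0$, $1\le p<\infty$ and $\beta,\mu\in\mathbb{R}$ with $0<\beta-\frac1p<\mu$. The generalized Stieltjes operator $$\mathcal{S}_{\beta,\mu}f(t)=t^{\mu-\beta}\int_0^\infty\frac{s^{\beta-1}}{(s+t)^\mu}f(s)\,ds,\qquad t>0,$$ is a bounded operator on $\mathcal{T}_p^{(\alpha)}(t^\alpha)$, and its operator norm there is $$\|\mathcal{S}_{\beta,\mu}\|=B\!\left(\mu-\beta+\tfrac1p,\ \beta-\tfrac1p\right).$$ Moreover, if $f\in\mathcal{T}_p^{(\alpha)}(t^\alpha)$, then $$\mathcal{S}_{\beta,\mu}f(t)=\int_{-\infty}^\infty\phi_{\mu-\beta+1/p,\,\mu}(r)\,T_{r,p}f(t)\,dr,\qquad\text{for (almost every) } t\ge0,$$ where $\phi_{a,\mu}(r)=\dfrac{e^{ar}}{(1+e^r)^\mu}$ and $T_{r,p}f(s)=e^{-r/p}f(e^{-r}s)$.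
   Context: $B$ is the Beta function. Let $\mathcal{S}_+$ be the Schwartz class on $[0,\infty)$. For $f\in\mathcal{S}_+$ and $\alpha>0$ put $W_+^{-\alpha}f(t)=\frac1{\Gamma(\alpha)}\int_t^\infty(s-t)^{\alpha-1}f(s)\,ds$ and $W_+^{\alpha}f(t)=(-1)^n\frac{d^n}{dt^n}W_+^{-(n-\alpha)}f(t)$ with $n=[\alpha]+1$; $W_+^0=\mathrm{Id}$. For $1\le p<\infty$ and $\alpha>0$, $\mathcal{T}_p^{(\alpha)}(t^\alpha)$ is the completion of $\mathcal{S}_+$ in the norm $\|f\|_{\alpha,p}=\frac1{\Gamma(\alpha+1)}\left(\int_0^\infty|W_+^\alpha f(t)|^p t^{\alpha p}dt\right)^{1/p}$; $\mathcal{T}_p^{(0)}(t^0)=L^p(\mathbb{R}^+)$ with $\|\cdot\|_{0,p}=\|\cdot\|_p$. These spaces are continuously embedded in $L^p(\mathbb{R}^+)$ and regarded as subspaces of it. The map $D_+^\alpha f(t)=\frac1{\Gamma(\alpha+1)}t^\alpha W_+^\alpha f(t)$ extends to an isometric isomorphism $\mathcal{T}_p^{(\alpha)}(t^\alpha)\to L^p(\mathbb{R}^+)$ with inverse (for $\alpha>0$) $(D_+^\alpha)^{-1}h(t)=\alpha\int_t^\infty(s-t)^{\alpha-1}\frac{h(s)}{s^\alpha}ds$. $(T_{r,p})_{r\in\mathbb{R}}$ is a $C_0$-group of isometries on $\mathcal{T}_p^{(\alpha)}(t^\alpha)$. *)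

theory Defs
  imports "HOL-Analysis.Analysis"
begin

text \<open>
  Functions on the half-line are total functions \<^typ>\<open>real \<Rightarrow> complex\<close> of which only the values
  on the positive (or nonnegative) reals matter; elements of the Lebesgue spaces are Borel
  representatives, and statements about them are to be read up to almost-everywhere equality.
\<close>

abbreviation halfline :: "real measure" where
  "halfline \<equiv> restrict_space lborel {0<..}"

definition Lp_norm :: "real \<Rightarrow> (real \<Rightarrow> complex) \<Rightarrow> real" where
  "Lp_norm p f = (LINT t|halfline. norm (f t) powr p) powr (1 / p)"

definition Lp_space :: "real \<Rightarrow> (real \<Rightarrow> complex) set" where
  "Lp_space p = {f \<in> borel_measurable halfline. integrable halfline (\<lambda>t. norm (f t) powr p)}"

text \<open>The derivative relative to \<open>[0,\<infinity>)\<close>: one-sided at the endpoint 0.\<close>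

definition hderiv :: "(real \<Rightarrow> complex) \<Rightarrow> real \<Rightarrow> complex" where
  "hderiv f t = vector_derivative f (at t within {0..})"

definition schwartz_plus :: "(real \<Rightarrow> complex) set" where
  "schwartz_plus = {f. \<forall>n.
     (\<forall>t\<ge>0. (hderiv ^^ n) f differentiable (at t within {0..})) \<and>
     (\<forall>m::nat. \<exists>C. \<forall>t\<ge>0. norm (t ^ m *\<^sub>R (hderiv ^^ n) f t) \<le> C)}"

definition weyl_integral :: "real \<Rightarrow> (real \<Rightarrow> complex) \<Rightarrow> real \<Rightarrow> complex" where
  "weyl_integral \<alpha> f t =
     (1 / Gamma \<alpha>) *\<^sub>R (LINT s:{t<..}|lborel. (s - t) powr (\<alpha> - 1) *\<^sub>R f s)"

definition weyl_deriv :: "real \<Rightarrow> (real \<Rightarrow> complex) \<Rightarrow> real \<Rightarrow> complex" where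
  "weyl_deriv \<alpha> f =
     (if \<alpha> = 0 then f
      else let n = nat \<lfloor>\<alpha>\<rfloor> + 1
           in (\<lambda>t. (-1) ^ n * (hderiv ^^ n) (weyl_integral (real n - \<alpha>) f) t))"

definition sobolev_prenorm :: "real \<Rightarrow> real \<Rightarrow> (real \<Rightarrow> complex) \<Rightarrow> real" where
  "sobolev_prenorm \<alpha> p f =
     1 / Gamma (\<alpha> + 1) *
       (LINT t|halfline. norm (weyl_deriv \<alpha> f t) powr p * t powr (\<alpha> * p)) powr (1 / p)"

text \<open>
  For \<open>\<alpha> > 0\<close> the completion of the Schwartz class is realised inside \<open>L\<^sup>p\<close>: the class of a
  sequence that is Cauchy for the pre-norm is identified with its \<open>L\<^sup>p\<close>-limit, and its norm is
  the limit of the pre-norms.  The definite description is legitimate because the pre-norm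
  dominates a positive multiple of the \<open>L\<^sup>p\<close>-norm and the induced map from the completion to \<open>L\<^sup>p\<close> is injective.
\<close>

definition approximates ::
    "real \<Rightarrow> real \<Rightarrow> (nat \<Rightarrow> real \<Rightarrow> complex) \<Rightarrow> (real \<Rightarrow> complex) \<Rightarrow> bool" where
  "approximates \<alpha> p \<phi> f \<longleftrightarrow>
     (\<forall>n. \<phi> n \<in> schwartz_plus) \<and>
     (\<forall>e>0. \<exists>N. \<forall>m\<ge>N. \<forall>n\<ge>N. sobolev_prenorm \<alpha> p (\<lambda>t. \<phi> m t - \<phi> n t) < e) \<and>
     (\<lambda>n. Lp_norm p (\<lambda>t. \<phi> n t - f t)) \<longlonglongrightarrow> 0"

definition sobolev :: "real \<Rightarrow> real \<Rightarrow> (real \<Rightarrow> complex) set" where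
  "sobolev \<alpha> p =
     (if \<alpha> = 0 then Lp_space p else {f \<in> Lp_space p. \<exists>\<phi>. approximates \<alpha> p \<phi> f})"

definition sobolev_norm :: "real \<Rightarrow> real \<Rightarrow> (real \<Rightarrow> complex) \<Rightarrow> real" where
  "sobolev_norm \<alpha> p f =
     (if \<alpha> = 0 then Lp_norm p f
      else THE N. \<exists>\<phi>. approximates \<alpha> p \<phi> f \<and> (\<lambda>n. sobolev_prenorm \<alpha> p (\<phi> n)) \<longlonglongrightarrow> N)"

text \<open>
  Since elements are representatives, a bounded operator also has to respect almost-everywhere
  equality.
\<close>

definition sobolev_bounded_operator ::
    "real \<Rightarrow> real \<Rightarrow> ((real \<Rightarrow> complex) \<Rightarrow> real \<Rightarrow> complex) \<Rightarrow> bool" where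
  "sobolev_bounded_operator \<alpha> p A \<longleftrightarrow>
     (\<forall>f\<in>sobolev \<alpha> p. A f \<in> sobolev \<alpha> p) \<and>
     (\<forall>f\<in>sobolev \<alpha> p. \<forall>g\<in>sobolev \<alpha> p.
        (AE t in halfline. f t = g t) \<longrightarrow> (AE t in halfline. A f t = A g t)) \<and>
     (\<forall>f\<in>sobolev \<alpha> p. \<forall>g\<in>sobolev \<alpha> p.
        AE t in halfline. A (\<lambda>s. f s + g s) t = A f t + A g t) \<and>
     (\<forall>c. \<forall>f\<in>sobolev \<alpha> p. AE t in halfline. A (\<lambda>s. c * f s) t = c * A f t) \<and>
     (\<exists>C. \<forall>f\<in>sobolev \<alpha> p. sobolev_norm \<alpha> p (A f) \<le> C * sobolev_norm \<alpha> p f)"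

text \<open>As in \<^const>\<open>onorm\<close>, the convention \<open>x / 0 = 0\<close> takes care of null functions.\<close>

definition sobolev_onorm ::
    "real \<Rightarrow> real \<Rightarrow> ((real \<Rightarrow> complex) \<Rightarrow> real \<Rightarrow> complex) \<Rightarrow> real" where
  "sobolev_onorm \<alpha> p A = (SUP f\<in>sobolev \<alpha> p. sobolev_norm \<alpha> p (A f) / sobolev_norm \<alpha> p f)"

definition stieltjes :: "real \<Rightarrow> real \<Rightarrow> (real \<Rightarrow> complex) \<Rightarrow> real \<Rightarrow> complex" where
  "stieltjes \<beta> \<mu> f t =
     t powr (\<mu> - \<beta>) *\<^sub>R (LINT s|halfline. (s powr (\<beta> - 1) / (s + t) powr \<mu>) *\<^sub>R f s)"

definition dilation :: "real \<Rightarrow> real \<Rightarrow> (real \<Rightarrow> complex) \<Rightarrow> real \<Rightarrow> complex" where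
  "dilation r p f s = exp (- r / p) *\<^sub>R f (exp (- r) * s)"

definition phi :: "real \<Rightarrow> real \<Rightarrow> real \<Rightarrow> real" where
  "phi a \<mu> r = exp (a * r) / (1 + exp r) powr \<mu>"

end

theory Submission
  imports Defs
begin

text \<open>
  For \<open>\<alpha> > 0\<close> the space is the range of the injective operator
  \<open>G h(t) = \<alpha> \<integral>\<^sub>t\<^sup>\<infinity> (s - t)\<^bsup>\<alpha>-1\<^esup> s\<^bsup>-\<alpha>\<^esup> h(s) ds\<close> on \<open>L\<^sup>p\<close>, and the norm of \<open>G h\<close> is \<open>\<parallel>h\<parallel>\<^sub>p\<close>.
  Both \<open>G\<close> and the Stieltjes operator have the form \<open>h \<mapsto> (t \<mapsto> \<integral> k(u) h(tu) du)\<close>.  Such operators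
  commute by Fubini's theorem, and Jensen's inequality bounds them on \<open>L\<^sup>p\<close> by
  \<open>\<integral> \<bar>k(u)\<bar> u\<^bsup>-1/p\<^esup> du\<close>, which for the Stieltjes kernel is the Beta value.  Hence the operator
  norm does not depend on \<open>\<alpha>\<close>; testing on \<open>t\<^bsup>-1/p-\<epsilon>\<^esup>\<close>, cut off near 0, shows that the bound is sharp
  for nonnegative kernels.

  The identification of the space requires that \<open>t\<^sup>\<alpha> W\<^sub>+\<^sup>\<alpha> \<phi>\<close> for Schwartz \<open>\<phi>\<close> is dense in \<open>L\<^sup>p\<close>, where
  linear combinations of \<open>e\<^bsup>-ct\<^esup>\<close> suffice because \<open>W\<^sub>+\<^sup>\<alpha> e\<^bsup>-ct\<^esup> = c\<^sup>\<alpha> e\<^bsup>-ct\<^esup>\<close>, and that \<open>G\<close> is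
  injective, which reduces to integer order by composing with a second operator of the same form.
\<close>

section \<open>The spaces \<open>L\<^sup>p\<close> on the half-line\<close>

text \<open>The factor u^(-1/p) is the norm of the dilation h(t) -> h(tu) on L^p. For a nonnegative
  kernel t^(-1/p) is a formal eigenfunction with the mass as eigenvalue; it fails to lie in L^p at
  both ends, which is why the test functions are cut off near 0 and steepened by \<epsilon>. Density
  and injectivity do different work. The functions t^\<alpha> W^\<alpha> \<phi> along a Cauchy
  sequence converge in L^p by completeness, and G sends their limit to the limit of the sequence.
  Density ensures that every h in L^p arises in this way, so that the whole range of G belongs to
  the space; injectivity ensures that the norm does not depend on the approximating sequence, as the
  definite description in \<open>sobolev_norm\<close> requires. Density is Weierstrass approximation
  in disguise: in the variable x = e^(-t), combinations of t^\<alpha> e^(-ct) with c = 1, 2, ... are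
  polynomials in x times one fixed function of L^p. Elements are known only almost everywhere, but
  dilations preserve null sets, so the value of such an operator at each single t > 0 depends only
  on the class of h.\<close>

lemma young_powr:
  fixes x l p :: real
  assumes "0 \<le> x" "0 < l" "1 \<le> p"
  shows "x \<le> l powr (1 - p) * x powr p / p + (1 - 1 / p) * l"
proof (cases "x = 0")
  case True
  then show ?thesis using assms by simp
next
  case False
  then have x: "x > 0" using assms by simp
  \<comment> \<open>The two factors are chosen so that their weighted geometric mean is exactly
    \<open>x\<close>; the scale \<open>l\<close> stays free and is optimised where the inequality is
    used.\<close>
  have "(x powr p * l powr (1 - p)) powr (1 / p) * l powr (1 - 1 / p)
      \<le> 1 / p * (x powr p * l powr (1 - p)) + (1 - 1 / p) * l"
    using assms x by (intro Youngs_inequality_0) auto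
  moreover have "(x powr p * l powr (1 - p)) powr (1 / p) * l powr (1 - 1 / p) = x"
  proof -
    have "(x powr p * l powr (1 - p)) powr (1 / p) = x * l powr ((1 - p) / p)"
      using assms x by (simp add: powr_mult powr_powr)
    moreover have "l powr ((1 - p) / p) * l powr (1 - 1 / p) = 1"
      using assms by (simp add: powr_add [symmetric] field_simps)
    ultimately show ?thesis
      by (simp add: mult.assoc)
  qed
  ultimately show ?thesis by (simp add: mult_ac)
qed

text \<open>Used in place of Hoelder's inequality: no conjugate exponent appears, so \<open>p = 1\<close> is not special.\<close>

lemma le_add_powr:
  fixes x l p :: real
  assumes "0 \<le> x" "0 < l" "1 \<le> p"
  shows "x \<le> l powr (1 - p) * x powr p + l"
proof (cases "x \<le> l")
  case True
  then show ?thesis using assms by (simp add: add_increasing)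
next
  case False
  then have x: "x > l" "x > 0" using assms by auto
  have "1 \<le> (x / l) powr (p - 1)"
    using x assms by (intro ge_one_powr_ge_zero) auto
  then have "x * 1 \<le> x * (x / l) powr (p - 1)"
    using x by (intro mult_left_mono) auto
  also have "\<dots> = l powr (1 - p) * x powr p"
    using x assms by (simp add: powr_divide powr_diff field_simps)
  finally show ?thesis using assms by simp
qed

text \<open>Young's inequality is integrated with one constant scale \<open>l\<close>, and
  \<open>l\<close> is optimised afterwards. Since \<open>C\<close> is only an upper bound of the
  mass, it can be positive even if the mass is 0, and dividing by it is safe.\<close>

lemma jensen_weighted:
  fixes w x :: "'a \<Rightarrow> real"
  assumes [measurable]: "w \<in> borel_measurable M" "x \<in> borel_measurable M"
    and p: "1 \<le> p" and nn: "\<And>y. y \<in> space M \<Longrightarrow> 0 \<le> w y" "\<And>y. y \<in> space M \<Longrightarrow> 0 \<le> x y"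
    and w: "integrable M w" "integral\<^sup>L M w \<le> C" "0 < C"
    and wx: "integrable M (\<lambda>y. w y * x y powr p)"
  shows "integrable M (\<lambda>y. w y * x y)"
    and "(LINT y|M. w y * x y) powr p \<le> C powr (p - 1) * (LINT y|M. w y * x y powr p)"
proof -
  define J where "J = (LINT y|M. w y * x y powr p)"
  have J0: "J \<ge> 0" unfolding J_def using nn by (intro integral_nonneg_AE AE_I2) auto
  show int: "integrable M (\<lambda>y. w y * x y)"
  proof (rule Bochner_Integration.integrable_bound)
    show "integrable M (\<lambda>y. w y * x y powr p + w y)" using w wx by simp
    show "AE y in M. norm (w y * x y) \<le> norm (w y * x y powr p + w y)"
    proof (rule AE_I2)
      fix y assume y: "y \<in> space M"
      have "w y * x y \<le> w y * (x y powr p + 1)"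
        using le_add_powr[of "x y" 1 p] nn[OF y] p by (intro mult_left_mono) auto
      with nn[OF y] show "norm (w y * x y) \<le> norm (w y * x y powr p + w y)"
        by (simp add: algebra_simps)
    qed
  qed auto
  define X where "X = (LINT y|M. w y * x y)"
  have X0: "X \<ge> 0" unfolding X_def using nn by (intro integral_nonneg_AE AE_I2) auto
  have main: "X \<le> l powr (1 - p) * J / p + (1 - 1 / p) * l * C" if l: "l > 0" for l
  proof -
    have "X \<le> (LINT y|M. (l powr (1 - p) / p) * (w y * x y powr p) + (1 - 1 / p) * l * w y)"
      unfolding X_def
    proof (rule integral_mono)
      show "integrable M (\<lambda>y. (l powr (1 - p) / p) * (w y * x y powr p) + (1 - 1 / p) * l * w y)"
        using w wx by simp
      fix y assume y: "y \<in> space M"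
      have "w y * x y \<le> w y * (l powr (1 - p) * x y powr p / p + (1 - 1 / p) * l)"
        using young_powr[of "x y" l p] nn[OF y] p l by (intro mult_left_mono) auto
      then show "w y * x y \<le> (l powr (1 - p) / p) * (w y * x y powr p) + (1 - 1 / p) * l * w y"
        by (simp add: algebra_simps)
    qed (rule int)
    also have "\<dots> = (l powr (1 - p) / p) * J + (1 - 1 / p) * l * integral\<^sup>L M w"
      unfolding J_def using w wx by simp
    also have "\<dots> \<le> (l powr (1 - p) / p) * J + (1 - 1 / p) * l * C"
      using w l p by (intro add_left_mono mult_left_mono mult_nonneg_nonneg) auto
    finally show ?thesis by simp
  qed
  have "X powr p \<le> C powr (p - 1) * J"
  proof (cases "X = 0")
    case True
    then show ?thesis using J0 by simp
  next
    case False
    then have X: "X > 0" using X0 by simp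
    \<comment> \<open>With this scale the second term of \<open>main\<close> equals
      \<open>(1 - 1 / p) * X\<close> and is absorbed on the left.\<close>
    define l where "l = X / C"
    have l: "l > 0" using X w by (simp add: l_def)
    have "X \<le> l powr (1 - p) * J / p + (1 - 1 / p) * X"
      using main[OF l] w by (simp add: l_def)
    then have "X / p \<le> l powr (1 - p) * J / p" by (simp add: algebra_simps)
    then have "X \<le> l powr (1 - p) * J" using p by (simp add: divide_le_cancel)
    then have "l powr (p - 1) * X \<le> l powr (p - 1) * (l powr (1 - p) * J)"
      by (intro mult_left_mono) auto
    also have "\<dots> = J" using l by (simp add: mult.assoc[symmetric] powr_add[symmetric])
    finally have "C powr (p - 1) * (l powr (p - 1) * X) \<le> C powr (p - 1) * J"
      by (intro mult_left_mono) auto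
    moreover have "C powr (p - 1) * (l powr (p - 1) * X) = X powr p"
      using X w by (simp add: l_def powr_divide powr_diff)
    ultimately show ?thesis by simp
  qed
  then show "(LINT y|M. w y * x y) powr p \<le> C powr (p - 1) * (LINT y|M. w y * x y powr p)"
    by (simp add: X_def J_def)
qed

text \<open>Convexity of the power at the points \<open>x / a\<close> and \<open>y / b\<close> with
  weights \<open>a / (a + b)\<close> and \<open>b / (a + b)\<close>. If \<open>a\<close> and
  \<open>b\<close> bound two norms, integrating this gives Minkowski's inequality.\<close>

lemma powr_add_le_weighted:
  fixes x y a b p :: real
  assumes "0 \<le> x" "0 \<le> y" "0 < a" "0 < b" "1 \<le> p"
  shows "(x + y) powr p \<le> (a + b) powr (p - 1) * (a powr (1 - p) * x powr p + b powr (1 - p) * y powr p)"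
proof -
  have conv: "(s * u + (1 - s) * v) powr p \<le> s * u powr p + (1 - s) * v powr p"
    if uv: "u \<ge> 0" "v \<ge> 0" and s: "0 < s" "s < 1" for u v s
  proof -
    consider "u > 0" "v > 0" | "u = 0" | "v = 0" using uv by fastforce
    then show ?thesis
    proof cases
      case 1
      then show ?thesis
        using convex_onD[OF powr_convex[OF assms(5)], of "1 - s" u v] uv s by (simp add: algebra_simps)
    next
      case 2
      have "(1 - s) powr p \<le> (1 - s) powr 1"
        using uv s assms by (intro powr_mono') auto
      then show ?thesis
        using 2 uv s by (simp add: powr_mult mult_right_mono)
    next
      case 3
      have "s powr p \<le> s powr 1"
        using uv s assms by (intro powr_mono') auto
      then show ?thesis
        using 3 uv s by (simp add: powr_mult mult_right_mono)
    qed
  qed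
  define s where "s = a / (a + b)"
  have s: "0 < s" "s < 1" "1 - s = b / (a + b)"
    using assms by (auto simp: s_def field_simps)
  have "x + y = (a + b) * (s * (x / a) + (1 - s) * (y / b))"
  proof -
    have "s * (x / a) = x / (a + b)" "(1 - s) * (y / b) = y / (a + b)"
      using assms unfolding s(3) by (simp_all add: s_def)
    then show ?thesis using assms by (simp add: add_divide_distrib[symmetric])
  qed
  then have "(x + y) powr p = (a + b) powr p * (s * (x / a) + (1 - s) * (y / b)) powr p"
    using assms s by (simp add: powr_mult)
  also have "\<dots> \<le> (a + b) powr p * (s * (x / a) powr p + (1 - s) * (y / b) powr p)"
    using assms s by (intro mult_left_mono conv) auto
  also have "\<dots> = (a + b) powr (p - 1) * (a powr (1 - p) * x powr p + b powr (1 - p) * y powr p)"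
  proof -
    have "s * (x / a) powr p = a powr (1 - p) * x powr p / (a + b)"
      "(1 - s) * (y / b) powr p = b powr (1 - p) * y powr p / (a + b)"
      using assms unfolding s(3) by (simp_all add: s_def powr_divide powr_diff)
    moreover have "(a + b) powr (p - 1) = (a + b) powr p / (a + b)"
      using assms by (simp add: powr_diff)
    ultimately show ?thesis by (simp add: add_divide_distrib[symmetric])
  qed
  finally show ?thesis .
qed

section \<open>The norm on L^p and Minkowski's inequality\<close>

lemma space_halfline [simp]: "space halfline = {0<..}"
  by (simp add: space_restrict_space)

lemma sigma_finite_halfline: "sigma_finite_measure halfline"
  by (intro sigma_finite_measure_restrict_space lborel.sigma_finite_measure_axioms) simp

lemma measurable_ident_halfline [measurable]: "(\<lambda>x. x) \<in> borel_measurable halfline"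
  by (intro measurable_restrict_space1) simp

lemma Lp_space_measurable: "f \<in> Lp_space p \<Longrightarrow> f \<in> borel_measurable halfline"
  and Lp_space_integrable: "f \<in> Lp_space p \<Longrightarrow> integrable halfline (\<lambda>t. norm (f t) powr p)"
  by (auto simp: Lp_space_def)

lemma Lp_norm_nonneg [simp]: "0 \<le> Lp_norm p f"
  by (simp add: Lp_norm_def)

lemma Lp_integral_nonneg: "0 \<le> (LINT t|halfline. norm (f t :: complex) powr p)"
  by (intro integral_nonneg_AE AE_I2) auto

lemma Lp_norm_powr: "1 \<le> p \<Longrightarrow> Lp_norm p f powr p = (LINT t|halfline. norm (f t) powr p)"
  using Lp_integral_nonneg by (simp add: Lp_norm_def powr_powr)

lemma Lp_norm_le_iff:
  assumes "1 \<le> p" "0 \<le> C"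
  shows "Lp_norm p f \<le> C \<longleftrightarrow> (LINT t|halfline. norm (f t) powr p) \<le> C powr p"
proof -
  have "Lp_norm p f \<le> C \<longleftrightarrow> Lp_norm p f powr p \<le> C powr p"
    using assms powr_mono2[of p "Lp_norm p f" C] powr_less_mono2[of p C "Lp_norm p f"] by fastforce
  then show ?thesis using assms by (simp add: Lp_norm_powr)
qed

lemma Lp_space_bound:
  assumes "g \<in> Lp_space p" "f \<in> borel_measurable halfline" "0 \<le> p"
    and "AE t in halfline. norm (f t) \<le> norm (g t)"
  shows "f \<in> Lp_space p"
proof -
  note [measurable] = assms(2)
  have "integrable halfline (\<lambda>t. norm (f t) powr p)"
    by (rule Bochner_Integration.integrable_bound[OF Lp_space_integrable[OF assms(1)]])
      (use assms in \<open>auto elim!: eventually_mono intro!: powr_mono2\<close>)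
  then show ?thesis using assms by (simp add: Lp_space_def)
qed

lemma Lp_norm_mono:
  assumes "g \<in> Lp_space p" "1 \<le> p" "AE t in halfline. norm (f t) \<le> norm (g t)"
  shows "Lp_norm p f \<le> Lp_norm p g"
  unfolding Lp_norm_le_iff[OF assms(2) Lp_norm_nonneg] Lp_norm_powr[OF assms(2)]
  by (intro integral_mono_AE' Lp_space_integrable assms)
    (use assms in \<open>auto elim!: eventually_mono intro!: powr_mono2\<close>)

lemma Lp_norm_cong:
  assumes "AE t in halfline. norm (f t) = norm (g t)"
    and [measurable]: "f \<in> borel_measurable halfline" "g \<in> borel_measurable halfline"
  shows "Lp_norm p f = Lp_norm p g"
  unfolding Lp_norm_def using assms(1)
  by (intro arg_cong[where f="\<lambda>x. x powr (1/p)"] integral_cong_AE) (auto elim!: eventually_mono)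

text \<open>Minkowski's inequality with positive upper bounds \<open>a\<close>, \<open>b\<close> in
  place of the norms, so that a vanishing norm never enters a negative power.
  \<open>Lp_norm_triangle\<close> then lets the bounds decrease to the norms.\<close>

lemma Lp_add_aux:
  assumes f: "f \<in> Lp_space p" and g: "g \<in> Lp_space p" and p: "1 \<le> p"
    and ab: "0 < a" "0 < b" "Lp_norm p f \<le> a" "Lp_norm p g \<le> b"
  shows "(\<lambda>t. f t + g t) \<in> Lp_space p" "Lp_norm p (\<lambda>t. f t + g t) \<le> a + b"
proof -
  note [measurable] = Lp_space_measurable[OF f] Lp_space_measurable[OF g]
  note int = Lp_space_integrable[OF f] Lp_space_integrable[OF g]
  let ?h = "\<lambda>t. (a + b) powr (p - 1) * (a powr (1 - p) * norm (f t) powr p + b powr (1 - p) * norm (g t) powr p)"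
  have h: "integrable halfline ?h" using int by simp
  have le: "norm (f t + g t) powr p \<le> ?h t" for t
  proof -
    have "norm (f t + g t) powr p \<le> (norm (f t) + norm (g t)) powr p"
      using p by (intro powr_mono2 norm_triangle_ineq) auto
    also have "\<dots> \<le> ?h t" using p ab by (intro powr_add_le_weighted) auto
    finally show ?thesis .
  qed
  have int': "integrable halfline (\<lambda>t. norm (f t + g t) powr p)"
  proof (rule Bochner_Integration.integrable_bound[OF h])
    show "AE t in halfline. norm (norm (f t + g t) powr p) \<le> norm (?h t)"
    proof (rule AE_I2)
      fix t
      show "norm (norm (f t + g t) powr p) \<le> norm (?h t)"
        using order_trans[OF le abs_ge_self, of t] by (simp only: real_norm_def abs_of_nonneg[OF powr_ge_zero])
    qed
  qed simp
  then show "(\<lambda>t. f t + g t) \<in> Lp_space p" by (simp add: Lp_space_def)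
  have fa: "(LINT t|halfline. norm (f t) powr p) \<le> a powr p" and gb: "(LINT t|halfline. norm (g t) powr p) \<le> b powr p"
    using ab p by (simp_all add: Lp_norm_le_iff[symmetric])
  have "(LINT t|halfline. norm (f t + g t) powr p) \<le> integral\<^sup>L halfline ?h"
    by (intro integral_mono int' h le)
  also have "\<dots> = (a + b) powr (p - 1) * (a powr (1 - p) * (LINT t|halfline. norm (f t) powr p)
       + b powr (1 - p) * (LINT t|halfline. norm (g t) powr p))"
    using int by simp
  also have "\<dots> \<le> (a + b) powr (p - 1) * (a powr (1 - p) * a powr p + b powr (1 - p) * b powr p)"
    by (intro mult_left_mono add_mono fa gb) auto
  also have "\<dots> = (a + b) powr p"
    using ab by (simp add: powr_add[symmetric]) (simp add: powr_diff)
  finally show "Lp_norm p (\<lambda>t. f t + g t) \<le> a + b"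
    using ab p by (simp add: Lp_norm_le_iff)
qed

lemma Lp_space_add:
  assumes "f \<in> Lp_space p" "g \<in> Lp_space p" "1 \<le> p"
  shows "(\<lambda>t. f t + g t) \<in> Lp_space p"
  using Lp_add_aux(1)[OF assms, of "Lp_norm p f + 1" "Lp_norm p g + 1"]
  by (simp add: add_nonneg_pos)

lemma Lp_norm_triangle:
  assumes "f \<in> Lp_space p" "g \<in> Lp_space p" "1 \<le> p"
  shows "Lp_norm p (\<lambda>t. f t + g t) \<le> Lp_norm p f + Lp_norm p g"
proof (rule field_le_epsilon)
  fix e :: real assume "e > 0"
  then have "Lp_norm p (\<lambda>t. f t + g t) \<le> (Lp_norm p f + e/2) + (Lp_norm p g + e/2)"
    by (intro Lp_add_aux(2) assms add_nonneg_pos) auto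
  then show "Lp_norm p (\<lambda>t. f t + g t) \<le> Lp_norm p f + Lp_norm p g + e" by simp
qed

lemma Lp_space_cmult: "f \<in> Lp_space p \<Longrightarrow> (\<lambda>t. c * f t) \<in> Lp_space p"
  by (auto simp: Lp_space_def norm_mult powr_mult)

lemma Lp_norm_cmult: "1 \<le> p \<Longrightarrow> Lp_norm p (\<lambda>t. c * f t) = norm c * Lp_norm p f"
  using Lp_integral_nonneg[where f=f and p=p] by (simp add: Lp_norm_def norm_mult powr_mult powr_powr)

lemma Lp_space_uminus: "f \<in> Lp_space p \<Longrightarrow> (\<lambda>t. - f t) \<in> Lp_space p"
  by (auto simp: Lp_space_def)

lemma Lp_norm_minus_commute: "Lp_norm p (\<lambda>t. f t - g t) = Lp_norm p (\<lambda>t. g t - f t)"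
  by (simp add: Lp_norm_def norm_minus_commute)

lemma Lp_space_diff:
  assumes "f \<in> Lp_space p" "g \<in> Lp_space p" "1 \<le> p"
  shows "(\<lambda>t. f t - g t) \<in> Lp_space p"
  using Lp_space_add[OF assms(1) Lp_space_uminus[OF assms(2)] assms(3)] by simp

lemma Lp_norm_diff_triangle:
  assumes "f \<in> Lp_space p" "g \<in> Lp_space p" "h \<in> Lp_space p" "1 \<le> p"
  shows "Lp_norm p (\<lambda>t. f t - h t) \<le> Lp_norm p (\<lambda>t. f t - g t) + Lp_norm p (\<lambda>t. g t - h t)"
  using Lp_norm_triangle[OF Lp_space_diff[OF assms(1,2,4)] Lp_space_diff[OF assms(2,3,4)] assms(4)]
  by simp

lemma Lp_norm_diff_abs:
  assumes "f \<in> Lp_space p" "g \<in> Lp_space p" "1 \<le> p"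
  shows "\<bar>Lp_norm p f - Lp_norm p g\<bar> \<le> Lp_norm p (\<lambda>t. f t - g t)"
  using Lp_norm_triangle[OF Lp_space_diff[OF assms] assms(2,3)]
    Lp_norm_triangle[OF Lp_space_diff[OF assms(2,1,3)] assms(1,3)]
    Lp_norm_minus_commute[of p f g] by simp

lemma Lp_norm_eq_0_iff:
  assumes "f \<in> Lp_space p" "1 \<le> p"
  shows "Lp_norm p f = 0 \<longleftrightarrow> (AE t in halfline. f t = 0)"
proof -
  have "Lp_norm p f = 0 \<longleftrightarrow> (LINT t|halfline. norm (f t) powr p) = 0"
    using assms by (simp add: Lp_norm_def)
  also have "\<dots> \<longleftrightarrow> (AE t in halfline. norm (f t) powr p = 0)"
    by (intro integral_nonneg_eq_0_iff_AE Lp_space_integrable assms) auto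
  finally show ?thesis by simp
qed

lemma Lp_norm_0 [simp]: "Lp_norm p (\<lambda>t. 0) = 0"
  by (simp add: Lp_norm_def)

lemma zero_Lp_space [simp]: "(\<lambda>t. 0) \<in> Lp_space p"
  by (simp add: Lp_space_def)

section \<open>Dominated convergence, Fatou's lemma and completeness in L^p\<close>

lemma Lp_dominated:
  assumes g: "g \<in> Lp_space p" and p: "1 \<le> p"
    and [measurable]: "\<And>n. f n \<in> borel_measurable halfline"
    and bd: "\<And>n. AE t in halfline. norm (f n t) \<le> norm (g t)"
    and lim: "AE t in halfline. (\<lambda>n. f n t) \<longlonglongrightarrow> 0"
  shows "(\<lambda>n. Lp_norm p (f n)) \<longlonglongrightarrow> 0"
proof -
  note [measurable] = Lp_space_measurable[OF g]
  have "(\<lambda>n. LINT t|halfline. norm (f n t) powr p) \<longlonglongrightarrow> (LINT t|halfline. 0)"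
  proof (rule integral_dominated_convergence[where w = "\<lambda>t. norm (g t) powr p"])
    show "AE t in halfline. (\<lambda>n. norm (f n t) powr p) \<longlonglongrightarrow> 0"
      using lim
    proof eventually_elim
      case (elim t)
      show ?case
        using tendsto_powr'[OF tendsto_norm_zero[OF elim] tendsto_const[of p]] p by simp
    qed
    show "AE t in halfline. norm (norm (f n t) powr p) \<le> norm (g t) powr p" for n
      using bd[of n] by eventually_elim (use p in \<open>auto intro!: powr_mono2\<close>)
  qed (use Lp_space_integrable[OF g] in auto)
  then have "(\<lambda>n. (LINT t|halfline. norm (f n t) powr p) powr (1 / p)) \<longlonglongrightarrow> 0 powr (1 / p)"
    using p by (intro tendsto_powr') (auto simp: Lp_integral_nonneg)
  then show ?thesis by (simp add: Lp_norm_def)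
qed

lemma Lp_Fatou:
  assumes p: "1 \<le> p" and g: "\<And>k. g k \<in> Lp_space p" and bd: "\<And>k. Lp_norm p (g k) \<le> e"
    and [measurable]: "h \<in> borel_measurable halfline"
    and lim: "AE t in halfline. (\<lambda>k. g k t) \<longlonglongrightarrow> h t"
  shows "h \<in> Lp_space p" "Lp_norm p h \<le> e"
proof -
  note [measurable] = Lp_space_measurable[OF g]
  have e: "0 \<le> e" using bd[of 0] Lp_norm_nonneg[of p "g 0"] by linarith
  have eq: "AE t in halfline. ennreal (norm (h t) powr p) = liminf (\<lambda>k. ennreal (norm (g k t) powr p))"
    using lim
  proof eventually_elim
    case (elim t)
    have "(\<lambda>k. norm (g k t) powr p) \<longlonglongrightarrow> norm (h t) powr p"
      using p by (intro tendsto_powr' tendsto_norm elim tendsto_const) auto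
    then have "(\<lambda>k. ennreal (norm (g k t) powr p)) \<longlonglongrightarrow> ennreal (norm (h t) powr p)"
      by (rule tendsto_ennrealI)
    then show ?case by (intro lim_imp_Liminf[symmetric]) auto
  qed
  have nn: "(\<integral>\<^sup>+t. ennreal (norm (g k t) powr p) \<partial>halfline) \<le> ennreal (e powr p)" for k
    using bd[of k] p e
    by (subst nn_integral_eq_integral[OF Lp_space_integrable[OF g]]) (auto simp: Lp_norm_le_iff intro!: ennreal_leI)
  have "(\<integral>\<^sup>+t. ennreal (norm (h t) powr p) \<partial>halfline)
      = (\<integral>\<^sup>+t. liminf (\<lambda>k. ennreal (norm (g k t) powr p)) \<partial>halfline)"
    by (rule nn_integral_cong_AE[OF eq])
  also have "\<dots> \<le> liminf (\<lambda>k. \<integral>\<^sup>+t. ennreal (norm (g k t) powr p) \<partial>halfline)"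
    by (intro nn_integral_liminf) measurable
  also have "\<dots> \<le> liminf (\<lambda>k::nat. ennreal (e powr p))"
    by (intro Liminf_mono always_eventually allI nn)
  also have "\<dots> = ennreal (e powr p)"
    by (simp add: Liminf_const)
  finally have le: "(\<integral>\<^sup>+t. ennreal (norm (h t) powr p) \<partial>halfline) \<le> ennreal (e powr p)" .
  have int: "integrable halfline (\<lambda>t. norm (h t) powr p)"
    using le by (intro integrableI_nonneg) (auto simp: le_less_trans)
  then show "h \<in> Lp_space p" by (simp add: Lp_space_def)
  from le have "ennreal (LINT t|halfline. norm (h t) powr p) \<le> ennreal (e powr p)"
    by (subst (asm) nn_integral_eq_integral[OF int]) auto
  then show "Lp_norm p h \<le> e"
    using e p by (simp add: Lp_norm_le_iff)
qed

text \<open>Each term is at most the whole sum S, so norm (d k) is at most S^(1/p) 2^(-k). The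
  factor \<open>2 ^ k\<close> thus turns a bound on single terms into absolute convergence.\<close>

lemma summable_suminf_powr:
  fixes d :: "nat \<Rightarrow> 'a :: banach"
  assumes "(\<Sum>k. ennreal ((2 ^ k * norm (d k)) powr p)) \<noteq> \<infinity>" and p: "1 \<le> p"
  shows "summable d"
proof -
  have sm: "summable (\<lambda>k. (2 ^ k * norm (d k)) powr p)"
    using assms(1) by (intro summable_suminf_not_top) auto
  define S where "S = (\<Sum>k. (2 ^ k * norm (d k)) powr p)"
  have S: "S \<ge> 0" unfolding S_def by (intro suminf_nonneg sm) auto
  have "norm (d k) \<le> S powr (1/p) * (1/2) ^ k" for k
  proof -
    have "(2 ^ k * norm (d k)) powr p \<le> S"
      using sum_le_suminf[OF sm, of "{k}"] by (simp add: S_def)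
    then have "((2 ^ k * norm (d k)) powr p) powr (1/p) \<le> S powr (1/p)"
      using p by (intro powr_mono2) auto
    then have "2 ^ k * norm (d k) \<le> S powr (1/p)"
      using p by (simp add: powr_powr)
    then show ?thesis by (simp add: power_divide field_simps)
  qed
  note le = this
  have "summable (\<lambda>k. S powr (1/p) * (1/2) ^ k)"
    by (intro summable_mult summable_geometric) auto
  from summable_comparison_test'[OF this le] show ?thesis .
qed

text \<open>The Riesz-Fischer argument: a rapidly Cauchy subsequence converges almost everywhere,
  and Fatou's lemma transfers the Cauchy estimates to the pointwise limit.\<close>

lemma Lp_complete:
  assumes p: "1 \<le> p" and f: "\<And>n. f n \<in> Lp_space p"
    and C: "\<And>e. 0 < e \<Longrightarrow> \<exists>N. \<forall>m\<ge>N. \<forall>n\<ge>N. Lp_norm p (\<lambda>t. f m t - f n t) < e"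
  obtains h where "h \<in> Lp_space p" "(\<lambda>n. Lp_norm p (\<lambda>t. f n t - h t)) \<longlonglongrightarrow> 0"
proof -
  note [measurable] = Lp_space_measurable[OF f]
  \<comment> \<open>The rate 4^(-k) pays for the weight 2^k of \<open>summable_suminf_powr\<close>
    and still leaves the summable 2^(-k).\<close>
  have "\<exists>N. \<forall>m\<ge>N. \<forall>n\<ge>N. Lp_norm p (\<lambda>t. f m t - f n t) < (1/4) ^ k" for k :: nat
    by (rule C) simp
  then obtain N where N: "\<And>k m n. m \<ge> N k \<Longrightarrow> n \<ge> N k \<Longrightarrow> Lp_norm p (\<lambda>t. f m t - f n t) < (1/4) ^ k"
    by metis
  \<comment> \<open>Adding all earlier thresholds and \<open>k\<close> itself makes the indices
    monotone, at least \<open>N k\<close> and at least \<open>k\<close>, hence unbounded.\<close>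
  define r where "r k = k + (\<Sum>i\<le>k. N i)" for k
  have rN: "N k \<le> r k" for k
    unfolding r_def using member_le_sum[of k "{..k}" N] by simp
  have rS: "r k \<le> r (Suc k)" "k \<le> r k" for k by (auto simp: r_def)
  define d where "d k t = f (r (Suc k)) t - f (r k) t" for k t
  have dL: "d k \<in> Lp_space p" for k
    unfolding d_def by (intro Lp_space_diff f p)
  note [measurable] = Lp_space_measurable[OF dL]
  have dn: "Lp_norm p (d k) \<le> (1/4) ^ k" for k
    unfolding d_def using N[of k "r (Suc k)" "r k"] rN[of k] rS(1)[of k] by simp
  have "(\<integral>\<^sup>+t. (\<Sum>k. ennreal ((2 ^ k * norm (d k t)) powr p)) \<partial>halfline)
      = (\<Sum>k. \<integral>\<^sup>+t. ennreal ((2 ^ k * norm (d k t)) powr p) \<partial>halfline)"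
    by (intro nn_integral_suminf) measurable
  also have "\<dots> \<le> (\<Sum>k. ennreal ((1/2) ^ k))"
  proof (intro suminf_le allI)
    fix k
    have "(\<integral>\<^sup>+t. ennreal ((2 ^ k * norm (d k t)) powr p) \<partial>halfline)
        = ennreal (Lp_norm p (\<lambda>t. 2 ^ k * d k t) powr p)"
      using Lp_space_integrable[OF Lp_space_cmult[OF dL[of k], of "2 ^ k"]] p
      by (subst nn_integral_eq_integral) (auto simp: Lp_norm_powr norm_mult norm_power)
    also have "Lp_norm p (\<lambda>t. 2 ^ k * d k t) \<le> (1/2) ^ k"
    proof -
      have "Lp_norm p (\<lambda>t. 2 ^ k * d k t) = 2 ^ k * Lp_norm p (d k)"
        using p by (simp only: Lp_norm_cmult) (simp add: norm_power)
      also have "\<dots> \<le> 2 ^ k * (1/4) ^ k"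
        by (intro mult_left_mono dn) auto
      also have "\<dots> = (1/2) ^ k" by (simp add: power_mult_distrib[symmetric])
      finally show ?thesis .
    qed
    then have "Lp_norm p (\<lambda>t. 2 ^ k * d k t) powr p \<le> ((1/2) ^ k) powr p"
      using p by (intro powr_mono2) auto
    also have "\<dots> \<le> ((1/2) ^ k) powr 1"
      using p by (intro powr_mono') (auto simp: power_le_one)
    finally show "(\<integral>\<^sup>+t. ennreal ((2 ^ k * norm (d k t)) powr p) \<partial>halfline) \<le> ennreal ((1/2) ^ k)"
      by (simp add: ennreal_leI)
  qed auto
  also have "\<dots> < \<infinity>"
    using summable_geometric[of "1/2::real"] by (subst suminf_ennreal2) auto
  finally have "AE t in halfline. (\<Sum>k. ennreal ((2 ^ k * norm (d k t)) powr p)) \<noteq> \<infinity>"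
    by (intro nn_integral_noteq_infinite) (measurable, use p in auto)
  then have conv: "AE t in halfline. convergent (\<lambda>k. f (r k) t)"
  proof eventually_elim
    case (elim t)
    have "summable (\<lambda>k. d k t)"
      by (rule summable_suminf_powr[OF elim p])
    then have "convergent (\<lambda>n. \<Sum>k<n. d k t)"
      by (simp add: summable_iff_convergent)
    then have "convergent (\<lambda>n. f (r 0) t + (\<Sum>k<n. d k t))"
      by (simp add: convergent_add convergent_const)
    moreover have "f (r 0) t + (\<Sum>k<n. d k t) = f (r n) t" for n
      unfolding d_def by (subst sum_lessThan_telescope) simp
    ultimately show ?case by simp
  qed
  define h where "h t = lim (\<lambda>k. f (r k) t)" for t
  have [measurable]: "h \<in> borel_measurable halfline"
    unfolding h_def by measurable
  have lim: "AE t in halfline. (\<lambda>k. f (r k) t) \<longlonglongrightarrow> h t"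
    using conv by eventually_elim (simp add: h_def convergent_LIMSEQ_iff)
  \<comment> \<open>One index runs to infinity along the subsequence while the other stays fixed;
    the offset \<open>N0\<close> keeps the moving index in the range where the Cauchy estimate
    holds.\<close>
  have est: "(\<lambda>t. f n t - h t) \<in> Lp_space p" "Lp_norm p (\<lambda>t. f n t - h t) \<le> e"
    if "\<And>m n. N0 \<le> m \<Longrightarrow> N0 \<le> n \<Longrightarrow> Lp_norm p (\<lambda>t. f m t - f n t) < e" "N0 \<le> n" for N0 n e
  proof -
    have 1: "(\<lambda>t. f n t - f (r (k + N0)) t) \<in> Lp_space p" for k
      by (intro Lp_space_diff f p)
    have 2: "Lp_norm p (\<lambda>t. f n t - f (r (k + N0)) t) \<le> e" for k
      using rS(2)[of "k + N0"] by (intro less_imp_le[OF that(1)[OF that(2)]]) simp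
    have 3: "AE t in halfline. (\<lambda>k. f n t - f (r (k + N0)) t) \<longlonglongrightarrow> f n t - h t"
      using lim by eventually_elim (intro tendsto_intros LIMSEQ_ignore_initial_segment)
    show "(\<lambda>t. f n t - h t) \<in> Lp_space p" "Lp_norm p (\<lambda>t. f n t - h t) \<le> e"
      by (rule Lp_Fatou[OF p 1 2 _ 3], measurable)+
  qed
  obtain N1 where N1: "\<forall>m\<ge>N1. \<forall>n\<ge>N1. Lp_norm p (\<lambda>t. f m t - f n t) < 1"
    using C[of 1] by auto
  have "(\<lambda>t. f N1 t - (f N1 t - h t)) \<in> Lp_space p"
    using N1 by (intro Lp_space_diff f p est(1)[of N1 1]) auto
  then have "h \<in> Lp_space p" by simp
  moreover have "(\<lambda>n. Lp_norm p (\<lambda>t. f n t - h t)) \<longlonglongrightarrow> 0"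
  proof (rule LIMSEQ_I)
    fix e :: real assume e: "e > 0"
    then obtain N0 where N0: "\<forall>m\<ge>N0. \<forall>n\<ge>N0. Lp_norm p (\<lambda>t. f m t - f n t) < e/2"
      using C[of "e/2"] by auto
    have "Lp_norm p (\<lambda>t. f n t - h t) \<le> e/2" if "n \<ge> N0" for n
      using N0 that by (intro est(2)[of N0]) auto
    then show "\<exists>N0. \<forall>n\<ge>N0. norm (Lp_norm p (\<lambda>t. f n t - h t) - 0) < e"
      using e by (intro exI[of _ N0]) (auto intro: le_less_trans[of _ "e/2"])
  qed
  ultimately show ?thesis using that by blast
qed

section \<open>Operators with homogeneous kernels\<close>

lemma nn_integral_halfline_dilate:
  assumes [measurable]: "g \<in> borel_measurable halfline" and c: "0 < c"
  shows "(\<integral>\<^sup>+t. g (t * c) \<partial>halfline) = ennreal (1 / c) * (\<integral>\<^sup>+t. g t \<partial>halfline)"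
proof -
  let ?g = "\<lambda>t. g t * indicator {0<..} t"
  have [measurable]: "?g \<in> borel_measurable borel"
    using assms(1) by (simp add: borel_measurable_restrict_space_iff_ennreal)
  have "(\<integral>\<^sup>+t. g t \<partial>halfline) = (\<integral>\<^sup>+t. ?g t \<partial>lborel)"
    by (subst nn_integral_restrict_space) auto
  also have "\<dots> = \<bar>c\<bar> * (\<integral>\<^sup>+t. ?g (0 + c * t) \<partial>lborel)"
    using c by (intro nn_integral_real_affine) auto
  also have "(\<integral>\<^sup>+t. ?g (0 + c * t) \<partial>lborel) = (\<integral>\<^sup>+t. g (t * c) * indicator {0<..} t \<partial>lborel)"
    using c by (intro nn_integral_cong) (auto simp: indicator_def mult.commute zero_less_mult_iff)
  also have "\<dots> = (\<integral>\<^sup>+t. g (t * c) \<partial>halfline)"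
    by (subst nn_integral_restrict_space) auto
  finally have "(\<integral>\<^sup>+t. g t \<partial>halfline) = ennreal c * (\<integral>\<^sup>+t. g (t * c) \<partial>halfline)"
    using c by simp
  then show ?thesis
    using c by (simp add: mult.assoc[symmetric] ennreal_mult[symmetric])
qed

lemma measurable_dilate_halfline:
  assumes [measurable]: "h \<in> borel_measurable halfline" "\<delta> \<in> borel_measurable N"
    and pos: "\<And>y. y \<in> space N \<Longrightarrow> 0 < \<delta> y"
  shows "(\<lambda>(t, y). h (t * \<delta> y)) \<in> borel_measurable (halfline \<Otimes>\<^sub>M N)"
proof -
  have "(\<lambda>z. fst z * \<delta> (snd z)) \<in> halfline \<Otimes>\<^sub>M N \<rightarrow>\<^sub>M halfline"
    by (rule measurable_restrict_space2) (auto simp: space_pair_measure pos)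
  then have "(\<lambda>z. h (fst z * \<delta> (snd z))) \<in> borel_measurable (halfline \<Otimes>\<^sub>M N)"
    by (rule measurable_compose) (rule assms)
  then show ?thesis by (simp add: case_prod_beta')
qed

lemma measurable_dilate1:
  assumes "h \<in> borel_measurable halfline" "0 < c"
  shows "(\<lambda>t. h (t * c)) \<in> borel_measurable halfline"
proof -
  have "(\<lambda>t. t * c) \<in> halfline \<rightarrow>\<^sub>M halfline"
    by (rule measurable_restrict_space2) (use assms in auto)
  then show ?thesis by (rule measurable_compose) (rule assms)
qed

text \<open>The measure of a dilated set is a multiple of the original measure, so null sets remain
  null; the identity for nonnegative integrals is applied to the indicator of the exceptional
  set.\<close>

lemma AE_halfline_dilate:
  assumes "AE t in halfline. P t" and c: "0 < c"
  shows "AE t in halfline. P (t * c)"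
proof -
  obtain N where N: "{t \<in> space halfline. \<not> P t} \<subseteq> N" "N \<in> null_sets halfline"
    using assms(1) by (auto simp: eventually_ae_filter)
  have [measurable]: "N \<in> sets halfline" using N by auto
  have "(\<integral>\<^sup>+t. indicator N (t * c) \<partial>halfline) = ennreal (1 / c) * (\<integral>\<^sup>+t. indicator N t \<partial>halfline)"
    by (intro nn_integral_halfline_dilate c) auto
  also have "\<dots> = 0" using N by (simp add: null_setsD1)
  finally have "AE t in halfline. indicator N (t * c) = (0 :: ennreal)"
    using measurable_dilate1[of "indicator N :: real \<Rightarrow> ennreal" c] c
    by (subst (asm) nn_integral_0_iff_AE) (auto intro: measurable_dilate1)
  moreover have "AE t in halfline. 0 < t * c"
    using c by (intro AE_I2) auto
  ultimately show ?thesis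
    by eventually_elim (use N in \<open>auto simp: indicator_def split: if_splits\<close>)
qed

text \<open>
  The index space \<open>N\<close> is general because the commutation of two operators needs the case of a
  product of two half-lines with \<open>\<delta>(u, v) = uv\<close>.
\<close>

lemma dilation_operator:
  assumes N: "sigma_finite_measure N" and p: "1 \<le> p"
    and h: "h \<in> Lp_space p"
    and [measurable]: "\<kappa> \<in> borel_measurable N" "\<delta> \<in> borel_measurable N"
    and pos: "\<And>y. y \<in> space N \<Longrightarrow> 0 < \<delta> y"
    and w: "integrable N (\<lambda>y. \<bar>\<kappa> y\<bar> * \<delta> y powr (-1 / p))"
      "(LINT y|N. \<bar>\<kappa> y\<bar> * \<delta> y powr (-1 / p)) \<le> C" "0 < C"
  shows "AE t in halfline. integrable N (\<lambda>y. \<kappa> y *\<^sub>R h (t * \<delta> y))"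
    and "(\<lambda>t. LINT y|N. \<kappa> y *\<^sub>R h (t * \<delta> y)) \<in> Lp_space p"
    and "Lp_norm p (\<lambda>t. LINT y|N. \<kappa> y *\<^sub>R h (t * \<delta> y)) \<le> C * Lp_norm p h"
proof -
  interpret N: sigma_finite_measure N by fact
  interpret P: pair_sigma_finite halfline N
    by (intro pair_sigma_finite.intro sigma_finite_halfline N)
  note [measurable] = Lp_space_measurable[OF h]
  have meas2 [measurable]: "(\<lambda>(t, y). h (t * \<delta> y)) \<in> borel_measurable (halfline \<Otimes>\<^sub>M N)"
    by (rule measurable_dilate_halfline) (auto intro: pos)
  have meas1 [measurable]: "(\<lambda>y. h (t * \<delta> y)) \<in> borel_measurable N" if "t > 0" for t
    using measurable_Pair2[OF meas2, of t] that by simp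
  \<comment> \<open>The kernel times the dilated function is split as \<open>v * x\<close>, with the
    powers of \<delta> arranged so that \<open>v\<close> has mass at most \<open>C\<close>, while
    the p-th power of \<open>x\<close> carries one factor \<delta>. That factor cancels the
    1/\<delta> from dilating the t-integral, so after Tonelli every y contributes the same
    \<open>B\<close>.\<close>
  define v where "v y = \<bar>\<kappa> y\<bar> * \<delta> y powr (-1 / p)" for y
  define x where "x t y = \<delta> y powr (1 / p) * norm (h (t * \<delta> y))" for t y
  have [measurable]: "v \<in> borel_measurable N" unfolding v_def by measurable
  have [measurable]: "(\<lambda>(t, y). x t y) \<in> borel_measurable (halfline \<Otimes>\<^sub>M N)"
    unfolding x_def by measurable
  have [measurable]: "x t \<in> borel_measurable N" if "t > 0" for t
    unfolding x_def using meas1[OF that] by measurable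
  have v0: "v y \<ge> 0" for y by (simp add: v_def)
  have x0: "x t y \<ge> 0" for t y by (simp add: x_def)
  have vint: "integrable N v" "integral\<^sup>L N v \<le> C" using w by (simp_all add: v_def[abs_def])
  have vx: "v y * x t y = \<bar>\<kappa> y\<bar> * norm (h (t * \<delta> y))" if "y \<in> space N" for t y
    using pos[OF that] by (simp add: v_def x_def powr_minus field_simps)
  have xp: "x t y powr p = \<delta> y * norm (h (t * \<delta> y)) powr p" if "y \<in> space N" for t y
    using pos[OF that] p by (simp add: x_def powr_mult powr_powr)
  define B where "B = (LINT t|halfline. norm (h t) powr p)"
  have B: "B = Lp_norm p h powr p" "B \<ge> 0"
    using p by (simp_all add: B_def Lp_norm_powr Lp_integral_nonneg)
  have "(\<integral>\<^sup>+t. (\<integral>\<^sup>+y. ennreal (v y * x t y powr p) \<partial>N) \<partial>halfline)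
      = (\<integral>\<^sup>+y. (\<integral>\<^sup>+t. ennreal (v y * x t y powr p) \<partial>halfline) \<partial>N)"
    by (rule P.Fubini'[symmetric]) measurable
  also have "\<dots> = (\<integral>\<^sup>+y. ennreal (v y) * ennreal B \<partial>N)"
  proof (rule nn_integral_cong)
    fix y assume y: "y \<in> space N"
    have "(\<integral>\<^sup>+t. ennreal (v y * x t y powr p) \<partial>halfline)
        = (\<integral>\<^sup>+t. ennreal (v y * \<delta> y) * ennreal (norm (h (t * \<delta> y)) powr p) \<partial>halfline)"
      using y v0[of y] pos[OF y] by (intro nn_integral_cong) (simp add: xp ennreal_mult[symmetric] mult.assoc)
    also have "\<dots> = ennreal (v y * \<delta> y) * (\<integral>\<^sup>+t. ennreal (norm (h (t * \<delta> y)) powr p) \<partial>halfline)"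
      by (intro nn_integral_cmult pos y
          measurable_dilate1[where h="\<lambda>t. ennreal (norm (h t) powr p)" and c="\<delta> y"]) measurable
    also have "(\<integral>\<^sup>+t. ennreal (norm (h (t * \<delta> y)) powr p) \<partial>halfline)
        = ennreal (1 / \<delta> y) * (\<integral>\<^sup>+t. ennreal (norm (h t) powr p) \<partial>halfline)"
      by (intro nn_integral_halfline_dilate[where g="\<lambda>t. ennreal (norm (h t) powr p)"] pos y) measurable
    also have "(\<integral>\<^sup>+t. ennreal (norm (h t) powr p) \<partial>halfline) = ennreal B"
      unfolding B_def by (intro nn_integral_eq_integral Lp_space_integrable h) auto
    finally show "(\<integral>\<^sup>+t. ennreal (v y * x t y powr p) \<partial>halfline) = ennreal (v y) * ennreal B"
      using pos[OF y] v0[of y] B by (simp add: ennreal_mult[symmetric] mult.assoc[symmetric])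
  qed
  also have "\<dots> = ennreal (integral\<^sup>L N v) * ennreal B"
    using vint v0 by (subst nn_integral_multc) (auto simp: nn_integral_eq_integral)
  also have "\<dots> \<le> ennreal C * ennreal B"
    by (intro mult_right_mono ennreal_leI vint) auto
  finally have J: "(\<integral>\<^sup>+t. (\<integral>\<^sup>+y. ennreal (v y * x t y powr p) \<partial>N) \<partial>halfline) \<le> ennreal (C * B)"
    using w B by (simp add: ennreal_mult)
  then have "(\<integral>\<^sup>+t. (\<integral>\<^sup>+y. ennreal (v y * x t y powr p) \<partial>N) \<partial>halfline) \<noteq> \<infinity>"
    by (auto simp: top_unique)
  then have "AE t in halfline. (\<integral>\<^sup>+y. ennreal (v y * x t y powr p) \<partial>N) \<noteq> \<infinity>"
    by (intro nn_integral_noteq_infinite) measurable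
  moreover have "AE t in halfline. 0 < t" by (intro AE_I2) auto
  ultimately have main: "AE t in halfline. integrable N (\<lambda>y. \<kappa> y *\<^sub>R h (t * \<delta> y)) \<and>
      ennreal (norm (LINT y|N. \<kappa> y *\<^sub>R h (t * \<delta> y)) powr p)
        \<le> ennreal (C powr (p - 1)) * (\<integral>\<^sup>+y. ennreal (v y * x t y powr p) \<partial>N)"
  proof eventually_elim
    case (elim t)
    note [measurable] = meas1[OF elim(2)]
    have int: "integrable N (\<lambda>y. v y * x t y powr p)"
      using elim v0 by (intro integrableI_nonneg) (auto simp: top.not_eq_extremum)
    have i1: "integrable N (\<lambda>y. v y * x t y)"
      by (rule jensen_weighted(1)[OF _ _ p v0 x0 vint w(3) int]) (use elim in measurable)
    have i1': "integrable N (\<lambda>y. norm (\<kappa> y *\<^sub>R h (t * \<delta> y)))"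
      using i1 by (rule Bochner_Integration.integrable_cong[THEN iffD1, rotated 2]) (auto simp: vx)
    then have i2: "integrable N (\<lambda>y. \<kappa> y *\<^sub>R h (t * \<delta> y))"
      by (subst (asm) integrable_norm_iff) measurable
    have "norm (LINT y|N. \<kappa> y *\<^sub>R h (t * \<delta> y)) \<le> (LINT y|N. norm (\<kappa> y *\<^sub>R h (t * \<delta> y)))"
      by (rule integral_norm_bound)
    also have "\<dots> = (LINT y|N. v y * x t y)"
      by (intro Bochner_Integration.integral_cong) (auto simp: vx)
    finally have "norm (LINT y|N. \<kappa> y *\<^sub>R h (t * \<delta> y)) powr p \<le> (LINT y|N. v y * x t y) powr p"
      using p by (intro powr_mono2) auto
    also have "\<dots> \<le> C powr (p - 1) * (LINT y|N. v y * x t y powr p)"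
      by (rule jensen_weighted(2)[OF _ _ p v0 x0 vint w(3) int]) (use elim in measurable)
    finally have "ennreal (norm (LINT y|N. \<kappa> y *\<^sub>R h (t * \<delta> y)) powr p)
        \<le> ennreal (C powr (p - 1)) * ennreal (LINT y|N. v y * x t y powr p)"
      using v0 by (subst ennreal_mult[symmetric]) (auto intro!: ennreal_leI)
    also have "ennreal (LINT y|N. v y * x t y powr p) = (\<integral>\<^sup>+y. ennreal (v y * x t y powr p) \<partial>N)"
      using v0 by (subst nn_integral_eq_integral[OF int]) auto
    finally show ?case using i2 by blast
  qed
  show "AE t in halfline. integrable N (\<lambda>y. \<kappa> y *\<^sub>R h (t * \<delta> y))"
    using main by eventually_elim simp
  let ?H = "\<lambda>t. LINT y|N. \<kappa> y *\<^sub>R h (t * \<delta> y)"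
  have [measurable]: "?H \<in> borel_measurable halfline"
    by measurable
  have "(\<integral>\<^sup>+t. ennreal (norm (?H t) powr p) \<partial>halfline)
      \<le> (\<integral>\<^sup>+t. ennreal (C powr (p - 1)) * (\<integral>\<^sup>+y. ennreal (v y * x t y powr p) \<partial>N) \<partial>halfline)"
    using main by (intro nn_integral_mono_AE) (auto elim: eventually_mono)
  also have "\<dots> = ennreal (C powr (p - 1)) * (\<integral>\<^sup>+t. (\<integral>\<^sup>+y. ennreal (v y * x t y powr p) \<partial>N) \<partial>halfline)"
    by (intro nn_integral_cmult) measurable
  also have "\<dots> \<le> ennreal (C powr (p - 1)) * ennreal (C * B)"
    by (intro mult_left_mono J) auto
  also have "\<dots> = ennreal ((C * Lp_norm p h) powr p)"
    using w B by (subst ennreal_mult[symmetric]) (auto simp: powr_mult powr_diff)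
  finally have le: "(\<integral>\<^sup>+t. ennreal (norm (?H t) powr p) \<partial>halfline) \<le> ennreal ((C * Lp_norm p h) powr p)" .
  have int: "integrable halfline (\<lambda>t. norm (?H t) powr p)"
    using le by (intro integrableI_nonneg) (auto simp: le_less_trans)
  then show "?H \<in> Lp_space p" by (simp add: Lp_space_def)
  from le have "ennreal (LINT t|halfline. norm (?H t) powr p) \<le> ennreal ((C * Lp_norm p h) powr p)"
    by (subst (asm) nn_integral_eq_integral[OF int]) auto
  then show "Lp_norm p ?H \<le> C * Lp_norm p h"
    using w p by (simp add: Lp_norm_le_iff)
qed

text \<open>With s = tu this is the integral operator whose kernel k(s/t)/t is homogeneous of degree
  -1, that is, a convolution operator for the multiplicative group of positive reals.\<close>

definition hom_op :: "(real \<Rightarrow> real) \<Rightarrow> (real \<Rightarrow> complex) \<Rightarrow> real \<Rightarrow> complex" where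
  "hom_op k h t = (LINT u|halfline. k u *\<^sub>R h (t * u))"

text \<open>The integral of the kernel's absolute value against the L^p norms of the dilations; it
  is the Mellin transform of the absolute value at 1 - 1/p.\<close>

definition kernel_mass :: "real \<Rightarrow> (real \<Rightarrow> real) \<Rightarrow> real" where
  "kernel_mass p k = (LINT u|halfline. \<bar>k u\<bar> * u powr (-1 / p))"

definition hom_kernel :: "real \<Rightarrow> (real \<Rightarrow> real) \<Rightarrow> bool" where
  "hom_kernel p k \<longleftrightarrow> k \<in> borel_measurable halfline \<and> integrable halfline (\<lambda>u. \<bar>k u\<bar> * u powr (-1 / p))"

lemma kernel_mass_nonneg: "0 \<le> kernel_mass p k"
  unfolding kernel_mass_def by (intro integral_nonneg_AE AE_I2) auto

text \<open>The mass may be 0, whereas \<open>dilation_operator\<close> takes a positive constant.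
  It is therefore applied with any \<open>C\<close> above the mass, and the excess tends to 0 at the
  end.\<close>

lemma
  assumes p: "1 \<le> p" and h: "h \<in> Lp_space p" and k: "hom_kernel p k"
  shows hom_op_integrable: "AE t in halfline. integrable halfline (\<lambda>u. k u *\<^sub>R h (t * u))"
    and hom_op_Lp: "hom_op k h \<in> Lp_space p"
    and hom_op_norm: "Lp_norm p (hom_op k h) \<le> kernel_mass p k * Lp_norm p h"
proof -
  have *: "AE t in halfline. integrable halfline (\<lambda>u. k u *\<^sub>R h (t * u))"
    "hom_op k h \<in> Lp_space p" "Lp_norm p (hom_op k h) \<le> C * Lp_norm p h"
    if "kernel_mass p k < C" for C
  proof -
    have C: "C > 0" using that kernel_mass_nonneg[of p k] by linarith
    note D = dilation_operator[where \<kappa>=k and \<delta>="\<lambda>u. u" and C=C, OF sigma_finite_halfline p h _ _ _ _ _ C]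
    show "AE t in halfline. integrable halfline (\<lambda>u. k u *\<^sub>R h (t * u))"
      by (rule D) (use k that in \<open>auto simp: hom_kernel_def kernel_mass_def\<close>)
    show "hom_op k h \<in> Lp_space p"
      unfolding hom_op_def[abs_def] by (rule D) (use k that in \<open>auto simp: hom_kernel_def kernel_mass_def\<close>)
    show "Lp_norm p (hom_op k h) \<le> C * Lp_norm p h"
      unfolding hom_op_def[abs_def] by (rule D) (use k that in \<open>auto simp: hom_kernel_def kernel_mass_def\<close>)
  qed
  show "AE t in halfline. integrable halfline (\<lambda>u. k u *\<^sub>R h (t * u))" "hom_op k h \<in> Lp_space p"
    by (rule *[of "kernel_mass p k + 1"], simp)+
  show "Lp_norm p (hom_op k h) \<le> kernel_mass p k * Lp_norm p h"
  proof (rule field_le_epsilon)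
    fix e :: real assume e: "e > 0"
    have "Lp_norm p (hom_op k h) \<le> (kernel_mass p k + e / (Lp_norm p h + 1)) * Lp_norm p h"
      using e by (intro *) (simp add: add_nonneg_pos)
    also have "\<dots> = kernel_mass p k * Lp_norm p h + e * (Lp_norm p h / (Lp_norm p h + 1))"
      by (simp add: algebra_simps)
    also have "\<dots> \<le> kernel_mass p k * Lp_norm p h + e * 1"
      using e by (intro add_left_mono mult_left_mono) (auto simp: divide_le_eq add_nonneg_pos)
    finally show "Lp_norm p (hom_op k h) \<le> kernel_mass p k * Lp_norm p h + e" by simp
  qed
qed

text \<open>By \<open>AE_halfline_dilate\<close> the two integrands agree for almost every u at each
  fixed t. The equality therefore holds at every positive t, which allows an almost-everywhere
  identity to be inserted under a second operator.\<close>

lemma hom_op_cong_AE: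
  assumes eq: "AE t in halfline. h t = h' t" and t: "0 < t"
    and m: "h \<in> borel_measurable halfline" "h' \<in> borel_measurable halfline" "k \<in> borel_measurable halfline"
  shows "hom_op k h t = hom_op k h' t"
proof -
  note [measurable] = measurable_dilate1[OF m(1) t] measurable_dilate1[OF m(2) t] m(3)
  have "(\<lambda>u. h (t * u)) \<in> borel_measurable halfline" "(\<lambda>u. h' (t * u)) \<in> borel_measurable halfline"
    using measurable_dilate1[OF m(1) t] measurable_dilate1[OF m(2) t] by (simp_all add: mult.commute)
  note [measurable] = this
  show ?thesis
    unfolding hom_op_def
  proof (rule integral_cong_AE)
    show "AE u in halfline. k u *\<^sub>R h (t * u) = k u *\<^sub>R h' (t * u)"
      using AE_halfline_dilate[OF eq t] by eventually_elim (simp add: mult.commute)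
  qed measurable
qed

lemma hom_op_diff:
  assumes p: "1 \<le> p" and h: "h \<in> Lp_space p" "h' \<in> Lp_space p" and k: "hom_kernel p k"
  shows "AE t in halfline. hom_op k (\<lambda>s. h s - h' s) t = hom_op k h t - hom_op k h' t"
  using hom_op_integrable[OF p h(1) k] hom_op_integrable[OF p h(2) k]
  by eventually_elim (simp add: hom_op_def algebra_simps)

text \<open>Both orders are iterated integrals of k(u) l(v) h(tuv). Absolute integrability over the
  product, for almost every t, comes from \<open>dilation_operator\<close> on the product index
  space.\<close>

lemma hom_op_commute:
  assumes p: "1 \<le> p" and h: "h \<in> Lp_space p" and k: "hom_kernel p k" and l: "hom_kernel p l"
  shows "AE t in halfline. hom_op k (hom_op l h) t = hom_op l (hom_op k h) t"
proof -
  interpret P: pair_sigma_finite halfline halfline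
    by (intro pair_sigma_finite.intro sigma_finite_halfline)
  have m [measurable]: "k \<in> borel_measurable halfline" "l \<in> borel_measurable halfline"
    and int: "integrable halfline (\<lambda>u. \<bar>k u\<bar> * u powr (-1 / p))" "integrable halfline (\<lambda>u. \<bar>l u\<bar> * u powr (-1 / p))"
    using k l by (auto simp: hom_kernel_def)
  define K where "K u = \<bar>k u\<bar> * u powr (-1 / p)" for u
  define L where "L u = \<bar>l u\<bar> * u powr (-1 / p)" for u
  have [measurable]: "K \<in> borel_measurable halfline" "L \<in> borel_measurable halfline"
    unfolding K_def L_def by measurable
  have KL: "integrable halfline K" "integrable halfline L" using int by (simp_all add: K_def[abs_def] L_def[abs_def])
  let ?N = "halfline \<Otimes>\<^sub>M halfline"
  define \<kappa> where "\<kappa> z = k (fst z) * l (snd z)" for z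
  define \<delta> where "\<delta> z = fst z * snd z" for z :: "real \<times> real"
  have [measurable]: "\<kappa> \<in> borel_measurable ?N" "\<delta> \<in> borel_measurable ?N"
    unfolding \<kappa>_def \<delta>_def by measurable
  have pos: "0 < \<delta> z" if "z \<in> space ?N" for z
    using that by (auto simp: \<delta>_def space_pair_measure)
  \<comment> \<open>Since (uv)^(-1/p) factors, the weight on the product space is the product of the
    two weights.\<close>
  have prod: "integrable ?N (\<lambda>(u, v). K u * L v)"
  proof (rule P.Fubini_integrable)
    show "integrable halfline (\<lambda>x. LINT y|halfline. norm (case (x, y) of (u, v) \<Rightarrow> K u * L v))"
      using KL by (simp add: abs_mult)
    show "AE x in halfline. integrable halfline (\<lambda>y. case (x, y) of (u, v) \<Rightarrow> K u * L v)"
      using KL by (intro AE_I2) simp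
  qed measurable
  have w: "integrable ?N (\<lambda>z. \<bar>\<kappa> z\<bar> * \<delta> z powr (-1 / p))"
    by (rule Bochner_Integration.integrable_cong[THEN iffD1, OF refl _ prod])
      (auto simp: space_pair_measure \<kappa>_def \<delta>_def K_def L_def abs_mult powr_mult)
  define C where "C = (LINT z|?N. \<bar>\<kappa> z\<bar> * \<delta> z powr (-1 / p)) + 1"
  have C: "(LINT z|?N. \<bar>\<kappa> z\<bar> * \<delta> z powr (-1 / p)) \<le> C" "0 < C"
    unfolding C_def by (auto intro!: add_nonneg_pos integral_nonneg_AE)
  have N: "sigma_finite_measure ?N" by (rule P.sigma_finite_measure_axioms)
  have "AE t in halfline. integrable ?N (\<lambda>z. \<kappa> z *\<^sub>R h (t * \<delta> z))"
    by (rule dilation_operator(1)[OF N p h _ _ pos w C]) auto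
  then show ?thesis
  proof eventually_elim
    case (elim t)
    have int: "integrable ?N (case_prod (\<lambda>u v. (k u * l v) *\<^sub>R h (t * (u * v))))"
      using elim by (simp add: \<kappa>_def \<delta>_def case_prod_beta')
    have "hom_op k (hom_op l h) t = (LINT u|halfline. LINT v|halfline. (k u * l v) *\<^sub>R h (t * (u * v)))"
      unfolding hom_op_def by (simp add: integral_scaleR_right[symmetric] mult.assoc del: integral_scaleR_right)
    also have "\<dots> = (LINT v|halfline. LINT u|halfline. (k u * l v) *\<^sub>R h (t * (u * v)))"
      by (rule P.Fubini_integral[OF int, symmetric])
    also have "\<dots> = hom_op l (hom_op k h) t"
      unfolding hom_op_def by (simp add: integral_scaleR_right[symmetric] mult_ac del: integral_scaleR_right)
    finally show ?case .
  qed
qed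

section \<open>Weyl fractional integrals\<close>

lemma integrable_halfline_iff:
  "integrable halfline f \<longleftrightarrow> set_integrable lborel {0<..} (f :: real \<Rightarrow> 'a :: {banach, second_countable_topology})"
  by (simp add: set_integrable_def integrable_restrict_space)

lemma integral_halfline_eq:
  "integral\<^sup>L halfline f = (LINT t:{0<..}|lborel. (f t :: 'a :: {banach, second_countable_topology}))"
  by (simp add: set_lebesgue_integral_def integral_restrict_space)

lemma measurable_halfline_iff:
  fixes f :: "real \<Rightarrow> 'a :: real_normed_vector"
  shows "f \<in> borel_measurable halfline \<longleftrightarrow> set_borel_measurable borel {0<..} f"
  by (simp add: set_borel_measurable_def borel_measurable_restrict_space_iff)

text \<open>Transported from the completed measure, on which Borel functions have the same
  integrals. If one side is not integrable neither is the other, and both integrals are 0 by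
  convention.\<close>

lemma lborel_change_of_variables:
  fixes f :: "real \<Rightarrow> 'a :: euclidean_space" and g :: "real \<Rightarrow> real"
  assumes S: "S \<in> sets borel" "g ` S \<in> sets borel"
    and g: "\<And>x. x \<in> S \<Longrightarrow> (g has_field_derivative g' x) (at x within S)" "inj_on g S"
    and m: "set_borel_measurable borel (g ` S) f" "set_borel_measurable borel S (\<lambda>x. \<bar>g' x\<bar> *\<^sub>R f (g x))"
  shows "set_integrable lborel (g ` S) f \<longleftrightarrow> set_integrable lborel S (\<lambda>x. \<bar>g' x\<bar> *\<^sub>R f (g x))"
    and "(LINT x:g ` S|lborel. f x) = (LINT x:S|lborel. \<bar>g' x\<bar> *\<^sub>R f (g x))"
proof -
  have c: "set_integrable lebesgue A h \<longleftrightarrow> set_integrable lborel A h"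
      "(LINT x:A|lebesgue. h x) = (LINT x:A|lborel. h x)"
    if "set_borel_measurable borel A h" for A and h :: "real \<Rightarrow> 'a"
    using that by (simp_all add: set_integrable_def set_lebesgue_integral_def set_borel_measurable_def
      integrable_completion integral_completion)
  have iff: "set_integrable lebesgue (g ` S) f \<longleftrightarrow> set_integrable lebesgue S (\<lambda>x. \<bar>g' x\<bar> *\<^sub>R f (g x))"
    by (rule absolutely_integrable_change_of_variables_real) (use S g in auto)
  then show iff': "set_integrable lborel (g ` S) f \<longleftrightarrow> set_integrable lborel S (\<lambda>x. \<bar>g' x\<bar> *\<^sub>R f (g x))"
    using c(1)[OF m(1)] c(1)[OF m(2)] by simp
  show "(LINT x:g ` S|lborel. f x) = (LINT x:S|lborel. \<bar>g' x\<bar> *\<^sub>R f (g x))"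
  proof (cases "set_integrable lborel (g ` S) f")
    case True
    then have i: "set_integrable lebesgue (g ` S) f" using c(1)[OF m(1)] by simp
    then have "integral S (\<lambda>x. \<bar>g' x\<bar> *\<^sub>R f (g x)) = integral (g ` S) f"
      using has_absolute_integral_change_of_variables_real[of S g g' f "integral (g ` S) f"] S g by auto
    then show ?thesis
      using i iff c[OF m(1)] c[OF m(2)] by (simp add: set_lebesgue_integral_eq_integral)
  next
    case False
    then have "(LINT x:g ` S|lborel. f x) = 0"
      by (simp add: set_integrable_def set_lebesgue_integral_def not_integrable_integral_eq)
    moreover have "(LINT x:S|lborel. \<bar>g' x\<bar> *\<^sub>R f (g x)) = 0"
      using False unfolding iff' by (simp add: set_integrable_def set_lebesgue_integral_def not_integrable_integral_eq)
    ultimately show ?thesis by simp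
  qed
qed

lemma Beta_pos: "0 < a \<Longrightarrow> 0 < b \<Longrightarrow> 0 < Beta a (b :: real)"
  by (simp add: Beta_def)

lemma has_bochner_integral_Beta:
  fixes a b :: real
  assumes "0 < a" "0 < b"
  shows "has_bochner_integral lborel (\<lambda>x. indicator {0<..<1} x * (x powr (a - 1) * (1 - x) powr (b - 1))) (Beta a b)"
proof -
  have 1: "has_bochner_integral lborel (\<lambda>x. indicator {0..1} x *\<^sub>R (x powr (a - 1) * (1 - x) powr (b - 1))) (Beta a b)"
    using integrable_Beta[OF assms] set_borel_integral_eq_integral(2)[OF integrable_Beta[OF assms]]
      has_integral_Beta_real[OF assms]
    by (simp add: has_bochner_integral_iff set_integrable_def set_lebesgue_integral_def integral_unique)
  show ?thesis
    by (rule has_bochner_integral_cong[THEN iffD1, OF refl _ refl 1]) (auto simp: indicator_def)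
qed

text \<open>The affine substitution of (t, r) to the unit interval. This is the inner integral when
  two Weyl integrals are composed.\<close>

lemma has_bochner_integral_Beta_interval:
  fixes a b :: real
  assumes ab: "0 < a" "0 < b" and tr: "t < r"
  shows "has_bochner_integral lborel (\<lambda>s. indicator {t<..<r} s * ((s - t) powr (a - 1) * (r - s) powr (b - 1)))
    (Beta a b * (r - t) powr (a + b - 1))"
proof -
  define d where "d = r - t"
  have d: "d > 0" using tr by (simp add: d_def)
  have "has_bochner_integral lborel (\<lambda>s. indicator {0<..<1} (- t / d + 1 / d * s) *
      ((- t / d + 1 / d * s) powr (a - 1) * (1 - (- t / d + 1 / d * s)) powr (b - 1))) (Beta a b /\<^sub>R \<bar>1 / d\<bar>)"
    using has_bochner_integral_Beta[OF ab] d
    by (subst (asm) lborel_has_bochner_integral_real_affine_iff[where c="1 / d" and t="- t / d"]) auto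
  \<comment> \<open>The exponent \<open>a + b - 2\<close> undoes the scaling of both factors of the
    integrand; the Jacobian contributes one more power of \<open>d\<close>.\<close>
  then have "has_bochner_integral lborel (\<lambda>s. d powr (a + b - 2) * (indicator {0<..<1} (- t / d + 1 / d * s) *
      ((- t / d + 1 / d * s) powr (a - 1) * (1 - (- t / d + 1 / d * s)) powr (b - 1))))
      (d powr (a + b - 2) * (Beta a b /\<^sub>R \<bar>1 / d\<bar>))"
    by (intro has_bochner_integral_mult_right) auto
  moreover have "d powr (a + b - 2) * (Beta a b /\<^sub>R \<bar>1 / d\<bar>) = Beta a b * d powr (a + b - 1)"
    using d by (simp add: powr_diff powr_add power2_eq_square)
  moreover have "d powr (a + b - 2) * (indicator {0<..<1} (- t / d + 1 / d * s) *
      ((- t / d + 1 / d * s) powr (a - 1) * (1 - (- t / d + 1 / d * s)) powr (b - 1)))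
    = indicator {t<..<r} s * ((s - t) powr (a - 1) * (r - s) powr (b - 1))" for s
  proof -
    have e: "- t / d + 1 / d * s = (s - t) / d" "1 - (s - t) / d = (r - s) / d"
    proof -
      show "- t / d + 1 / d * s = (s - t) / d" by (simp add: diff_divide_distrib)
      have "1 - (s - t) / d = (d - (s - t)) / d" using d by (simp add: diff_divide_distrib)
      then show "1 - (s - t) / d = (r - s) / d" by (simp add: d_def)
    qed
    show ?thesis
    proof (cases "t < s \<and> s < r")
      case True
      then have "(s - t) / d \<in> {0<..<1}" using d by (auto simp: d_def)
      then show ?thesis using True d unfolding e
        by (simp add: powr_divide powr_add powr_diff power2_eq_square)
    next
      case False
      then have "(s - t) / d \<notin> {0<..<1}" using d by (auto simp: d_def field_simps)
      then show ?thesis using False unfolding e by auto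
    qed
  qed
  ultimately show ?thesis by (simp only: d_def)
qed

text \<open>Substitute x = u / (1 + u), where 1 - x = 1 / (1 + u) and dx = du / (1 + u)^2. Up to
  renaming exponents this is the mass of the Stieltjes kernel.\<close>

lemma has_bochner_integral_Beta_halfline:
  fixes a b :: real
  assumes ab: "0 < a" "0 < b"
  shows "has_bochner_integral halfline (\<lambda>u. u powr (a - 1) / (1 + u) powr (a + b)) (Beta a b)"
proof -
  define g where "g u = u / (1 + u)" for u :: real
  let ?f = "\<lambda>x. x powr (a - 1) * (1 - x) powr (b - 1)"
  have img: "g ` {0<..} = {0<..<1}"
  proof
    show "{0<..<1} \<subseteq> g ` {0<..}"
    proof
      fix x :: real assume "x \<in> {0<..<1}"
      then show "x \<in> g ` {0<..}"
        by (intro image_eqI[of _ _ "x / (1 - x)"]) (auto simp: g_def field_simps)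
    qed
  qed (auto simp: g_def)
  have der: "(g has_field_derivative 1 / (1 + u)\<^sup>2) (at u within {0<..})" if "u \<in> {0<..}" for u
    unfolding g_def using that
    by (auto intro!: derivative_eq_intros simp: field_simps power2_eq_square)
  have inj: "inj_on g {0<..}"
    by (auto simp: inj_on_def g_def field_simps)
  have eq: "\<bar>1 / (1 + u)\<^sup>2\<bar> *\<^sub>R ?f (g u) = u powr (a - 1) / (1 + u) powr (a + b)" if "u > 0" for u
  proof -
    have "1 - g u = 1 / (1 + u)" using that by (simp add: g_def field_simps)
    then show ?thesis
      using that by (simp add: g_def powr_divide powr_add powr_diff power2_eq_square)
  qed
  have B: "set_integrable lborel (g ` {0<..}) ?f" "(LINT x:g ` {0<..}|lborel. ?f x) = Beta a b"
    using has_bochner_integral_Beta[OF ab] unfolding img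
    by (simp_all add: has_bochner_integral_iff set_integrable_def set_lebesgue_integral_def)
  have [measurable]: "g \<in> borel_measurable borel" unfolding g_def by measurable
  have m: "set_borel_measurable borel (g ` {0<..}) ?f"
      "set_borel_measurable borel {0<..} (\<lambda>u. \<bar>1 / (1 + u)\<^sup>2\<bar> *\<^sub>R ?f (g u))"
    unfolding set_borel_measurable_def img by measurable
  note cv = lborel_change_of_variables[OF _ _ der inj m]
  have "set_integrable lborel {0<..} (\<lambda>u. \<bar>1 / (1 + u)\<^sup>2\<bar> *\<^sub>R ?f (g u))"
    "(LINT u:{0<..}|lborel. \<bar>1 / (1 + u)\<^sup>2\<bar> *\<^sub>R ?f (g u)) = Beta a b"
    using cv B by (simp_all add: img)
  then have 1: "has_bochner_integral halfline (\<lambda>u. \<bar>1 / (1 + u)\<^sup>2\<bar> *\<^sub>R ?f (g u)) (Beta a b)"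
    by (simp add: has_bochner_integral_iff integrable_halfline_iff integral_halfline_eq)
  show ?thesis
    by (rule has_bochner_integral_cong[THEN iffD1, OF refl _ refl 1]) (use eq in auto)
qed

text \<open>A stock of majorants with prescribed behaviour at 0 and at infinity, used for all later
  dominations by powers.\<close>

lemma integrable_Beta_halfline:
  "0 < a \<Longrightarrow> 0 < b \<Longrightarrow> integrable halfline (\<lambda>u. C * (u powr (a - 1) / (1 + u) powr (a + b)) :: real)"
  using has_bochner_integral_Beta_halfline[of a b] unfolding has_bochner_integral_iff
  by (intro integrable_mult_right) blast

lemma weyl_integral_scaleR: "weyl_integral a (\<lambda>s. c *\<^sub>R f s) t = c *\<^sub>R weyl_integral a f t"
  unfolding weyl_integral_def set_lebesgue_integral_def
  by (simp only: scaleR_left_commute[of _ c] integral_scaleR_right)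

text \<open>Fubini's theorem on the triangle t < s < r: the integral over s is a Beta integral, and
  B(a, b) turns the product of the Gamma factors into that of order a + b. Absolute convergence at
  order a + b is what makes the double integral converge.\<close>

lemma weyl_integral_compose:
  fixes g :: "real \<Rightarrow> complex"
  assumes ab: "0 < a" "0 < b"
    and int: "set_integrable lborel {t<..} (\<lambda>r. (r - t) powr (a + b - 1) *\<^sub>R g r)"
    and m: "set_borel_measurable borel {t<..} g"
  shows "set_integrable lborel {t<..} (\<lambda>s. (s - t) powr (a - 1) *\<^sub>R weyl_integral b g s)"
    and "weyl_integral a (weyl_integral b g) t = weyl_integral (a + b) g t"
proof -
  have Gab: "Gamma a \<noteq> 0" "Gamma b \<noteq> 0"
    using Gamma_real_pos[OF ab(1)] Gamma_real_pos[OF ab(2)] by simp_all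
  define G where "G r = indicator {t<..} r *\<^sub>R g r" for r
  have [measurable]: "G \<in> borel_measurable borel"
    using m by (simp add: set_borel_measurable_def G_def[abs_def])
  \<comment> \<open>The integrand on the triangle. Integrating out \<open>s\<close> gives the Beta
    value (\<open>in1\<close> to \<open>in3\<close>), integrating out \<open>r\<close> gives the
    inner Weyl integral (\<open>eq\<close>).\<close>
  define F where "F r s = (indicator {t<..<r} s * ((s - t) powr (a - 1) * (r - s) powr (b - 1))) *\<^sub>R G r" for r s
  have ind: "indicator {t<..<r} s = (if t < s \<and> s < r then 1 else 0 :: real)" for r s :: real
    by (auto simp: indicator_def)
  have Fm [measurable]: "case_prod F \<in> borel_measurable (lborel \<Otimes>\<^sub>M lborel)"
    unfolding F_def ind by measurable
  have in1: "integrable lborel (F r)" and in2: "(LINT s|lborel. norm (F r s)) = Beta a b * norm ((r - t) powr (a + b - 1) *\<^sub>R G r)"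
    and in3: "(LINT s|lborel. F r s) = Beta a b *\<^sub>R ((r - t) powr (a + b - 1) *\<^sub>R G r)" for r
  proof -
    have "integrable lborel (F r) \<and> (LINT s|lborel. norm (F r s)) = Beta a b * norm ((r - t) powr (a + b - 1) *\<^sub>R G r)
       \<and> (LINT s|lborel. F r s) = Beta a b *\<^sub>R ((r - t) powr (a + b - 1) *\<^sub>R G r)"
    proof (cases "t < r")
      case True
      note B = has_bochner_integral_Beta_interval[OF ab True]
      have "norm (F r s) = (indicator {t<..<r} s * ((s - t) powr (a - 1) * (r - s) powr (b - 1))) * norm (G r)" for s
        by (simp add: F_def)
      then show ?thesis
        using B unfolding F_def has_bochner_integral_iff by simp
    next
      case False
      then have "G r = 0" by (simp add: G_def)
      then show ?thesis by (simp add: F_def[abs_def])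
    qed
    then show "integrable lborel (F r)" "(LINT s|lborel. norm (F r s)) = Beta a b * norm ((r - t) powr (a + b - 1) *\<^sub>R G r)"
      "(LINT s|lborel. F r s) = Beta a b *\<^sub>R ((r - t) powr (a + b - 1) *\<^sub>R G r)" by blast+
  qed
  have intG: "integrable lborel (\<lambda>r. (r - t) powr (a + b - 1) *\<^sub>R G r)"
    using int by (simp add: set_integrable_def G_def mult_ac)
  have FI: "integrable (lborel \<Otimes>\<^sub>M lborel) (case_prod F)"
  proof (rule lborel_pair.Fubini_integrable)
    show "integrable lborel (\<lambda>r. LINT s|lborel. norm (case (r, s) of (r, s) \<Rightarrow> F r s))"
      using integrable_norm[OF intG] by (simp add: in2 del: norm_scaleR)
  qed (auto simp: in1)
  have eq: "(LINT r|lborel. F r s) = Gamma b *\<^sub>R (indicator {t<..} s *\<^sub>R ((s - t) powr (a - 1) *\<^sub>R weyl_integral b g s))" for s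
  proof -
    have "F r s = (indicator {t<..} s * (s - t) powr (a - 1)) *\<^sub>R (indicator {s<..} r *\<^sub>R ((r - s) powr (b - 1) *\<^sub>R g r))" for r
      by (auto simp: F_def G_def indicator_def)
    then have "(LINT r|lborel. F r s) = (LINT r|lborel. (indicator {t<..} s * (s - t) powr (a - 1)) *\<^sub>R
        (indicator {s<..} r *\<^sub>R ((r - s) powr (b - 1) *\<^sub>R g r)))"
      by (intro Bochner_Integration.integral_cong refl)
    also have "\<dots> = (indicator {t<..} s * (s - t) powr (a - 1)) *\<^sub>R
        (LINT r:{s<..}|lborel. (r - s) powr (b - 1) *\<^sub>R g r)"
      unfolding set_lebesgue_integral_def by (rule integral_scaleR_right)
    also have "(LINT r:{s<..}|lborel. (r - s) powr (b - 1) *\<^sub>R g r) = Gamma b *\<^sub>R weyl_integral b g s"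
      using Gab by (simp add: weyl_integral_def)
    finally show ?thesis by (simp add: mult_ac)
  qed
  have "integrable lborel (\<lambda>s. LINT r|lborel. F r s)"
    by (rule lborel_pair.integrable_snd) (rule FI)
  then have "integrable lborel (\<lambda>s. (1 / Gamma b) *\<^sub>R (LINT r|lborel. F r s))"
    by (intro integrable_scaleR_right)
  then show "set_integrable lborel {t<..} (\<lambda>s. (s - t) powr (a - 1) *\<^sub>R weyl_integral b g s)"
    using Gab by (simp only: eq) (simp add: set_integrable_def)
  have "(LINT s|lborel. LINT r|lborel. F r s) = (LINT r|lborel. LINT s|lborel. F r s)"
    by (rule lborel_pair.Fubini_integral[OF FI])
  also have "\<dots> = Beta a b *\<^sub>R (LINT r|lborel. (r - t) powr (a + b - 1) *\<^sub>R G r)"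
    unfolding in3 by (rule integral_scaleR_right)
  also have "(LINT r|lborel. (r - t) powr (a + b - 1) *\<^sub>R G r) = (LINT r:{t<..}|lborel. (r - t) powr (a + b - 1) *\<^sub>R g r)"
    by (simp add: set_lebesgue_integral_def G_def mult_ac)
  moreover have "(LINT s|lborel. LINT r|lborel. F r s)
      = Gamma b *\<^sub>R (LINT s:{t<..}|lborel. (s - t) powr (a - 1) *\<^sub>R weyl_integral b g s)"
    unfolding eq set_lebesgue_integral_def by (rule integral_scaleR_right)
  ultimately have "Gamma b *\<^sub>R (LINT s:{t<..}|lborel. (s - t) powr (a - 1) *\<^sub>R weyl_integral b g s)
      = Beta a b *\<^sub>R (LINT r:{t<..}|lborel. (r - t) powr (a + b - 1) *\<^sub>R g r)"
    by simp
  then have "(LINT s:{t<..}|lborel. (s - t) powr (a - 1) *\<^sub>R weyl_integral b g s)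
      = (Beta a b / Gamma b) *\<^sub>R (LINT r:{t<..}|lborel. (r - t) powr (a + b - 1) *\<^sub>R g r)"
    using Gab by (simp add: eq_vector_fraction_iff)
  then show "weyl_integral a (weyl_integral b g) t = weyl_integral (a + b) g t"
    using Gab by (simp add: weyl_integral_def[of a] weyl_integral_def[of "a + b"] Beta_def)
qed

text \<open>The Weyl integral of order \<open>a\<close> after multiplication by s^(-c), in the
  variable u = s/t. The order and the weight are separate parameters because the injectivity proof
  combines unequal ones.\<close>

definition weyl_kernel :: "real \<Rightarrow> real \<Rightarrow> real \<Rightarrow> real" where
  "weyl_kernel a c u = indicator {1<..} u * ((u - 1) powr (a - 1) * u powr (- c))"

text \<open>The shift u = 1 + v turns the mass into the Beta integral with parameters a and c + 1/p
  - a: the first bound on \<open>a\<close> governs u near 1, the second governs infinity.\<close>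

lemma hom_kernel_weyl:
  assumes a: "0 < a" "a < c + 1 / p"
  shows "hom_kernel p (weyl_kernel a c)"
proof -
  have m: "weyl_kernel a c \<in> borel_measurable halfline"
    unfolding weyl_kernel_def by measurable
  have "integrable halfline (\<lambda>u. u powr (a - 1) / (1 + u) powr (a + (c + 1 / p - a)))"
    using has_bochner_integral_Beta_halfline[of a "c + 1 / p - a"] a by (simp add: has_bochner_integral_iff)
  then have "integrable lborel (\<lambda>u. indicator {0<..} u * (u powr (a - 1) / (1 + u) powr (c + 1 / p)))"
    by (simp add: integrable_halfline_iff set_integrable_def)
  from lborel_integrable_real_affine[OF this, of 1 "-1"]
  have 1: "integrable lborel (\<lambda>u. indicator {0<..} (-1 + u) * ((-1 + u) powr (a - 1) / u powr (c + 1 / p)))"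
    by simp
  have "integrable lborel (\<lambda>u. indicator {0<..} u *\<^sub>R (\<bar>weyl_kernel a c u\<bar> * u powr (-1 / p)))"
    by (rule Bochner_Integration.integrable_cong[THEN iffD1, OF refl _ 1])
      (auto simp: weyl_kernel_def indicator_def powr_add powr_minus abs_mult divide_inverse)
  then show ?thesis
    using m by (simp add: hom_kernel_def integrable_halfline_iff set_integrable_def)
qed

text \<open>The substitution s = tu; both sides are 0 by convention when the integral diverges, so
  the identity is valid at every positive t.\<close>

lemma hom_op_weyl:
  assumes a: "0 < a" and t: "0 < t"
  shows "hom_op (weyl_kernel a c) h t = (t powr (c - a) * Gamma a) *\<^sub>R weyl_integral a (\<lambda>s. s powr (- c) *\<^sub>R h s) t"
proof -
  define F where "F s = indicator {t<..} s *\<^sub>R ((s - t) powr (a - 1) *\<^sub>R (s powr (- c) *\<^sub>R h s))" for s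
  have "F (0 + t * u) = t powr (a - 1 - c) *\<^sub>R (indicator {0<..} u *\<^sub>R (weyl_kernel a c u *\<^sub>R h (t * u)))" for u
  proof (cases "1 < u")
    case True
    have "(t * u - t) powr (a - 1) = (t * (u - 1)) powr (a - 1)" by (simp add: algebra_simps)
    also have "\<dots> = t powr (a - 1) * (u - 1) powr (a - 1)"
      using True t by (intro powr_mult)
    moreover have "(t * u) powr (- c) = t powr (- c) * u powr (- c)"
      using True t by (intro powr_mult)
    moreover have "t powr (a - 1 - c) = t powr (a - 1) * t powr (- c)"
      by (simp add: powr_add[symmetric])
    ultimately have "(t * u - t) powr (a - 1) * (t * u) powr (- c) = t powr (a - 1 - c) * weyl_kernel a c u"
      using True by (simp only: weyl_kernel_def) (simp add: mult_ac)
    then show ?thesis using True t by (simp add: F_def)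
  next
    case False
    then show ?thesis using t by (simp add: F_def weyl_kernel_def)
  qed
  then have "(LINT u|lborel. F (0 + t * u)) = (LINT u|lborel. t powr (a - 1 - c) *\<^sub>R
      (indicator {0<..} u *\<^sub>R (weyl_kernel a c u *\<^sub>R h (t * u))))"
    by (simp only:)
  also have "\<dots> = t powr (a - 1 - c) *\<^sub>R hom_op (weyl_kernel a c) h t"
    unfolding hom_op_def integral_halfline_eq set_lebesgue_integral_def by (rule integral_scaleR_right)
  finally have "integral\<^sup>L lborel F = t *\<^sub>R (t powr (a - 1 - c) *\<^sub>R hom_op (weyl_kernel a c) h t)"
    using lborel_integral_real_affine[of t F 0] t by simp
  moreover have "weyl_integral a (\<lambda>s. s powr (- c) *\<^sub>R h s) t = (1 / Gamma a) *\<^sub>R integral\<^sup>L lborel F"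
    by (simp only: weyl_integral_def set_lebesgue_integral_def F_def[abs_def])
  moreover have "Gamma a \<noteq> 0" using Gamma_real_pos[OF a] by simp
  ultimately show ?thesis
    using t by (simp add: powr_diff)
qed

text \<open>Takes the place of Hoelder's inequality: \<open>le_add_powr\<close> is used with the
  scale l = r^(-1/p). The first condition on \<open>q\<close> integrates the term l, the second
  bounds the coefficient of the p-th power of h.\<close>

lemma Lp_integrable_weight:
  assumes p: "1 \<le> p" and h: "h \<in> Lp_space p"
    and [measurable]: "q \<in> borel_measurable halfline"
    and q: "integrable halfline (\<lambda>r. \<bar>q r\<bar> * r powr (-1 / p))"
    and K: "\<And>r. 0 < r \<Longrightarrow> \<bar>q r\<bar> * r powr (1 - 1 / p) \<le> K"
  shows "integrable halfline (\<lambda>r. q r *\<^sub>R h r)"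
proof (rule Bochner_Integration.integrable_bound)
  show "integrable halfline (\<lambda>r. \<bar>q r\<bar> * r powr (-1 / p) + K * norm (h r) powr p)"
    using q Lp_space_integrable[OF h] by simp
  show "(\<lambda>r. q r *\<^sub>R h r) \<in> borel_measurable halfline"
    using Lp_space_measurable[OF h] by measurable
  show "AE r in halfline. norm (q r *\<^sub>R h r) \<le> norm (\<bar>q r\<bar> * r powr (-1 / p) + K * norm (h r) powr p)"
  proof (rule AE_I2)
    fix r assume "r \<in> space halfline"
    then have r: "r > 0" by simp
    have "norm (h r) \<le> (r powr (-1 / p)) powr (1 - p) * norm (h r) powr p + r powr (-1 / p)"
      using r p by (intro le_add_powr) auto
    also have "(r powr (-1 / p)) powr (1 - p) = r powr (1 - 1 / p)"
    proof -
      have "-1 / p * (1 - p) = 1 - 1 / p" using p by (simp add: field_simps)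
      then show ?thesis by (simp only: powr_powr)
    qed
    finally have "\<bar>q r\<bar> * norm (h r) \<le> \<bar>q r\<bar> * (r powr (1 - 1 / p) * norm (h r) powr p + r powr (-1 / p))"
      by (intro mult_left_mono) auto
    also have "\<dots> = (\<bar>q r\<bar> * r powr (1 - 1 / p)) * norm (h r) powr p + \<bar>q r\<bar> * r powr (-1 / p)"
      by (simp add: algebra_simps)
    also have "\<dots> \<le> K * norm (h r) powr p + \<bar>q r\<bar> * r powr (-1 / p)"
      by (intro add_right_mono mult_right_mono K r) auto
    finally show "norm (q r *\<^sub>R h r) \<le> norm (\<bar>q r\<bar> * r powr (-1 / p) + K * norm (h r) powr p)"
      by simp
  qed
qed

text \<open>For r > t one has 1 + r at most (1 + 1/t) r, so a Beta integrand with first parameter 1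
  dominates.\<close>

lemma integrable_powr_tail:
  assumes "0 < e" "0 < t"
  shows "integrable halfline (\<lambda>r. indicator {t<..} r * r powr (-1 - e))"
proof (rule Bochner_Integration.integrable_bound)
  show "integrable halfline (\<lambda>r. (1 + 1 / t) powr (1 + e) * (r powr (1 - 1) / (1 + r) powr (1 + e)))"
    by (rule integrable_Beta_halfline[OF zero_less_one assms(1)])
  show "AE r in halfline. norm (indicator {t<..} r * r powr (-1 - e))
      \<le> norm ((1 + 1 / t) powr (1 + e) * (r powr (1 - 1) / (1 + r) powr (1 + e)))"
  proof (rule AE_I2)
    fix r assume "r \<in> space halfline"
    then have r: "r > 0" by simp
    show "norm (indicator {t<..} r * r powr (-1 - e))
      \<le> norm ((1 + 1 / t) powr (1 + e) * (r powr (1 - 1) / (1 + r) powr (1 + e)))"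
    proof (cases "t < r")
      case True
      have "1 + r \<le> (1 + 1 / t) * r" using True assms by (simp add: field_simps)
      then have "(1 + r) powr (1 + e) \<le> ((1 + 1 / t) * r) powr (1 + e)"
        using r assms by (intro powr_mono2) auto
      also have "\<dots> = (1 + 1 / t) powr (1 + e) * r powr (1 + e)"
        using r assms by (simp add: powr_mult)
      finally have "1 / r powr (1 + e) \<le> (1 + 1 / t) powr (1 + e) / (1 + r) powr (1 + e)"
        using r by (simp add: field_simps)
      moreover have "r powr (-1 - e) = 1 / r powr (1 + e)"
        by (simp add: powr_minus[symmetric] divide_inverse)
      ultimately show ?thesis using r True by simp
    qed simp
  qed
qed measurable

text \<open>Away from 0 the weight 1/r is admissible for every p at once; this is all the decay that
  membership in L^p supplies to the injectivity proof.\<close>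

lemma Lp_tail:
  assumes p: "1 \<le> p" and h: "h \<in> Lp_space p" and t: "0 < t"
  shows "set_integrable lborel {t<..} (\<lambda>r. (1 / r) *\<^sub>R h r)"
proof -
  have p': "1 / p \<le> 1" "0 < 1 / p" using p by auto
  have "integrable halfline (\<lambda>r. (indicator {t<..} r * (1 / r)) *\<^sub>R h r)"
  proof (rule Lp_integrable_weight[OF p h, where K="t powr (- 1 / p)"])
    show "integrable halfline (\<lambda>r. \<bar>indicator {t<..} r * (1 / r)\<bar> * r powr (-1 / p))"
      by (rule Bochner_Integration.integrable_cong[THEN iffD1, OF refl _ integrable_powr_tail[OF p'(2) t]])
        (auto simp: powr_diff powr_minus indicator_def field_simps)
    show "\<bar>indicator {t<..} r * (1 / r)\<bar> * r powr (1 - 1 / p) \<le> t powr (- 1 / p)" if "0 < r" for r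
    proof (cases "t < r")
      case True
      have "r powr (- 1 / p) \<le> t powr (- 1 / p)"
        using True t p by (intro powr_mono2') auto
      moreover have "1 / r * r powr (1 - 1 / p) = r powr (- 1 / p)"
        using that by (simp add: powr_diff powr_minus field_simps)
      ultimately show ?thesis using True that by simp
    qed simp
  qed measurable
  moreover have "(\<lambda>r. indicator {0<..} r *\<^sub>R ((indicator {t<..} r * (1 / r)) *\<^sub>R h r)) =
      (\<lambda>r. indicator {t<..} r *\<^sub>R ((1 / r) *\<^sub>R h r))"
    using t by (auto simp: indicator_def)
  ultimately show ?thesis
    by (simp only: integrable_halfline_iff set_integrable_def)
qed

section \<open>Injectivity of Weyl integrals\<close>

lemma AE_lborel_ex_interval:
  fixes a b :: real
  assumes "AE x in lborel. P x" "a < b"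
  shows "\<exists>x. a < x \<and> x < b \<and> P x"
proof (rule ccontr)
  assume "\<not> ?thesis"
  with assms(1) have "AE x in lborel. x \<notin> {a<..<b}" by (auto elim!: eventually_mono)
  then have "{a<..<b} \<in> null_sets lborel" by (subst AE_iff_null_sets) auto
  then show False using assms(2) by (auto simp: null_sets_def)
qed

lemma AE_halfline_iff: "(AE t in halfline. P t) \<longleftrightarrow> (AE t in lborel. 0 < t \<longrightarrow> P t)"
  by (simp add: AE_restrict_space_iff)

text \<open>Differences of tail integrals are integrals over intervals, so averages of g over
  suitable short intervals vanish; Lebesgue's differentiation theorem does the rest.\<close>

lemma null_of_tail_integral:
  fixes g :: "real \<Rightarrow> complex"
  assumes int: "\<And>t. 0 < t \<Longrightarrow> set_integrable lborel {t<..} g"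
    and z: "AE t in halfline. (LINT r:{t<..}|lborel. g r) = 0"
  shows "AE t in halfline. g t = 0"
proof -
  define T where "T t = (LINT r:{t<..}|lborel. g r)" for t
  have z': "AE t in lborel. 0 < t \<longrightarrow> T t = 0" using z by (simp add: AE_halfline_iff T_def)
  have "AE x in lborel. e < x \<longrightarrow> g x = 0" if e: "0 < e" for e
  proof -
    \<comment> \<open>Truncated at \<open>e\<close> because g is integrable only away from
      0.\<close>
    define f where "f r = indicator {e<..} r *\<^sub>R g r" for r
    have f: "integrable lborel f" using int[OF e] by (simp add: f_def[abs_def] set_integrable_def)
    have fS: "set_integrable lborel A f" if "A \<in> sets borel" for A
      using f that by (simp add: set_integrable_def integrable_mult_indicator)
    have "f integrable_on cbox a b" for a b
      by (rule set_borel_integral_eq_integral(1)[OF fS]) auto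
    then obtain N where N: "negligible N"
       "\<And>x e. x \<notin> N \<Longrightarrow> 0 < e \<Longrightarrow> \<exists>d>0. \<forall>h. 0 < h \<and> h < d \<longrightarrow>
          norm (integral (cbox x (x + h *\<^sub>R One)) f /\<^sub>R h ^ DIM(real) - f x) < e"
      by (rule integrable_ccontinuous_explicit) blast
    have "AE x in lebesgue. x \<notin> N"
      using N(1) by (simp add: negligible_iff_null_sets AE_not_in)
    then have "AE x in lborel. x \<notin> N" by (simp add: AE_completion_iff)
    with z' show ?thesis
    proof eventually_elim
      case (elim x)
      show ?case
      proof
        assume x: "e < x"
        then have Tx: "T x = 0" using elim e by simp
        have "norm (f x) \<le> d" if d: "d > 0" for d
        proof -
          obtain d' where d': "d' > 0" "\<And>h. 0 < h \<Longrightarrow> h < d' \<Longrightarrow>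
              norm (integral (cbox x (x + h *\<^sub>R One)) f /\<^sub>R h ^ DIM(real) - f x) < d"
            using N(2)[OF elim(2) d] by blast
          \<comment> \<open>The differentiation theorem allows every small step, but the tail
            integral vanishes only off a null set; the step \<open>y - x\<close> is chosen so that
            it vanishes at the right endpoint.\<close>
          obtain y where y: "x < y" "y < x + d'" "0 < y \<longrightarrow> T y = 0"
            using AE_lborel_ex_interval[OF z', of x "x + d'"] d' by auto
          have Ty: "T y = 0" using y x e by simp
          have "integral {x..y} f = (LINT r:{x..y}|lborel. f r)"
            by (rule set_borel_integral_eq_integral(2)[OF fS, symmetric]) auto
          also have "\<dots> = (LINT r|lborel. indicator {x<..} r *\<^sub>R g r - indicator {y<..} r *\<^sub>R g r)"
            unfolding set_lebesgue_integral_def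
          proof (rule integral_cong_AE)
            show "AE r in lborel. indicator {x..y} r *\<^sub>R f r = indicator {x<..} r *\<^sub>R g r - indicator {y<..} r *\<^sub>R g r"
              using AE_lborel_singleton[of x] by eventually_elim (use x y in \<open>auto simp: f_def indicator_def\<close>)
          qed (use int[of x] int[of y] x y e fS[of "{x..y}"] in \<open>auto simp: set_integrable_def\<close>)
          also have "\<dots> = T x - T y"
            using int[of x] int[of y] x y e by (simp add: T_def set_lebesgue_integral_def set_integrable_def)
          finally have "integral (cbox x (x + (y - x) *\<^sub>R One)) f = 0" using Tx Ty by simp
          then show ?thesis using d'(2)[of "y - x"] y by simp
        qed
        then have "norm (f x) \<le> 0" by (metis dense not_le)
        then show "g x = 0" using x by (simp add: f_def)
      qed
    qed
  qed
  \<comment> \<open>Countably many truncation levels suffice, so the exceptional sets can be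
    united.\<close>
  then have "AE x in lborel. \<forall>n. inverse (real (Suc n)) < x \<longrightarrow> g x = 0"
    by (subst AE_all_countable) auto
  then have "AE x in lborel. 0 < x \<longrightarrow> g x = 0"
    by eventually_elim (auto dest: reals_Archimedean)
  then show ?thesis by (simp add: AE_halfline_iff)
qed

lemma weyl_integral_1: "weyl_integral 1 g t = (LINT r:{t<..}|lborel. g r)"
  unfolding weyl_integral_def by (auto simp: set_lebesgue_integral_def indicator_def intro!: Bochner_Integration.integral_cong)

lemma set_integrable_bound_mono:
  fixes f g :: "real \<Rightarrow> complex"
  assumes "set_integrable lborel A g" "set_borel_measurable borel A f"
    and "\<And>x. x \<in> A \<Longrightarrow> norm (f x) \<le> norm (g x)"
  shows "set_integrable lborel A f"
  using assms(1) unfolding set_integrable_def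
  by (rule Bochner_Integration.integrable_bound)
    (use assms(2,3) in \<open>auto simp: set_borel_measurable_def indicator_def\<close>)

lemma set_borel_measurable_halfline_subset:
  fixes g :: "real \<Rightarrow> 'a :: {banach, second_countable_topology}"
  assumes "g \<in> borel_measurable halfline" "A \<subseteq> {0<..}" "A \<in> sets borel"
  shows "set_borel_measurable borel A g"
  by (rule set_borel_measurable_subset[of _ "{0<..}"]) (use assms in \<open>auto simp: measurable_halfline_iff\<close>)

lemma set_integrable_shifted_power:
  fixes g :: "real \<Rightarrow> complex"
  assumes int: "set_integrable lborel {t<..} (\<lambda>r. r ^ n *\<^sub>R g r)" and t: "0 < t"
    and [measurable]: "g \<in> borel_measurable halfline"
  shows "set_integrable lborel {t<..} (\<lambda>r. (r - t) powr real n *\<^sub>R g r)"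
proof (rule set_integrable_bound_mono[OF int])
  show "set_borel_measurable borel {t<..} (\<lambda>r. (r - t) powr real n *\<^sub>R g r)"
    by (rule set_borel_measurable_halfline_subset) (measurable, use t in auto)
  fix r assume "r \<in> {t<..}"
  then have r: "t < r" by simp
  have "(r - t) powr real n = (r - t) ^ n" using r by (simp add: powr_realpow)
  also have "\<dots> \<le> r ^ n" using r t by (intro power_mono) auto
  finally show "norm ((r - t) powr real n *\<^sub>R g r) \<le> norm (r ^ n *\<^sub>R g r)"
    using r t by (simp add: mult_right_mono)
qed

text \<open>An integral of order n + 2 is the tail integral of the one of order n + 1, so
  \<open>null_of_tail_integral\<close> lowers the order by one in each induction step.\<close>

lemma weyl_integral_nat_injective:
  fixes g :: "real \<Rightarrow> complex"
  assumes "g \<in> borel_measurable halfline"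
    and "\<And>t. 0 < t \<Longrightarrow> set_integrable lborel {t<..} (\<lambda>r. r ^ n *\<^sub>R g r)"
    and "AE t in halfline. weyl_integral (real (Suc n)) g t = 0"
  shows "AE t in halfline. g t = 0"
  using assms(2,3)
proof (induction n)
  case 0
  then show ?case by (simp add: weyl_integral_1 null_of_tail_integral)
next
  case (Suc n)
  note [measurable] = assms(1)
  have m: "set_borel_measurable borel {t<..} (\<lambda>r. q r *\<^sub>R g r)" if "0 < t" "q \<in> borel_measurable borel" for t q
  proof (rule set_borel_measurable_halfline_subset)
    have [measurable]: "q \<in> borel_measurable halfline"
      using that by (intro measurable_restrict_space1) simp
    show "(\<lambda>r. q r *\<^sub>R g r) \<in> borel_measurable halfline" by measurable
  qed (use that in auto)
  have m1: "set_borel_measurable borel {t<..} g" if "0 < t" for t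
    using m[OF that, of "\<lambda>r. 1"] by simp
  have i1: "set_integrable lborel {t<..} (\<lambda>r. (r - t) powr (1 + real (Suc n) - 1) *\<^sub>R g r)" if t: "0 < t" for t
    using set_integrable_shifted_power[OF Suc.prems(1)[OF t] t assms(1)] by simp
  \<comment> \<open>The induction hypothesis uses the lighter weight r^n, which on r > t is at most
    r^(n+1) / t.\<close>
  have i2: "set_integrable lborel {t<..} (\<lambda>r. r ^ n *\<^sub>R g r)" if t: "0 < t" for t
  proof (rule set_integrable_bound_mono[OF _ m[OF t]])
    show "set_integrable lborel {t<..} (\<lambda>r. (1 / t) *\<^sub>R (r ^ Suc n *\<^sub>R g r))"
      using Suc.prems(1)[OF t] by (intro set_integrable_scaleR_right) auto
    fix r assume "r \<in> {t<..}"
    then have r: "t < r" by simp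
    have "r ^ n * 1 \<le> r ^ n * (r / t)" using r t by (intro mult_left_mono) auto
    then show "norm (r ^ n *\<^sub>R g r) \<le> norm ((1 / t) *\<^sub>R (r ^ Suc n *\<^sub>R g r))"
      using r t mult_right_mono[of "r ^ n" "r ^ n * (r / t)" "norm (g r)"] by (simp add: mult_ac)
  qed measurable
  note C = weyl_integral_compose[OF zero_less_one _ i1 m1]
  have "AE t in halfline. weyl_integral (real (Suc n)) g t = 0"
  proof (rule null_of_tail_integral)
    show "set_integrable lborel {t<..} (weyl_integral (real (Suc n)) g)" if "0 < t" for t
    proof -
      have "set_integrable lborel {t<..} (\<lambda>s. (s - t) powr (1 - 1) *\<^sub>R weyl_integral (real (Suc n)) g s)"
        using that by (intro C(1)) auto
      then show ?thesis
        unfolding set_integrable_def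
        by (rule Bochner_Integration.integrable_cong[THEN iffD1, rotated 2]) (auto simp: indicator_def)
    qed
    have "AE t in halfline. 0 < t" by (intro AE_I2) simp
    with Suc.prems(2) show "AE t in halfline. (LINT r:{t<..}|lborel. weyl_integral (real (Suc n)) g r) = 0"
    proof eventually_elim
      case (elim t)
      then show ?case using C(2)[of t] by (simp add: weyl_integral_1 add.commute)
    qed
  qed
  with i2 show ?case by (rule Suc.IH)
qed

text \<open>
  With \<open>n > a\<close> an integer and \<open>b = n - a\<close>, the kernels \<open>(a, a)\<close> and \<open>(b, n)\<close> compose, up to a
  constant, to \<open>(n, n)\<close>.  Composing \<open>W\<^bsup>-b\<^esup>\<close> directly with the vanishing integral is not possible:
  \<open>\<integral> (s - t)\<^bsup>n-1\<^esup> s\<^bsup>-a\<^esup> h(s) ds\<close> may diverge for \<open>h\<close> in \<open>L\<^sup>p\<close>.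
\<close>

lemma weyl_kernel_injective:
  assumes p: "1 \<le> p" and h: "h \<in> Lp_space p" and a: "0 < a"
    and z: "AE t in halfline. hom_op (weyl_kernel a a) h t = 0"
  shows "AE t in halfline. h t = 0"
proof -
  \<comment> \<open>The integer called n in the preceding remark is \<open>Suc n\<close> here, so
    \<open>b\<close> lies in (0, 1].\<close>
  define n where "n = nat \<lfloor>a\<rfloor>"
  define b where "b = real (Suc n) - a"
  have b: "b > 0" "a + b = real (Suc n)" using a by (auto simp: b_def n_def) linarith
  have k1: "hom_kernel p (weyl_kernel a a)" using a p by (intro hom_kernel_weyl) auto
  have "0 < 1 / p" using p by simp
  then have k2: "hom_kernel p (weyl_kernel b (real (Suc n)))"
    using a b unfolding b_def by (intro hom_kernel_weyl) linarith+
  \<comment> \<open>The auxiliary operator is applied directly to h, inside the vanishing one. The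
    composition then converges absolutely, and commutation moves the vanishing operator
    inwards.\<close>
  define Rh where "Rh = hom_op (weyl_kernel b (real (Suc n))) h"
  define g where "g r = r powr (- real (Suc n)) *\<^sub>R h r" for r
  note [measurable] = Lp_space_measurable[OF h]
  have gm: "g \<in> borel_measurable halfline" unfolding g_def by measurable
  \<comment> \<open>The weight r^n reduces g to h(r)/r, which is the integrand of
    \<open>Lp_tail\<close>.\<close>
  have gi: "set_integrable lborel {t<..} (\<lambda>r. r ^ n *\<^sub>R g r)" if t: "0 < t" for t
  proof -
    have eq: "r ^ n *\<^sub>R g r = (1 / r) *\<^sub>R h r" if "r \<in> {t<..}" for r
    proof -
      have "r powr (- real (Suc n)) = inverse (r ^ Suc n)"
        using that t by (simp only: powr_minus) (subst powr_realpow, auto)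
      then show ?thesis using that t by (simp add: g_def field_simps)
    qed
    show ?thesis using Lp_tail[OF p h t]
      by (rule set_integrable_cong[THEN iffD1, rotated 3]) (auto simp: eq)
  qed
  have gi': "set_integrable lborel {t<..} (\<lambda>r. (r - t) powr (a + b - 1) *\<^sub>R g r)" if t: "0 < t" for t
    using set_integrable_shifted_power[OF gi[OF t] t gm] b by simp
  have G0: "Gamma a \<noteq> 0" "Gamma b \<noteq> 0"
    using Gamma_real_pos[OF a] Gamma_real_pos[OF b(1)] by simp_all
  have eq: "hom_op (weyl_kernel a a) Rh t = (Gamma a * Gamma b) *\<^sub>R weyl_integral (real (Suc n)) g t" if t: "0 < t" for t
  proof -
    have "hom_op (weyl_kernel a a) Rh t = (t powr (a - a) * Gamma a) *\<^sub>R weyl_integral a (\<lambda>s. s powr (- a) *\<^sub>R Rh s) t"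
      by (rule hom_op_weyl[OF a t])
    also have "weyl_integral a (\<lambda>s. s powr (- a) *\<^sub>R Rh s) t = weyl_integral a (\<lambda>s. Gamma b *\<^sub>R weyl_integral b g s) t"
    proof -
      \<comment> \<open>By \<open>hom_op_weyl\<close> the operator (b, Suc n) produces the factor
        s^(Suc n - b) = s^a, which cancels the weight s^(-a) of the outer operator.\<close>
      have "s powr (- a) *\<^sub>R Rh s = Gamma b *\<^sub>R weyl_integral b g s" if "s > 0" for s
        unfolding Rh_def using that b
        by (subst hom_op_weyl) (auto simp: g_def[abs_def] b_def powr_minus)
      then show ?thesis
        unfolding weyl_integral_def[of a] set_lebesgue_integral_def using t
        by (intro arg_cong[where f="\<lambda>x. (1 / Gamma a) *\<^sub>R x"] Bochner_Integration.integral_cong) (auto simp: indicator_def simp del: scaleR_scaleR)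
    qed
    also have "\<dots> = Gamma b *\<^sub>R weyl_integral a (weyl_integral b g) t"
      by (rule weyl_integral_scaleR)
    also have "weyl_integral a (weyl_integral b g) t = weyl_integral (a + b) g t"
      using t by (intro weyl_integral_compose a b gi' set_borel_measurable_halfline_subset gm) auto
    finally show ?thesis using t b by simp
  qed
  have "AE t in halfline. hom_op (weyl_kernel a a) Rh t = 0"
  proof -
    \<comment> \<open>In this order the inner function is null, and the outer operator sees only its
      class.\<close>
    have "hom_op (weyl_kernel b (real (Suc n))) (hom_op (weyl_kernel a a) h) t = 0" if "t > 0" for t
    proof -
      have "hom_op (weyl_kernel b (real (Suc n))) (hom_op (weyl_kernel a a) h) t
          = hom_op (weyl_kernel b (real (Suc n))) (\<lambda>_. 0) t"
        using k2 by (intro hom_op_cong_AE z that Lp_space_measurable[OF hom_op_Lp[OF p h k1]]) (auto simp: hom_kernel_def)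
      then show ?thesis by (simp add: hom_op_def)
    qed
    then have "AE t in halfline. hom_op (weyl_kernel b (real (Suc n))) (hom_op (weyl_kernel a a) h) t = 0"
      by (intro AE_I2) simp
    with hom_op_commute[OF p h k1 k2] show ?thesis
      by eventually_elim (simp add: Rh_def)
  qed
  moreover have "AE t in halfline. 0 < t" by (intro AE_I2) simp
  ultimately have "AE t in halfline. weyl_integral (real (Suc n)) g t = 0"
    by eventually_elim (use eq G0 in auto)
  from weyl_integral_nat_injective[OF gm _ this] have "AE t in halfline. g t = 0"
    using gi by blast
  moreover have "AE t in halfline. 0 < t" by (intro AE_I2) simp
  ultimately show ?thesis by eventually_elim (simp add: g_def)
qed

section \<open>Weyl derivatives of Schwartz functions\<close>

lemma at_within_halfline_not_bot: "0 \<le> t \<Longrightarrow> at t within {0::real..} \<noteq> bot"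
proof
  assume t: "0 \<le> t" and bot: "at t within {0::real..} = bot"
  have "at_right t \<le> at t within {0..}" using t by (intro at_le) auto
  then show False using bot trivial_limit_at_right_real[of t] by (simp add: bot_unique trivial_limit_def)
qed

lemma hderivI:
  assumes "(f has_vector_derivative d) (at t within {0..})" "0 \<le> t"
  shows "hderiv f t = d"
  unfolding hderiv_def by (rule vector_derivative_within[OF at_within_halfline_not_bot]) (use assms in auto)

lemma hderiv_cong:
  assumes "\<And>t. 0 \<le> t \<Longrightarrow> f t = g t" "0 \<le> t"
  shows "hderiv f t = hderiv g t"
  unfolding hderiv_def by (rule vector_derivative_cong_eq) (use assms in auto)

lemma differentiable_halfline_cong:
  assumes "f differentiable (at t within {0..})" "0 \<le> t" "\<And>t. 0 \<le> t \<Longrightarrow> f t = g t"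
  shows "g differentiable (at t within {0::real..})"
  using assms(1) by (rule differentiable_transform_within[OF _ zero_less_one]) (use assms in auto)

lemma schwartz_hderiv: "f \<in> schwartz_plus \<Longrightarrow> hderiv f \<in> schwartz_plus"
  unfolding schwartz_plus_def mem_Collect_eq
proof
  fix n
  assume *: "\<forall>n. (\<forall>t\<ge>0. (hderiv ^^ n) f differentiable (at t within {0..})) \<and>
     (\<forall>m::nat. \<exists>C. \<forall>t\<ge>0. norm (t ^ m *\<^sub>R (hderiv ^^ n) f t) \<le> C)"
  have "(hderiv ^^ n) (hderiv f) = (hderiv ^^ Suc n) f" by (simp add: funpow_swap1)
  then show "(\<forall>t\<ge>0. (hderiv ^^ n) (hderiv f) differentiable (at t within {0..})) \<and>
     (\<forall>m::nat. \<exists>C. \<forall>t\<ge>0. norm (t ^ m *\<^sub>R (hderiv ^^ n) (hderiv f) t) \<le> C)"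
    using *[rule_format, of "Suc n"] by metis
qed

lemma schwartz_hderiv_funpow: "f \<in> schwartz_plus \<Longrightarrow> (hderiv ^^ n) f \<in> schwartz_plus"
  by (induction n) (auto intro: schwartz_hderiv)

lemma schwartz_has_deriv:
  assumes "f \<in> schwartz_plus" "0 \<le> t"
  shows "(f has_vector_derivative hderiv f t) (at t within {0..})"
proof -
  have "(hderiv ^^ 0) f differentiable (at t within {0..})"
    using assms unfolding schwartz_plus_def by blast
  then show ?thesis by (simp add: vector_derivative_works hderiv_def)
qed

lemma schwartz_continuous: "f \<in> schwartz_plus \<Longrightarrow> continuous_on {0..} f"
  unfolding continuous_on_eq_continuous_within
  by (auto intro: has_vector_derivative_continuous schwartz_has_deriv)

text \<open>\<open>vector_derivative\<close> is a choice operator, so linearity has to be proved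
  along the iteration, where differentiability of both iterates is at hand. The single form f + c g
  covers sums and differences.\<close>

lemma schwartz_lin_aux:
  assumes f: "f \<in> schwartz_plus" and g: "g \<in> schwartz_plus"
  shows "0 \<le> t \<Longrightarrow> (hderiv ^^ n) (\<lambda>t. f t + c * g t) t = (hderiv ^^ n) f t + c * (hderiv ^^ n) g t"
proof (induction n arbitrary: t)
  case (Suc n)
  have "hderiv ((hderiv ^^ n) (\<lambda>t. f t + c * g t)) t = hderiv (\<lambda>t. (hderiv ^^ n) f t + c * (hderiv ^^ n) g t) t"
    by (rule hderiv_cong[OF Suc.IH Suc.prems])
  also have "\<dots> = hderiv ((hderiv ^^ n) f) t + c * hderiv ((hderiv ^^ n) g) t"
    using schwartz_has_deriv[OF schwartz_hderiv_funpow[OF f] Suc.prems, of n]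
      schwartz_has_deriv[OF schwartz_hderiv_funpow[OF g] Suc.prems, of n] Suc.prems
    by (intro hderivI has_vector_derivative_add has_vector_derivative_mult_right)
  finally show ?case by simp
qed simp

lemma schwartz_lin:
  assumes f: "f \<in> schwartz_plus" and g: "g \<in> schwartz_plus"
  shows "(\<lambda>t. f t + c * g t) \<in> schwartz_plus"
  unfolding schwartz_plus_def mem_Collect_eq
proof (intro allI conjI impI)
  fix n :: nat and t :: real assume t: "0 \<le> t"
  have "(\<lambda>t. (hderiv ^^ n) f t + c * (hderiv ^^ n) g t) differentiable (at t within {0..})"
    by (rule differentiableI_vector[OF has_vector_derivative_add[OF schwartz_has_deriv[OF schwartz_hderiv_funpow[OF f] t]
      has_vector_derivative_mult_right[OF schwartz_has_deriv[OF schwartz_hderiv_funpow[OF g] t]]]])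
  then show "(hderiv ^^ n) (\<lambda>t. f t + c * g t) differentiable (at t within {0..})"
    by (rule differentiable_halfline_cong[OF _ t]) (simp add: schwartz_lin_aux[OF f g])
next
  fix n m :: nat
  obtain A B where A: "\<And>t. t \<ge> 0 \<Longrightarrow> norm (t ^ m *\<^sub>R (hderiv ^^ n) f t) \<le> A"
    and B: "\<And>t. t \<ge> 0 \<Longrightarrow> norm (t ^ m *\<^sub>R (hderiv ^^ n) g t) \<le> B"
    using f g unfolding schwartz_plus_def mem_Collect_eq by meson
  show "\<exists>C. \<forall>t\<ge>0. norm (t ^ m *\<^sub>R (hderiv ^^ n) (\<lambda>t. f t + c * g t) t) \<le> C"
  proof (intro exI allI impI)
    fix t :: real assume t: "0 \<le> t"
    have "norm (t ^ m *\<^sub>R (hderiv ^^ n) (\<lambda>t. f t + c * g t) t)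
        = norm (t ^ m *\<^sub>R (hderiv ^^ n) f t + c * (t ^ m *\<^sub>R (hderiv ^^ n) g t))"
      by (simp add: schwartz_lin_aux[OF f g t] scaleR_add_right)
    also have "\<dots> \<le> A + norm c * B"
    proof (intro norm_triangle_le add_mono A t)
      show "norm (c * (t ^ m *\<^sub>R (hderiv ^^ n) g t)) \<le> norm c * B"
        unfolding norm_mult by (intro mult_left_mono B t) auto
    qed
    finally show "norm (t ^ m *\<^sub>R (hderiv ^^ n) (\<lambda>t. f t + c * g t) t) \<le> A + norm c * B" .
  qed
qed

text \<open>Converts the bounds with integer powers of t into a real power of 1 + t, which has no
  singularity at 0: 1 + t is at most 2 for t at most 1, and at most 2t beyond.\<close>

lemma schwartz_decay:
  assumes "f \<in> schwartz_plus"
  obtains C where "0 \<le> C" "\<And>t. 0 \<le> t \<Longrightarrow> norm (f t) \<le> C * (1 + t) powr (- m)"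
proof -
  define M where "M = nat \<lceil>m\<rceil>"
  have M: "m \<le> real M" unfolding M_def by linarith
  have bd: "\<exists>C. \<forall>t\<ge>0. norm (t ^ k *\<^sub>R f t) \<le> C" for k
    using assms unfolding schwartz_plus_def mem_Collect_eq by (metis funpow_0)
  obtain A where A: "\<And>t. t \<ge> 0 \<Longrightarrow> norm (t ^ 0 *\<^sub>R f t) \<le> A" using bd by meson
  obtain B where B: "\<And>t. t \<ge> 0 \<Longrightarrow> norm (t ^ M *\<^sub>R f t) \<le> B" using bd by meson
  have A0: "A \<ge> 0" by (rule order_trans[OF norm_ge_zero A[OF order_refl]])
  have B0: "B \<ge> 0" by (rule order_trans[OF norm_ge_zero B[OF order_refl]])
  have "norm (f t) \<le> 2 ^ M * (A + B) * (1 + t) powr (- m)" if t: "0 \<le> t" for t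
  proof -
    have "(1 + t) ^ M * norm (f t) \<le> 2 ^ M * (A + B)"
    proof (cases "t \<le> 1")
      case True
      have "(1 + t) ^ M * norm (f t) \<le> 2 ^ M * A"
        using True t A[OF t] by (intro mult_mono power_mono) auto
      then show ?thesis using B0 by (simp add: distrib_left add_increasing2)
    next
      case False
      have "(1 + t) ^ M * norm (f t) \<le> (2 * t) ^ M * norm (f t)"
        using False t by (intro mult_right_mono power_mono) auto
      also have "\<dots> = 2 ^ M * norm (t ^ M *\<^sub>R f t)"
        using t by (simp add: power_mult_distrib)
      also have "\<dots> \<le> 2 ^ M * B" using B[OF t] by (intro mult_left_mono) auto
      finally show ?thesis using A0 by (simp add: distrib_left add_increasing)
    qed
    then have "norm (f t) \<le> 2 ^ M * (A + B) * (1 + t) powr (- real M)"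
      using t by (simp add: powr_minus powr_realpow field_simps)
    also have "\<dots> \<le> 2 ^ M * (A + B) * (1 + t) powr (- m)"
      using A0 B0 t M by (intro mult_left_mono powr_mono) auto
    finally show ?thesis .
  qed
  then show ?thesis using A0 B0 by (intro that[of "2 ^ M * (A + B)"]) auto
qed

text \<open>Moves t from the domain of integration into the argument of f, so that integrals for
  different t can be compared over one fixed domain.\<close>

lemma weyl_integral_shift:
  "weyl_integral a f t = (1 / Gamma a) *\<^sub>R (LINT u|halfline. u powr (a - 1) *\<^sub>R f (t + u))"
proof -
  have "(LINT s:{t<..}|lborel. (s - t) powr (a - 1) *\<^sub>R f s)
      = (LINT u|lborel. indicator {t<..} (t + 1 * u) *\<^sub>R ((t + 1 * u - t) powr (a - 1) *\<^sub>R f (t + 1 * u)))"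
    unfolding set_lebesgue_integral_def by (subst lborel_integral_real_affine[of 1 _ t]) auto
  also have "\<dots> = (LINT u|halfline. u powr (a - 1) *\<^sub>R f (t + u))"
    unfolding integral_halfline_eq set_lebesgue_integral_def
    by (intro Bochner_Integration.integral_cong) (auto simp: indicator_def)
  finally show ?thesis by (simp add: weyl_integral_def)
qed

lemma integrable_weyl_shift:
  "set_integrable lborel {t<..} (\<lambda>s. (s - t) powr (a - 1) *\<^sub>R f s) \<longleftrightarrow>
    integrable halfline (\<lambda>u. u powr (a - 1) *\<^sub>R (f (t + u) :: complex))"
proof -
  have "set_integrable lborel {t<..} (\<lambda>s. (s - t) powr (a - 1) *\<^sub>R f s) \<longleftrightarrow>
     integrable lborel (\<lambda>u. indicator {t<..} (t + 1 * u) *\<^sub>R ((t + 1 * u - t) powr (a - 1) *\<^sub>R f (t + 1 * u)))"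
    unfolding set_integrable_def by (subst lborel_integrable_real_affine_iff) auto
  also have "\<dots> \<longleftrightarrow> integrable halfline (\<lambda>u. u powr (a - 1) *\<^sub>R (f (t + u) :: complex))"
    unfolding integrable_halfline_iff set_integrable_def
    by (intro Bochner_Integration.integrable_cong) (auto simp: indicator_def)
  finally show ?thesis .
qed

lemma weyl_integral_cong:
  assumes "\<And>s. t < s \<Longrightarrow> f s = g s"
  shows "weyl_integral a f t = weyl_integral a g t"
proof -
  have "indicator {t<..} s *\<^sub>R ((s - t) powr (a - 1) *\<^sub>R f s) =
      indicator {t<..} s *\<^sub>R ((s - t) powr (a - 1) *\<^sub>R g s)" for s
    using assms by (cases "t < s") auto
  then show ?thesis by (simp only: weyl_integral_def set_lebesgue_integral_def)
qed

section \<open>Weyl integrals of Schwartz functions: integrability, decay, continuity\<close>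

context
  fixes f :: "real \<Rightarrow> complex"
  assumes f: "f \<in> schwartz_plus"
begin

lemma schwartz_shift_measurable: "0 \<le> t \<Longrightarrow> (\<lambda>u. f (t + u)) \<in> borel_measurable halfline"
proof -
  assume t: "0 \<le> t"
  have "continuous_on {0<..} (\<lambda>u. f (t + u))"
    using t by (intro continuous_on_compose2[OF schwartz_continuous[OF f]] continuous_intros) auto
  then show ?thesis
    unfolding measurable_halfline_iff by (intro set_measurable_continuous_on) auto
qed

text \<open>The decay in t + u is spent twice: 1 + t + u exceeds both 1 + t and 1 + u. The absolute
  value of \<open>m\<close> keeps the exponent of the first factor of the right sign, and a + 1
  makes the u-factor a Beta integrand with second parameter 1.\<close>

lemma schwartz_weyl_bound:
  assumes a: "0 < a"
  obtains C where "0 \<le> C"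
    "\<And>t u. 0 \<le> t \<Longrightarrow> 0 < u \<Longrightarrow> norm (u powr (a - 1) *\<^sub>R f (t + u)) \<le> C * (1 + t) powr (- m) * (u powr (a - 1) / (1 + u) powr (a + 1))"
proof -
  obtain C where C: "0 \<le> C" "\<And>t. 0 \<le> t \<Longrightarrow> norm (f t) \<le> C * (1 + t) powr (- (\<bar>m\<bar> + (a + 1)))"
    using schwartz_decay[OF f] by blast
  have "norm (u powr (a - 1) *\<^sub>R f (t + u)) \<le> C * (1 + t) powr (- m) * (u powr (a - 1) / (1 + u) powr (a + 1))"
    if t: "0 \<le> t" and u: "0 < u" for t u
  proof -
    have "(1 + (t + u)) powr (- (\<bar>m\<bar> + (a + 1))) = (1 + (t + u)) powr (- \<bar>m\<bar>) * (1 + (t + u)) powr (- (a + 1))"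
      by (simp add: powr_add[symmetric])
    also have "\<dots> \<le> (1 + t) powr (- \<bar>m\<bar>) * (1 + u) powr (- (a + 1))"
      using t u a by (intro mult_mono powr_mono2') auto
    also have "\<dots> \<le> (1 + t) powr (- m) * (1 + u) powr (- (a + 1))"
      using t by (intro mult_right_mono powr_mono) auto
    finally have "norm (f (t + u)) \<le> C * ((1 + t) powr (- m) * (1 + u) powr (- (a + 1)))"
      using C(2)[of "t + u"] t u C(1) by (meson add_nonneg_nonneg less_imp_le mult_left_mono order_trans)
    then have "u powr (a - 1) * norm (f (t + u)) \<le> u powr (a - 1) * (C * ((1 + t) powr (- m) * (1 + u) powr (- (a + 1))))"
      by (intro mult_left_mono) auto
    also have "(1 + u) powr (- (a + 1)) = 1 / (1 + u) powr (a + 1)" by (rule powr_minus_divide)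
    finally show ?thesis by (simp add: mult_ac)
  qed
  then show ?thesis using that C(1) by blast
qed

lemma schwartz_weyl_integrable:
  assumes a: "0 < a" and t: "0 \<le> t"
  shows "integrable halfline (\<lambda>u. u powr (a - 1) *\<^sub>R f (t + u))"
proof -
  obtain C where C: "0 \<le> C"
    "\<And>t u. 0 \<le> t \<Longrightarrow> 0 < u \<Longrightarrow> norm (u powr (a - 1) *\<^sub>R f (t + u)) \<le> C * (1 + t) powr (- 0) * (u powr (a - 1) / (1 + u) powr (a + 1))"
    using schwartz_weyl_bound[OF a, where m=0] by blast
  note [measurable] = schwartz_shift_measurable[OF t]
  have "integrable halfline (\<lambda>u. C * (1 + t) powr (- 0) * (u powr (a - 1) / (1 + u) powr (a + 1)))"
    by (rule integrable_Beta_halfline[OF a zero_less_one])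
  then show ?thesis
  proof (rule Bochner_Integration.integrable_bound)
    show "AE u in halfline. norm (u powr (a - 1) *\<^sub>R f (t + u)) \<le> norm (C * (1 + t) powr (- 0) * (u powr (a - 1) / (1 + u) powr (a + 1)))"
    proof (rule AE_I2)
      fix u assume "u \<in> space halfline"
      then have "u > 0" by simp
      from order_trans[OF C(2)[OF t this] abs_ge_self]
      show "norm (u powr (a - 1) *\<^sub>R f (t + u)) \<le> norm (C * (1 + t) powr (- 0) * (u powr (a - 1) / (1 + u) powr (a + 1)))"
        by (simp only: real_norm_def)
    qed
  qed measurable
qed

lemma schwartz_weyl_set_integrable:
  assumes a: "0 < a" and t: "0 \<le> t"
  shows "set_integrable lborel {t<..} (\<lambda>s. (s - t) powr (a - 1) *\<^sub>R f s)"
  unfolding integrable_weyl_shift by (rule schwartz_weyl_integrable[OF assms])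

lemma schwartz_weyl_decay:
  assumes a: "0 < a"
  obtains C where "0 \<le> C" "\<And>t. 0 \<le> t \<Longrightarrow> norm (weyl_integral a f t) \<le> C * (1 + t) powr (- m)"
proof -
  obtain C where C: "0 \<le> C"
    "\<And>t u. 0 \<le> t \<Longrightarrow> 0 < u \<Longrightarrow> norm (u powr (a - 1) *\<^sub>R f (t + u)) \<le> C * (1 + t) powr (- m) * (u powr (a - 1) / (1 + u) powr (a + 1))"
    using schwartz_weyl_bound[OF a, where m=m] by blast
  have G: "Gamma a > 0" using Gamma_real_pos[OF a] .
  have B: "Beta a 1 > 0" using a by (intro Beta_pos) auto
  note BI = has_bochner_integral_Beta_halfline[OF a zero_less_one]
  have "norm (weyl_integral a f t) \<le> (1 / Gamma a * C * Beta a 1) * (1 + t) powr (- m)" if t: "0 \<le> t" for t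
  proof -
    have "norm (LINT u|halfline. u powr (a - 1) *\<^sub>R f (t + u))
        \<le> (LINT u|halfline. C * (1 + t) powr (- m) * (u powr (a - 1) / (1 + u) powr (a + 1)))"
    proof (rule Bochner_Integration.integral_norm_bound_integral[OF schwartz_weyl_integrable[OF a t]])
      show "integrable halfline (\<lambda>u. C * (1 + t) powr (- m) * (u powr (a - 1) / (1 + u) powr (a + 1)))"
        by (rule integrable_Beta_halfline[OF a zero_less_one])
    qed (use C(2)[OF t] in simp)
    also have "\<dots> = C * (1 + t) powr (- m) * Beta a 1"
      using BI unfolding has_bochner_integral_iff by (subst integral_mult_right_zero) simp
    finally show ?thesis using G by (simp add: weyl_integral_shift field_simps)
  qed
  then show ?thesis using C(1) G B by (intro that[of "1 / Gamma a * C * Beta a 1"]) auto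
qed

text \<open>Dominated convergence along sequences; the bound with m = 0 does not depend on t, which
  includes the endpoint 0.\<close>

lemma schwartz_weyl_continuous:
  assumes a: "0 < a"
  shows "continuous_on {0..} (weyl_integral a f)"
proof (rule continuous_on_sequentiallyI)
  fix x t assume x: "\<forall>n. x n \<in> {0::real..}" "t \<in> {0..}" and lim: "x \<longlonglongrightarrow> t"
  obtain C where C: "0 \<le> C"
    "\<And>t u. 0 \<le> t \<Longrightarrow> 0 < u \<Longrightarrow> norm (u powr (a - 1) *\<^sub>R f (t + u)) \<le> C * (1 + t) powr (- 0) * (u powr (a - 1) / (1 + u) powr (a + 1))"
    using schwartz_weyl_bound[OF a, where m=0] by blast
  have "(\<lambda>n. LINT u|halfline. u powr (a - 1) *\<^sub>R f (x n + u)) \<longlonglongrightarrow> (LINT u|halfline. u powr (a - 1) *\<^sub>R f (t + u))"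
  proof (rule integral_dominated_convergence[where w="\<lambda>u. C * (u powr (a - 1) / (1 + u) powr (a + 1))"])
    show "(\<lambda>u. u powr (a - 1) *\<^sub>R f (t + u)) \<in> borel_measurable halfline"
      using x by (intro borel_measurable_integrable schwartz_weyl_integrable a) auto
    show "(\<lambda>u. u powr (a - 1) *\<^sub>R f (x n + u)) \<in> borel_measurable halfline" for n
      using x by (intro borel_measurable_integrable schwartz_weyl_integrable a) auto
    show "integrable halfline (\<lambda>u. C * (u powr (a - 1) / (1 + u) powr (a + 1)))"
      by (rule integrable_Beta_halfline[OF a zero_less_one])
    show "AE u in halfline. (\<lambda>n. u powr (a - 1) *\<^sub>R f (x n + u)) \<longlonglongrightarrow> u powr (a - 1) *\<^sub>R f (t + u)"
    proof (rule AE_I2)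
      fix u assume "u \<in> space halfline"
      then have u: "u > 0" by simp
      have "(\<lambda>n. f (x n + u)) \<longlonglongrightarrow> f (t + u)"
        using x u by (intro continuous_on_tendsto_compose[OF schwartz_continuous[OF f]] tendsto_intros lim)
          (auto intro!: always_eventually add_nonneg_nonneg)
      then show "(\<lambda>n. u powr (a - 1) *\<^sub>R f (x n + u)) \<longlonglongrightarrow> u powr (a - 1) *\<^sub>R f (t + u)"
        by (intro tendsto_intros)
    qed
    show "AE u in halfline. norm (u powr (a - 1) *\<^sub>R f (x n + u)) \<le> C * (u powr (a - 1) / (1 + u) powr (a + 1))" for n
    proof (rule AE_I2)
      fix u assume "u \<in> space halfline"
      moreover have "0 \<le> x n" using x by auto
      ultimately show "norm (u powr (a - 1) *\<^sub>R f (x n + u)) \<le> C * (u powr (a - 1) / (1 + u) powr (a + 1))"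
        using C(2)[of "x n" u] by auto
    qed
  qed
  then show "(\<lambda>n. weyl_integral a f (x n)) \<longlonglongrightarrow> weyl_integral a f t"
    unfolding weyl_integral_shift by (intro tendsto_intros)
qed

end

text \<open>The tail integral is a constant minus the integral over {0..t}, so the fundamental
  theorem applies, including the one-sided derivative at 0.\<close>

lemma tail_integral_deriv:
  fixes g :: "real \<Rightarrow> complex"
  assumes cont: "continuous_on {0..} g" and int: "set_integrable lborel {0<..} g" and t: "0 \<le> t"
  shows "((\<lambda>t. LINT r:{t<..}|lborel. g r) has_vector_derivative - g t) (at t within {0..})"
proof -
  have m: "set_borel_measurable borel A g" if "A \<subseteq> {0..}" "A \<in> sets borel" for A
    using that by (intro set_measurable_continuous_on continuous_on_subset[OF cont])
  have int0: "set_integrable lborel {0..} g"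
    using int unfolding set_integrable_def
  proof (rule integrable_cong_AE_imp)
    show "AE x in lborel. indicator {0<..} x *\<^sub>R g x = indicator {0..} x *\<^sub>R g x"
      using AE_lborel_singleton[of 0] by eventually_elim (auto simp: indicator_def)
  qed (use m[of "{0..}"] in \<open>simp add: set_borel_measurable_def\<close>)
  have sub: "set_integrable lborel A g" if "A \<subseteq> {0..}" "A \<in> sets borel" for A
    using that by (intro set_integrable_subset[OF int0]) auto
  define I where "I = (LINT r:{0..}|lborel. g r)"
  have eq: "I - integral {0..s} g = (LINT r:{s<..}|lborel. g r)" if s: "0 \<le> s" for s
  proof -
    have "I = (LINT r:{0..s} \<union> {s<..}|lborel. g r)"
      unfolding I_def using s by (intro arg_cong[where f="\<lambda>A. LINT r:A|lborel. g r"]) auto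
    also have "\<dots> = (LINT r:{0..s}|lborel. g r) + (LINT r:{s<..}|lborel. g r)"
      using s by (intro set_integral_Un sub) auto
    also have "(LINT r:{0..s}|lborel. g r) = integral {0..s} g"
      using s by (intro set_borel_integral_eq_integral(2) sub) auto
    finally show ?thesis by simp
  qed
  have "((\<lambda>u. integral {0..u} g) has_vector_derivative g t) (at t within {0..t + 1})"
    using t by (intro integral_has_vector_derivative continuous_on_subset[OF cont]) auto
  then have "((\<lambda>u. I - integral {0..u} g) has_vector_derivative - g t) (at t within {0..t + 1})"
    by (auto intro!: derivative_eq_intros)
  then have "((\<lambda>t. LINT r:{t<..}|lborel. g r) has_vector_derivative - g t) (at t within {0..t + 1})"
    by (rule has_vector_derivative_transform[rotated 2]) (use t eq in auto)
  \<comment> \<open>Differentiation is local: the two filters agree because the sets coincide near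
    t.\<close>
  moreover have "at t within {0..t + 1} = at t within {0..}"
    by (rule at_within_nhd[of _ "{t - 1<..<t + 1}"]) auto
  ultimately show ?thesis by simp
qed

section \<open>Weyl integrals and derivatives undo each other\<close>

lemma schwartz_set_integrable:
  assumes f: "f \<in> schwartz_plus"
  shows "set_integrable lborel {0<..} f"
proof -
  have "set_integrable lborel {0<..} (\<lambda>s. (s - 0) powr (1 - 1) *\<^sub>R f s)"
    by (rule schwartz_weyl_set_integrable[OF f]) auto
  then show ?thesis
    unfolding set_integrable_def
    by (rule Bochner_Integration.integrable_cong[THEN iffD1, rotated 2]) (auto simp: indicator_def)
qed

text \<open>The sum of \<open>weyl_integral 1 (hderiv f)\<close> and f has derivative 0, hence is
  constant; both summands decay at infinity, so the constant is 0.\<close>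

lemma schwartz_weyl_1_hderiv:
  assumes f: "f \<in> schwartz_plus" and t: "0 \<le> t"
  shows "weyl_integral 1 (hderiv f) t = - f t"
proof -
  note f' = schwartz_hderiv[OF f]
  define G where "G t = weyl_integral 1 (hderiv f) t + f t" for t
  have "(G has_vector_derivative 0) (at s within {0..})" if "s \<in> {0..}" for s
  proof -
    have s: "0 \<le> s" using that by simp
    have "((\<lambda>t. weyl_integral 1 (hderiv f) t) has_vector_derivative - hderiv f s) (at s within {0..})"
      unfolding weyl_integral_1
      by (rule tail_integral_deriv[OF schwartz_continuous[OF f'] schwartz_set_integrable[OF f'] s])
    from has_vector_derivative_add[OF this schwartz_has_deriv[OF f s]] show ?thesis
      by (simp add: G_def[abs_def])
  qed
  then obtain c where c: "\<And>s. s \<in> {0..} \<Longrightarrow> G s = c"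
    using has_vector_derivative_zero_constant[of "{0..}" G] by auto
  obtain A where A: "\<And>t. 0 \<le> t \<Longrightarrow> norm (f t) \<le> A * (1 + t) powr (- 1)"
    using schwartz_decay[OF f] by blast
  obtain B where B: "\<And>t. 0 \<le> t \<Longrightarrow> norm (weyl_integral 1 (hderiv f) t) \<le> B * (1 + t) powr (- 1)"
    using schwartz_weyl_decay[OF f' zero_less_one] by blast
  have "norm c \<le> (A + B) * (1 + real n) powr (- 1)" for n
  proof -
    have "norm c = norm (G (real n))" using c by simp
    also have "\<dots> \<le> norm (weyl_integral 1 (hderiv f) (real n)) + norm (f (real n))"
      unfolding G_def by (rule norm_triangle_ineq)
    also have "\<dots> \<le> B * (1 + real n) powr (- 1) + A * (1 + real n) powr (- 1)"
      by (intro add_mono A B) auto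
    finally show ?thesis by (simp only: distrib_right add.commute)
  qed
  moreover have "(\<lambda>n. (A + B) * (1 + real n) powr (- 1)) \<longlonglongrightarrow> 0"
    using tendsto_mult_left[OF LIMSEQ_inverse_real_of_nat, of "A + B"] by (simp add: powr_minus)
  ultimately have "norm c \<le> 0" by (intro LIMSEQ_le_const[of _ 0]) auto
  then show ?thesis using c[of t] t by (simp add: G_def eq_neg_iff_add_eq_0)
qed

lemma weyl_integral_uminus: "weyl_integral a (\<lambda>s. - f s) t = - weyl_integral a f t"
  using weyl_integral_scaleR[of a "-1" f t] by simp

text \<open>
  Instead of differentiating under the integral sign, write \<open>f = - W\<^bsup>-1\<^esup> f'\<close>, so that
  \<open>W\<^bsup>-a\<^esup> f = - W\<^bsup>-1\<^esup> (W\<^bsup>-a\<^esup> f')\<close> is the primitive of a continuous function.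
\<close>

lemma schwartz_weyl_hderiv:
  assumes f: "f \<in> schwartz_plus" and a: "0 < a" and t: "0 \<le> t"
  shows "hderiv (weyl_integral a f) t = weyl_integral a (hderiv f) t"
proof -
  note f' = schwartz_hderiv[OF f]
  have eq: "weyl_integral a f s = - (LINT r:{s<..}|lborel. weyl_integral a (hderiv f) r)" if s: "0 \<le> s" for s
  proof -
    have int: "set_integrable lborel {s<..} (\<lambda>r. (r - s) powr (a + 1 - 1) *\<^sub>R hderiv f r)"
      by (rule schwartz_weyl_set_integrable[OF f' _ s]) (use a in auto)
    have m: "set_borel_measurable borel {s<..} (hderiv f)"
      using s by (intro set_measurable_continuous_on continuous_on_subset[OF schwartz_continuous[OF f']]) auto
    have "weyl_integral a f s = weyl_integral a (\<lambda>r. - weyl_integral 1 (hderiv f) r) s"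
      using s by (intro weyl_integral_cong) (simp add: schwartz_weyl_1_hderiv[OF f])
    also have "\<dots> = - weyl_integral a (weyl_integral 1 (hderiv f)) s"
      by (rule weyl_integral_uminus)
    also have "weyl_integral a (weyl_integral 1 (hderiv f)) s = weyl_integral (a + 1) (hderiv f) s"
      by (rule weyl_integral_compose(2)[OF a zero_less_one int m])
    also have "\<dots> = weyl_integral 1 (weyl_integral a (hderiv f)) s"
      using weyl_integral_compose(2)[OF zero_less_one a _ m] int by (simp add: add.commute)
    finally show ?thesis by (simp add: weyl_integral_1)
  qed
  have cont: "continuous_on {0..} (weyl_integral a (hderiv f))"
    by (rule schwartz_weyl_continuous[OF f' a])
  have "set_integrable lborel {0<..} (weyl_integral a (hderiv f))"
  proof -
    have "set_integrable lborel {0<..} (\<lambda>r. (r - 0) powr (1 - 1) *\<^sub>R weyl_integral a (hderiv f) r)"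
    proof (rule weyl_integral_compose(1)[OF zero_less_one a])
      show "set_integrable lborel {0<..} (\<lambda>r. (r - 0) powr (1 + a - 1) *\<^sub>R hderiv f r)"
        using schwartz_weyl_set_integrable[OF f', of "1 + a" 0] a by simp
      show "set_borel_measurable borel {0<..} (hderiv f)"
        by (intro set_measurable_continuous_on continuous_on_subset[OF schwartz_continuous[OF f']]) auto
    qed
    then show ?thesis
      unfolding set_integrable_def
      by (rule Bochner_Integration.integrable_cong[THEN iffD1, rotated 2]) (auto simp: indicator_def)
  qed
  from tail_integral_deriv[OF cont this t]
  have "((\<lambda>s. - (LINT r:{s<..}|lborel. weyl_integral a (hderiv f) r)) has_vector_derivative weyl_integral a (hderiv f) t) (at t within {0..})"
    using has_vector_derivative_minus by force
  then have "hderiv (\<lambda>s. - (LINT r:{s<..}|lborel. weyl_integral a (hderiv f) r)) t = weyl_integral a (hderiv f) t"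
    by (rule hderivI[OF _ t])
  then show ?thesis using hderiv_cong[OF eq t] by simp
qed

lemma schwartz_weyl_hderiv_funpow:
  assumes f: "f \<in> schwartz_plus" and a: "0 < a"
  shows "0 \<le> t \<Longrightarrow> (hderiv ^^ n) (weyl_integral a f) t = weyl_integral a ((hderiv ^^ n) f) t"
proof (induction n arbitrary: t)
  case (Suc n)
  have "(hderiv ^^ Suc n) (weyl_integral a f) t = hderiv (weyl_integral a ((hderiv ^^ n) f)) t"
    using hderiv_cong[OF Suc.IH Suc.prems] by simp
  also have "\<dots> = weyl_integral a ((hderiv ^^ Suc n) f) t"
    using schwartz_weyl_hderiv[OF schwartz_hderiv_funpow[OF f] a Suc.prems] by simp
  finally show ?case .
qed simp

lemma schwartz_weyl_compose:
  assumes f: "f \<in> schwartz_plus" and ab: "0 < a" "0 < b" and t: "0 \<le> t"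
  shows "weyl_integral a (weyl_integral b f) t = weyl_integral (a + b) f t"
proof (rule weyl_integral_compose(2)[OF ab])
  show "set_integrable lborel {t<..} (\<lambda>r. (r - t) powr (a + b - 1) *\<^sub>R f r)"
    by (rule schwartz_weyl_set_integrable[OF f _ t]) (use ab in auto)
  show "set_borel_measurable borel {t<..} f"
    using t by (intro set_measurable_continuous_on continuous_on_subset[OF schwartz_continuous[OF f]]) auto
qed

text \<open>Each innermost integration of order 1 removes one derivative and contributes one
  sign.\<close>

lemma schwartz_weyl_nat_hderiv:
  assumes f: "f \<in> schwartz_plus"
  shows "0 \<le> t \<Longrightarrow> weyl_integral (real (Suc n)) ((hderiv ^^ Suc n) f) t = (-1) ^ Suc n * f t"
proof (induction n arbitrary: t)
  case 0
  then show ?case by (simp add: schwartz_weyl_1_hderiv[OF f])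
next
  case (Suc n)
  note fS = schwartz_hderiv_funpow[OF f, of "Suc (Suc n)"]
  have "weyl_integral (real (Suc (Suc n))) ((hderiv ^^ Suc (Suc n)) f) t
      = weyl_integral (real (Suc n) + 1) ((hderiv ^^ Suc (Suc n)) f) t" by simp
  also have "\<dots> = weyl_integral (real (Suc n)) (weyl_integral 1 ((hderiv ^^ Suc (Suc n)) f)) t"
    by (rule schwartz_weyl_compose[OF fS _ _ Suc.prems, symmetric]) auto
  also have "\<dots> = weyl_integral (real (Suc n)) (\<lambda>s. - (hderiv ^^ Suc n) f s) t"
    using Suc.prems schwartz_weyl_1_hderiv[OF schwartz_hderiv_funpow[OF f, of "Suc n"]]
    by (intro weyl_integral_cong) simp
  also have "\<dots> = - weyl_integral (real (Suc n)) ((hderiv ^^ Suc n) f) t"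
    by (rule weyl_integral_uminus)
  also have "\<dots> = (-1) ^ Suc (Suc n) * f t"
    using Suc.IH[OF Suc.prems] by simp
  finally show ?case .
qed

text \<open>With the derivatives moved onto f, the Weyl derivative is a Weyl integral of a Schwartz
  function. Decay, continuity and linearity are inherited from there. The order
  \<open>real (Suc n) - a\<close> lies in (0, 1] and equals 1 for integer \<open>a\<close>.\<close>

lemma weyl_deriv_eq:
  assumes f: "f \<in> schwartz_plus" and a: "0 < a" and t: "0 \<le> t" and n: "n = nat \<lfloor>a\<rfloor>"
  shows "weyl_deriv a f t = (-1) ^ Suc n * weyl_integral (real (Suc n) - a) ((hderiv ^^ Suc n) f) t"
proof -
  have "0 < real (Suc n) - a" using n a by linarith
  then show ?thesis
    using a n schwartz_weyl_hderiv_funpow[OF f _ t, of "real (Suc n) - a" "Suc n"]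
    by (simp add: weyl_deriv_def Let_def)
qed

lemma weyl_integral_cmult: "weyl_integral a (\<lambda>s. c * f s) t = c * weyl_integral a f t"
proof -
  have "(LINT s:{t<..}|lborel. (s - t) powr (a - 1) *\<^sub>R (c * f s)) = (LINT s|lborel. c * (indicator {t<..} s *\<^sub>R ((s - t) powr (a - 1) *\<^sub>R f s)))"
    unfolding set_lebesgue_integral_def by (simp only: mult_scaleR_right)
  also have "\<dots> = c * (LINT s:{t<..}|lborel. (s - t) powr (a - 1) *\<^sub>R f s)"
    unfolding set_lebesgue_integral_def by (rule integral_mult_right_zero)
  finally show ?thesis by (simp add: weyl_integral_def)
qed

text \<open>The orders a and Suc n - a add up to the integer Suc n, where
  \<open>schwartz_weyl_nat_hderiv\<close> recovers f; the two signs cancel.\<close>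

lemma weyl_integral_weyl_deriv:
  assumes f: "f \<in> schwartz_plus" and a: "0 < a" and t: "0 \<le> t"
  shows "weyl_integral a (weyl_deriv a f) t = f t"
proof -
  define n where "n = nat \<lfloor>a\<rfloor>"
  have g: "0 < real (Suc n) - a" using a by (simp add: n_def) linarith
  have "weyl_integral a (weyl_deriv a f) t
      = weyl_integral a (\<lambda>s. (-1) ^ Suc n * weyl_integral (real (Suc n) - a) ((hderiv ^^ Suc n) f) s) t"
    using t by (intro weyl_integral_cong weyl_deriv_eq[OF f a _ n_def]) simp
  also have "\<dots> = (-1) ^ Suc n * weyl_integral a (weyl_integral (real (Suc n) - a) ((hderiv ^^ Suc n) f)) t"
    by (rule weyl_integral_cmult)
  also have "weyl_integral a (weyl_integral (real (Suc n) - a) ((hderiv ^^ Suc n) f)) t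
      = weyl_integral (real (Suc n)) ((hderiv ^^ Suc n) f) t"
    using schwartz_weyl_compose[OF schwartz_hderiv_funpow[OF f, of "Suc n"] a g t]
    by (simp del: funpow.simps of_nat_Suc)
  also have "\<dots> = (-1) ^ Suc n * f t"
    by (rule schwartz_weyl_nat_hderiv[OF f t])
  finally show ?thesis by (simp add: power_mult_distrib[symmetric] mult.assoc[symmetric] del: power_Suc)
qed

lemma weyl_deriv_decay:
  assumes f: "f \<in> schwartz_plus" and a: "0 < a"
  obtains C where "0 \<le> C" "\<And>t. 0 \<le> t \<Longrightarrow> norm (weyl_deriv a f t) \<le> C * (1 + t) powr (- m)"
proof -
  define n where "n = nat \<lfloor>a\<rfloor>"
  have g: "0 < real (Suc n) - a" using a by (simp add: n_def) linarith
  show ?thesis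
    using schwartz_weyl_decay[OF schwartz_hderiv_funpow[OF f, of "Suc n"] g, where m=m] that
    by (simp add: weyl_deriv_eq[OF f a _ n_def] norm_mult norm_power del: power_Suc funpow.simps of_nat_Suc) blast
qed

lemma weyl_deriv_continuous:
  assumes f: "f \<in> schwartz_plus" and a: "0 < a"
  shows "continuous_on {0..} (weyl_deriv a f)"
proof -
  define n where "n = nat \<lfloor>a\<rfloor>"
  have g: "0 < real (Suc n) - a" using a by (simp add: n_def) linarith
  have "continuous_on {0..} (\<lambda>t. (-1) ^ Suc n * weyl_integral (real (Suc n) - a) ((hderiv ^^ Suc n) f) t)"
    by (intro continuous_on_mult continuous_on_const schwartz_weyl_continuous schwartz_hderiv_funpow f g)
  then show ?thesis
    by (rule continuous_on_cong[THEN iffD1, rotated 2]) (simp_all add: weyl_deriv_eq[OF f a _ n_def] del: power_Suc funpow.simps of_nat_Suc)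
qed

lemma weyl_deriv_lin:
  assumes f: "f \<in> schwartz_plus" and g: "g \<in> schwartz_plus" and a: "0 < a" and t: "0 \<le> t"
  shows "weyl_deriv a (\<lambda>t. f t + c * g t) t = weyl_deriv a f t + c * weyl_deriv a g t"
proof -
  define n where "n = nat \<lfloor>a\<rfloor>"
  define b where "b = real (Suc n) - a"
  have b: "0 < b" using a by (simp add: n_def b_def) linarith
  define F where "F = (hderiv ^^ Suc n) f"
  define G where "G = (hderiv ^^ Suc n) g"
  have FG: "F \<in> schwartz_plus" "G \<in> schwartz_plus"
    unfolding F_def G_def using f g by (blast intro: schwartz_hderiv_funpow)+
  have i: "integrable halfline (\<lambda>u. u powr (b - 1) *\<^sub>R F (t + u))" "integrable halfline (\<lambda>u. u powr (b - 1) *\<^sub>R G (t + u))"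
    by (rule schwartz_weyl_integrable[OF FG(1) b t], rule schwartz_weyl_integrable[OF FG(2) b t])
  have "weyl_integral b ((hderiv ^^ Suc n) (\<lambda>t. f t + c * g t)) t = weyl_integral b (\<lambda>s. F s + c * G s) t"
    unfolding F_def G_def using t by (intro weyl_integral_cong schwartz_lin_aux f g) simp
  also have "\<dots> = weyl_integral b F t + c * weyl_integral b G t"
  proof -
    have "(LINT u|halfline. u powr (b - 1) *\<^sub>R (F (t + u) + c * G (t + u)))
        = (LINT u|halfline. u powr (b - 1) *\<^sub>R F (t + u) + c * (u powr (b - 1) *\<^sub>R G (t + u)))"
      by (simp only: scaleR_add_right mult_scaleR_right)
    also have "\<dots> = (LINT u|halfline. u powr (b - 1) *\<^sub>R F (t + u)) + c * (LINT u|halfline. u powr (b - 1) *\<^sub>R G (t + u))"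
      using i by (subst Bochner_Integration.integral_add) (auto intro: integrable_mult_right simp del: mult_scaleR_right)
    finally show ?thesis by (simp add: weyl_integral_shift scaleR_add_right)
  qed
  finally show ?thesis
    using weyl_deriv_eq[OF schwartz_lin[OF f g, of c] a t n_def] weyl_deriv_eq[OF f a t n_def] weyl_deriv_eq[OF g a t n_def]
    by (simp add: b_def F_def G_def algebra_simps del: power_Suc funpow.simps of_nat_Suc)
qed

text \<open>The operator \<open>D_+^a\<close>. The pre-norm is the L^p norm of its value, and its
  image of the Schwartz class is to be shown dense in L^p.\<close>

definition weighted_deriv :: "real \<Rightarrow> (real \<Rightarrow> complex) \<Rightarrow> real \<Rightarrow> complex" where
  "weighted_deriv a f t = (t powr a / Gamma (a + 1)) *\<^sub>R weyl_deriv a f t"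

lemma weighted_deriv_Lp:
  assumes f: "f \<in> schwartz_plus" and a: "0 < a" and p: "1 \<le> p"
  shows "weighted_deriv a f \<in> Lp_space p"
proof -
  have "weyl_deriv a f \<in> borel_measurable halfline"
    unfolding measurable_halfline_iff
    by (intro set_measurable_continuous_on continuous_on_subset[OF weyl_deriv_continuous[OF f a]]) auto
  note [measurable] = this
  have m: "weighted_deriv a f \<in> borel_measurable halfline"
    unfolding weighted_deriv_def by measurable
  \<comment> \<open>The exponent a + 2 compensates t^a and leaves (1 + t)^(-2), whose p-th power is
    still integrable since p is at least 1.\<close>
  obtain C where C: "0 \<le> C" "\<And>t. 0 \<le> t \<Longrightarrow> norm (weyl_deriv a f t) \<le> C * (1 + t) powr (- (a + 2))"
    using weyl_deriv_decay[OF f a, where m="a + 2"] by blast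
  have G: "Gamma (a + 1) > 0" using a by (intro Gamma_real_pos) auto
  have B: "integrable halfline (\<lambda>u. (C / Gamma (a + 1)) powr p * (u powr (1 - 1) / (1 + u) powr (1 + 1)))"
    by (rule integrable_Beta_halfline[OF zero_less_one zero_less_one])
  have "integrable halfline (\<lambda>t. norm (weighted_deriv a f t) powr p)"
  proof (rule Bochner_Integration.integrable_bound[OF B])
    show "AE t in halfline. norm (norm (weighted_deriv a f t) powr p)
        \<le> norm ((C / Gamma (a + 1)) powr p * (t powr (1 - 1) / (1 + t) powr (1 + 1)))"
    proof (rule AE_I2)
      fix t assume "t \<in> space halfline"
      then have t: "t > 0" by simp
      have "norm (weighted_deriv a f t) = t powr a / Gamma (a + 1) * norm (weyl_deriv a f t)"
        using G by (simp add: weighted_deriv_def)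
      also have "\<dots> \<le> (1 + t) powr a / Gamma (a + 1) * (C * (1 + t) powr (- (a + 2)))"
        using t a G by (intro mult_mono divide_right_mono powr_mono2 C) auto
      also have "\<dots> = (C / Gamma (a + 1)) * (1 + t) powr (- 2)"
        by (simp add: powr_add[symmetric])
      finally have "norm (weighted_deriv a f t) powr p \<le> ((C / Gamma (a + 1)) * (1 + t) powr (- 2)) powr p"
        using p by (intro powr_mono2) auto
      also have "\<dots> = (C / Gamma (a + 1)) powr p * (1 + t) powr (- 2 * p)"
        using C(1) G by (subst powr_mult) (auto simp: powr_powr)
      also have "\<dots> \<le> (C / Gamma (a + 1)) powr p * (1 + t) powr (- 2)"
        using t p by (intro mult_left_mono powr_mono) auto
      finally show "norm (norm (weighted_deriv a f t) powr p)
        \<le> norm ((C / Gamma (a + 1)) powr p * (t powr (1 - 1) / (1 + t) powr (1 + 1)))"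
        using t by (simp add: powr_minus divide_inverse)
    qed
  qed (use m in measurable)
  then show ?thesis using m by (simp add: Lp_space_def)
qed

lemma sobolev_prenorm_eq:
  assumes "0 < a" "1 \<le> p"
  shows "sobolev_prenorm a p f = Lp_norm p (weighted_deriv a f)"
proof -
  have G: "Gamma (a + 1) > 0" using assms by (intro Gamma_real_pos) auto
  have "(LINT t|halfline. norm (weighted_deriv a f t) powr p)
      = (LINT t|halfline. (1 / Gamma (a + 1)) powr p * (norm (weyl_deriv a f t) powr p * t powr (a * p)))"
    using G by (intro Bochner_Integration.integral_cong)
      (auto simp: weighted_deriv_def powr_mult powr_divide powr_powr)
  also have "\<dots> = (1 / Gamma (a + 1)) powr p * (LINT t|halfline. norm (weyl_deriv a f t) powr p * t powr (a * p))"
    by (rule integral_mult_right_zero)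
  finally show ?thesis
    using G assms by (simp add: Lp_norm_def sobolev_prenorm_def powr_mult powr_powr integral_nonneg_AE powr_divide)
qed

text \<open>The weights s^(-a) and s^a cancel, leaving the Weyl integral of the Weyl derivative; the
  constants cancel by Gamma(a + 1) = a Gamma(a).\<close>

lemma hom_op_weighted_deriv:
  assumes f: "f \<in> schwartz_plus" and a: "0 < a" and t: "0 < t"
  shows "a *\<^sub>R hom_op (weyl_kernel a a) (weighted_deriv a f) t = f t"
proof -
  have G: "Gamma a \<noteq> 0" "Gamma (a + 1) = a * Gamma a"
  proof -
    show "Gamma a \<noteq> 0" using Gamma_real_pos[OF a] by simp
    have "a \<notin> \<int>\<^sub>\<le>\<^sub>0" using a by (auto elim!: nonpos_Ints_cases)
    then show "Gamma (a + 1) = a * Gamma a" by (rule Gamma_plus1)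
  qed
  have "hom_op (weyl_kernel a a) (weighted_deriv a f) t
      = Gamma a *\<^sub>R weyl_integral a (\<lambda>s. s powr (- a) *\<^sub>R weighted_deriv a f s) t"
    using hom_op_weyl[OF a t, of a] t by simp
  also have "weyl_integral a (\<lambda>s. s powr (- a) *\<^sub>R weighted_deriv a f s) t
      = weyl_integral a (\<lambda>s. (1 / Gamma (a + 1)) *\<^sub>R weyl_deriv a f s) t"
    using t by (intro weyl_integral_cong) (simp add: weighted_deriv_def powr_minus)
  also have "\<dots> = (1 / Gamma (a + 1)) *\<^sub>R f t"
    using weyl_integral_weyl_deriv[OF f a, of t] t by (simp only: weyl_integral_scaleR)
  finally show ?thesis using G a by simp
qed

section \<open>Density of the weighted derivatives\<close>

lemma weighted_deriv_lin:
  assumes "f \<in> schwartz_plus" "g \<in> schwartz_plus" "0 < a" "0 \<le> t"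
  shows "weighted_deriv a (\<lambda>t. f t + c * g t) t = weighted_deriv a f t + c * weighted_deriv a g t"
  using weyl_deriv_lin[OF assms, of c] by (simp add: weighted_deriv_def scaleR_add_right)

section \<open>Exponentials as eigenfunctions of Weyl derivatives\<close>

definition exp_decay :: "real \<Rightarrow> real \<Rightarrow> complex" where
  "exp_decay c t = complex_of_real (exp (- c * t))"

lemma exp_decay_deriv: "(exp_decay c has_vector_derivative - complex_of_real c * exp_decay c t) (at t within S)"
proof -
  have "((\<lambda>t. exp (- c * t)) has_real_derivative - c * exp (- c * t)) (at t within S)"
    by (auto intro!: derivative_eq_intros)
  from has_vector_derivative_of_real[OF this] show ?thesis
    by (simp add: exp_decay_def[abs_def])
qed

lemma exp_decay_hderiv_funpow:
  "0 \<le> t \<Longrightarrow> (hderiv ^^ n) (exp_decay c) t = (- complex_of_real c) ^ n * exp_decay c t"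
proof (induction n arbitrary: t)
  case (Suc n)
  have "hderiv ((hderiv ^^ n) (exp_decay c)) t = hderiv (\<lambda>t. (- complex_of_real c) ^ n * exp_decay c t) t"
    by (rule hderiv_cong[OF Suc.IH Suc.prems])
  also have "\<dots> = (- complex_of_real c) ^ n * (- complex_of_real c * exp_decay c t)"
    by (intro hderivI has_vector_derivative_mult_right exp_decay_deriv Suc.prems)
  finally show ?case by simp
qed simp

lemma power_mult_exp_bounded:
  assumes c: "0 < (c :: real)"
  shows "\<exists>C. \<forall>t\<ge>0. t ^ m * exp (- c * t) \<le> C"
proof (cases "m = 0")
  case True
  then show ?thesis using c by (intro exI[of _ 1]) auto
next
  case False
  show ?thesis
  proof (intro exI allI impI)
    fix t :: real assume t: "0 \<le> t"
    \<comment> \<open>The bound x <= e^x is used at x = ct/m, so that its m-th power gives exactly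
      e^(ct).\<close>
    have "t = (m / c) * (c * t / m)" using c False by simp
    also have "\<dots> \<le> (m / c) * exp (c * t / m)"
      using exp_ge_add_one_self[of "c * t / m"] c by (intro mult_left_mono, linarith, simp)
    finally have "t ^ m \<le> ((m / c) * exp (c * t / m)) ^ m"
      using t by (intro power_mono) auto
    also have "\<dots> = (m / c) ^ m * exp (c * t)"
    proof -
      have "exp (c * t / m) ^ m = exp (c * t)" using False by (simp add: exp_of_nat_mult[symmetric])
      then show ?thesis by (simp only: power_mult_distrib)
    qed
    finally have "t ^ m * exp (- c * t) \<le> (m / c) ^ m * exp (c * t) * exp (- c * t)"
      by (intro mult_right_mono) auto
    moreover have "exp (c * t) * exp (- c * t) = 1" by (simp add: exp_add[symmetric])
    ultimately show "t ^ m * exp (- c * t) \<le> (m / c) ^ m" by (simp only: mult.assoc mult_1_right)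
  qed
qed

lemma exp_decay_schwartz:
  assumes c: "0 < c"
  shows "exp_decay c \<in> schwartz_plus"
  unfolding schwartz_plus_def mem_Collect_eq
proof (intro allI conjI impI)
  fix n :: nat and t :: real assume t: "0 \<le> t"
  have "(\<lambda>t. (- complex_of_real c) ^ n * exp_decay c t) differentiable (at t within {0..})"
    by (rule differentiableI_vector[OF has_vector_derivative_mult_right[OF exp_decay_deriv]])
  then show "(hderiv ^^ n) (exp_decay c) differentiable (at t within {0..})"
    by (rule differentiable_halfline_cong[OF _ t]) (simp add: exp_decay_hderiv_funpow)
next
  fix n m :: nat
  obtain C where C: "\<And>t. t \<ge> 0 \<Longrightarrow> t ^ m * exp (- c * t) \<le> C"
    using power_mult_exp_bounded[OF c] by blast
  show "\<exists>C. \<forall>t\<ge>0. norm (t ^ m *\<^sub>R (hderiv ^^ n) (exp_decay c) t) \<le> C"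
  proof (intro exI allI impI)
    fix t :: real assume t: "0 \<le> t"
    have "norm (t ^ m *\<^sub>R (hderiv ^^ n) (exp_decay c) t) = c ^ n * (t ^ m * exp (- c * t))"
      using t c by (simp add: exp_decay_hderiv_funpow norm_mult norm_power exp_decay_def)
    also have "\<dots> \<le> c ^ n * C"
      using c by (intro mult_left_mono C t) auto
    finally show "norm (t ^ m *\<^sub>R (hderiv ^^ n) (exp_decay c) t) \<le> c ^ n * C" .
  qed
qed

lemma integral_powr_mult_exp:
  fixes c :: real
  assumes g: "0 < g" and c: "0 < c"
  shows "(LINT u|halfline. u powr (g - 1) * exp (- c * u)) = Gamma g * c powr (- g)"
proof -
  define F where "F u = indicator {0..} u * u powr (g - 1) / exp u" for u :: real
  have [measurable]: "F \<in> borel_measurable borel" unfolding F_def by measurable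
  have "integral\<^sup>L lborel F = enn2real (\<integral>\<^sup>+u. ennreal (F u) \<partial>lborel)"
    by (intro integral_eq_nn_integral) (auto simp: F_def)
  also have "(\<integral>\<^sup>+u. ennreal (F u) \<partial>lborel) = ennreal (Gamma g)"
    using Gamma_conv_nn_integral_real[OF g] by (simp add: F_def)
  finally have 1: "integral\<^sup>L lborel F = Gamma g" using Gamma_real_pos[OF g] by simp
  have "F (0 + c * u) = c powr (g - 1) * (indicator {0<..} u *\<^sub>R (u powr (g - 1) * exp (- c * u)))" if "u \<noteq> 0" for u
    using c that by (cases "u > 0") (auto simp: F_def powr_mult exp_minus divide_inverse indicator_def zero_le_mult_iff)
  \<comment> \<open>At 0 both sides vanish since \<open>0 powr x = 0\<close>, although only the left
    indicator contains 0.\<close>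
  moreover have "F (0 + c * 0) = c powr (g - 1) * (indicator {0<..} 0 *\<^sub>R (0 powr (g - 1) * exp (- c * 0)))"
    by (simp add: F_def)
  ultimately have "F (0 + c * u) = c powr (g - 1) * (indicator {0<..} u *\<^sub>R (u powr (g - 1) * exp (- c * u)))" for u
    by (cases "u = 0") auto
  then have "(LINT u|lborel. F (0 + c * u)) = (LINT u|lborel. c powr (g - 1) * (indicator {0<..} u *\<^sub>R (u powr (g - 1) * exp (- c * u))))"
    by (simp only:)
  also have "\<dots> = c powr (g - 1) * (LINT u|halfline. u powr (g - 1) * exp (- c * u))"
    unfolding integral_halfline_eq set_lebesgue_integral_def by (rule integral_mult_right_zero)
  finally have "Gamma g = c * (c powr (g - 1) * (LINT u|halfline. u powr (g - 1) * exp (- c * u)))"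
    using 1 lborel_integral_real_affine[of c F 0] c by simp
  then show ?thesis
    using c by (simp add: powr_diff powr_minus field_simps)
qed

lemma weyl_integral_exp_decay:
  assumes g: "0 < g" and c: "0 < c"
  shows "weyl_integral g (exp_decay c) t = c powr (- g) *\<^sub>R exp_decay c t"
proof -
  have "u powr (g - 1) *\<^sub>R exp_decay c (t + u) = exp_decay c t * complex_of_real (u powr (g - 1) * exp (- c * u))" for u
    by (simp add: exp_decay_def scaleR_conv_of_real distrib_left exp_diff exp_minus field_simps flip: of_real_mult of_real_divide)
  then have "(LINT u|halfline. u powr (g - 1) *\<^sub>R exp_decay c (t + u))
      = exp_decay c t * complex_of_real (LINT u|halfline. u powr (g - 1) * exp (- c * u))"
    by (simp only: integral_mult_right_zero integral_complex_of_real)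
  also have "\<dots> = exp_decay c t * complex_of_real (Gamma g * c powr (- g))"
    by (simp only: integral_powr_mult_exp[OF g c])
  finally show ?thesis
    using Gamma_real_pos[OF g] by (simp add: weyl_integral_shift scaleR_conv_of_real)
qed

lemma weighted_deriv_exp_decay:
  assumes a: "0 < a" and c: "0 < c" and t: "0 \<le> t"
  shows "weighted_deriv a (exp_decay c) t = (c powr a / Gamma (a + 1)) *\<^sub>R (t powr a *\<^sub>R exp_decay c t)"
proof -
  define n where "n = Suc (nat \<lfloor>a\<rfloor>)"
  define b where "b = real n - a"
  have b: "0 < b" using a by (simp add: b_def n_def) linarith
  have "weyl_deriv a (exp_decay c) t = (-1) ^ n * weyl_integral b ((hderiv ^^ n) (exp_decay c)) t"
    unfolding n_def b_def by (rule weyl_deriv_eq[OF exp_decay_schwartz[OF c] a t refl])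
  also have "weyl_integral b ((hderiv ^^ n) (exp_decay c)) t = weyl_integral b (\<lambda>s. (- complex_of_real c) ^ n * exp_decay c s) t"
    using t by (intro weyl_integral_cong exp_decay_hderiv_funpow) simp
  also have "\<dots> = (- complex_of_real c) ^ n * (c powr (- b) *\<^sub>R exp_decay c t)"
    by (simp only: weyl_integral_cmult weyl_integral_exp_decay[OF b c])
  also have "(-1) ^ n * \<dots> = complex_of_real (c ^ n * c powr (- b)) * exp_decay c t"
    by (simp add: scaleR_conv_of_real mult.assoc[symmetric] power_mult_distrib[symmetric])
  also have "c ^ n * c powr (- b) = c powr a"
    using c by (simp add: powr_realpow[symmetric] powr_add[symmetric] b_def)
  finally show ?thesis by (simp add: weighted_deriv_def scaleR_conv_of_real)
qed

text \<open>Membership in the closure of the weighted derivatives. The class is enlarged in stages: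
  \<open>base_weight\<close> times polynomials in e^(-t), then continuous functions of e^(-t),
  indicators and simple functions.\<close>

definition approximable :: "real \<Rightarrow> real \<Rightarrow> (real \<Rightarrow> complex) \<Rightarrow> bool" where
  "approximable a p h \<longleftrightarrow> h \<in> Lp_space p \<and>
     (\<forall>e>0. \<exists>\<phi>\<in>schwartz_plus. Lp_norm p (\<lambda>t. weighted_deriv a \<phi> t - h t) < e)"

lemma approximable_in_Lp: "approximable a p h \<Longrightarrow> h \<in> Lp_space p"
  by (simp add: approximable_def)

lemma Lp_space_cong_pos:
  assumes "f \<in> Lp_space p" "\<And>t. 0 < t \<Longrightarrow> g t = f t"
  shows "g \<in> Lp_space p"
proof -
  have "f \<in> borel_measurable halfline \<longleftrightarrow> g \<in> borel_measurable halfline"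
    by (intro measurable_cong) (use assms in auto)
  moreover have "integrable halfline (\<lambda>t. norm (f t) powr p) \<longleftrightarrow> integrable halfline (\<lambda>t. norm (g t) powr p)"
    by (intro Bochner_Integration.integrable_cong) (use assms in auto)
  ultimately show ?thesis using assms(1) by (simp add: Lp_space_def)
qed

lemma Lp_norm_cong_pos:
  assumes "\<And>t. 0 < t \<Longrightarrow> g t = f t"
  shows "Lp_norm p g = Lp_norm p f"
  unfolding Lp_norm_def
  by (intro arg_cong[where f="\<lambda>x. x powr (1 / p)"] Bochner_Integration.integral_cong) (use assms in auto)

context
  fixes a p :: real
  assumes a: "0 < a" and p: "1 \<le> p"
begin

lemma approximable_cong:
  assumes "approximable a p h" "\<And>t. 0 < t \<Longrightarrow> h' t = h t"
  shows "approximable a p h'"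
proof -
  have "Lp_norm p (\<lambda>t. weighted_deriv a \<phi> t - h' t) = Lp_norm p (\<lambda>t. weighted_deriv a \<phi> t - h t)" for \<phi>
    by (rule Lp_norm_cong_pos) (simp add: assms)
  then show ?thesis
    using assms Lp_space_cong_pos[OF _ assms(2)] by (simp add: approximable_def)
qed

lemma approximable_lin:
  assumes h: "approximable a p h" and k: "approximable a p k"
  shows "approximable a p (\<lambda>t. h t + c * k t)"
  unfolding approximable_def
proof (intro conjI allI impI)
  have hL: "h \<in> Lp_space p" and kL: "k \<in> Lp_space p" using h k by (auto simp: approximable_def)
  show "(\<lambda>t. h t + c * k t) \<in> Lp_space p" by (intro Lp_space_add Lp_space_cmult hL kL p)
  fix e :: real assume e: "e > 0"
  have "0 < e / 2 / (norm c + 1)" using e by (simp add: add_nonneg_pos)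
  then obtain \<phi> \<psi> where S: "\<phi> \<in> schwartz_plus" "\<psi> \<in> schwartz_plus"
    and n: "Lp_norm p (\<lambda>t. weighted_deriv a \<phi> t - h t) < e / 2" "Lp_norm p (\<lambda>t. weighted_deriv a \<psi> t - k t) < e / 2 / (norm c + 1)"
    using h k e unfolding approximable_def by (meson half_gt_zero)
  note L = Lp_space_diff[OF weighted_deriv_Lp[OF S(1) a p] hL p] Lp_space_diff[OF weighted_deriv_Lp[OF S(2) a p] kL p]
  have "Lp_norm p (\<lambda>t. weighted_deriv a (\<lambda>t. \<phi> t + c * \<psi> t) t - (h t + c * k t))
      = Lp_norm p (\<lambda>t. (weighted_deriv a \<phi> t - h t) + c * (weighted_deriv a \<psi> t - k t))"
    by (rule Lp_norm_cong_pos) (simp add: weighted_deriv_lin[OF S a] algebra_simps)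
  also have "\<dots> \<le> Lp_norm p (\<lambda>t. weighted_deriv a \<phi> t - h t) + Lp_norm p (\<lambda>t. c * (weighted_deriv a \<psi> t - k t))"
    by (intro Lp_norm_triangle Lp_space_cmult L p)
  also have "Lp_norm p (\<lambda>t. c * (weighted_deriv a \<psi> t - k t)) = norm c * Lp_norm p (\<lambda>t. weighted_deriv a \<psi> t - k t)"
    by (rule Lp_norm_cmult[OF p])
  also have "norm c * Lp_norm p (\<lambda>t. weighted_deriv a \<psi> t - k t) \<le> norm c * (e / 2 / (norm c + 1))"
    using n by (intro mult_left_mono) auto
  also have "\<dots> = e / 2 * (norm c / (norm c + 1))" by simp
  also have "\<dots> \<le> e / 2 * 1"
    using e by (intro mult_left_mono) (auto simp: divide_le_eq add_nonneg_pos)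
  finally have "Lp_norm p (\<lambda>t. weighted_deriv a (\<lambda>t. \<phi> t + c * \<psi> t) t - (h t + c * k t)) < e"
    using n by linarith
  then show "\<exists>\<phi>\<in>schwartz_plus. Lp_norm p (\<lambda>t. weighted_deriv a \<phi> t - (h t + c * k t)) < e"
    using schwartz_lin[OF S] by blast
qed

lemma approximable_limit:
  assumes h: "h \<in> Lp_space p" and hn: "\<And>n. approximable a p (H n)"
    and lim: "(\<lambda>n. Lp_norm p (\<lambda>t. H n t - h t)) \<longlonglongrightarrow> 0"
  shows "approximable a p h"
  unfolding approximable_def
proof (intro conjI allI impI h)
  fix e :: real assume e: "e > 0"
  then have "\<forall>\<^sub>F n in sequentially. Lp_norm p (\<lambda>t. H n t - h t) < e / 2"
    by (intro order_tendstoD(2)[OF lim]) auto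
  then obtain n where n: "Lp_norm p (\<lambda>t. H n t - h t) < e / 2" by (auto simp: eventually_sequentially)
  obtain \<phi> where \<phi>: "\<phi> \<in> schwartz_plus" "Lp_norm p (\<lambda>t. weighted_deriv a \<phi> t - H n t) < e / 2"
    using hn[of n] e unfolding approximable_def by (meson half_gt_zero)
  have "Lp_norm p (\<lambda>t. weighted_deriv a \<phi> t - h t) < e"
    using Lp_norm_diff_triangle[OF weighted_deriv_Lp[OF \<phi>(1) a p] _ h p, of "H n"] hn[of n] n \<phi>(2)
    by (simp add: approximable_def)
  then show "\<exists>\<phi>\<in>schwartz_plus. Lp_norm p (\<lambda>t. weighted_deriv a \<phi> t - h t) < e"
    using \<phi>(1) by blast
qed

lemma approximable_sum:
  assumes "finite A" "\<And>x. x \<in> A \<Longrightarrow> approximable a p (H x)"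
  shows "approximable a p (\<lambda>t. \<Sum>x\<in>A. H x t)"
  using assms
proof (induction A rule: finite_induct)
  case empty
  have S: "exp_decay 1 \<in> schwartz_plus" by (rule exp_decay_schwartz) simp
  have "approximable a p (weighted_deriv a (exp_decay 1))"
    unfolding approximable_def using S weighted_deriv_Lp[OF S a p]
    by (auto intro!: bexI[of _ "exp_decay 1"])
  from approximable_lin[OF this this, of "-1"] show ?case by simp
next
  case (insert x A)
  then have "approximable a p (\<lambda>t. H x t + 1 * (\<Sum>y\<in>A. H y t))"
    by (intro approximable_lin) auto
  then show ?case using insert by simp
qed

text \<open>The common factor: t^a e^(-(i+1)t) is \<open>base_weight t\<close> times the i-th power
  of e^(-t). It lies in L^p, so it converts uniform or bounded pointwise convergence into L^p
  convergence, and it has no zero on the positive reals.\<close>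

definition base_weight :: "real \<Rightarrow> complex" where
  "base_weight t = complex_of_real (t powr a * exp (- t))"

lemma approximable_exp:
  assumes c: "0 < c"
  shows "approximable a p (\<lambda>t. z * (t powr a *\<^sub>R exp_decay c t))"
proof -
  have S: "exp_decay c \<in> schwartz_plus" by (rule exp_decay_schwartz[OF c])
  have 1: "approximable a p (weighted_deriv a (exp_decay c))"
    unfolding approximable_def using S weighted_deriv_Lp[OF S a p]
    by (auto intro!: bexI[of _ "exp_decay c"])
  have 0: "approximable a p (\<lambda>t. 0)" using approximable_sum[of "{}"] by simp
  have G: "Gamma (a + 1) > 0" using a by (intro Gamma_real_pos) auto
  from approximable_lin[OF 0 1, of "z * complex_of_real (Gamma (a + 1) / c powr a)"]
  show ?thesis
    by (rule approximable_cong) (use weighted_deriv_exp_decay[OF a c] c G in \<open>simp add: scaleR_conv_of_real\<close>)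
qed

lemma base_weight_Lp: "base_weight \<in> Lp_space p"
proof -
  have "approximable a p base_weight"
    by (rule approximable_cong[OF approximable_exp[OF zero_less_one, of 1]])
      (simp add: base_weight_def exp_decay_def scaleR_conv_of_real)
  then show ?thesis by (simp add: approximable_def)
qed

lemma approximable_polynomial:
  "approximable a p (\<lambda>t. base_weight t * complex_of_real (\<Sum>i\<le>n. b i * exp (- t) ^ i))"
proof -
  have "approximable a p (\<lambda>t. \<Sum>i\<le>n. complex_of_real (b i) * (t powr a *\<^sub>R exp_decay (real i + 1) t))"
    by (intro approximable_sum approximable_exp) auto
  then show ?thesis
  proof (rule approximable_cong)
    fix t :: real
    have "exp (- (real i + 1) * t) = exp (- t) * exp (- t) ^ i" for i
      by (simp add: exp_of_nat_mult[symmetric] exp_add[symmetric] algebra_simps)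
    then have "exp_decay (real i + 1) t = complex_of_real (exp (- t)) * complex_of_real (exp (- t)) ^ i" for i
      by (simp only: exp_decay_def of_real_mult of_real_power)
    then show "base_weight t * complex_of_real (\<Sum>i\<le>n. b i * exp (- t) ^ i)
        = (\<Sum>i\<le>n. complex_of_real (b i) * (t powr a *\<^sub>R exp_decay (real i + 1) t))"
      by (simp add: base_weight_def sum_distrib_left scaleR_conv_of_real mult_ac)
  qed
qed

text \<open>Weierstrass' theorem on [0, 1] in the variable x = e^(-t); the uniform error is
  multiplied by a fixed function of L^p.\<close>

lemma approximable_continuous:
  assumes c: "continuous_on {0..1} (c :: real \<Rightarrow> real)"
  shows "approximable a p (\<lambda>t. base_weight t * complex_of_real (c (exp (- t))))"
proof -
  have "\<exists>b m. \<forall>x\<in>{0..1}. \<bar>c x - (\<Sum>i\<le>m. b i * x ^ i)\<bar> < 1 / real (Suc n)" for n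
  proof -
    obtain g where g: "real_polynomial_function g" "\<And>x. x \<in> {0..1} \<Longrightarrow> \<bar>c x - g x\<bar> < 1 / real (Suc n)"
      using Stone_Weierstrass_real_polynomial_function[OF compact_Icc c, of "1 / real (Suc n)"] by auto
    obtain b m where "g = (\<lambda>x. \<Sum>i\<le>(m::nat). b i * x ^ i)"
      using g(1) by (auto simp: real_polynomial_function_iff_sum)
    then show ?thesis using g(2) by blast
  qed
  then obtain b m where bm: "\<And>n x. x \<in> {0..1} \<Longrightarrow> \<bar>c x - (\<Sum>i\<le>m n. b n i * x ^ i)\<bar> < 1 / real (Suc n)"
    by metis
  define H where "H n t = base_weight t * complex_of_real (\<Sum>i\<le>m n. b n i * exp (- t) ^ i)" for n t
  define h where "h t = base_weight t * complex_of_real (c (exp (- t)))" for t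
  have H: "approximable a p (H n)" for n unfolding H_def by (rule approximable_polynomial)
  have "continuous_on {0<..} (\<lambda>t. c (exp (- t)))"
    by (intro continuous_on_compose2[OF c] continuous_intros) auto
  then have [measurable]: "(\<lambda>t. c (exp (- t))) \<in> borel_measurable halfline"
    unfolding measurable_halfline_iff by (intro set_measurable_continuous_on) auto
  note [measurable] = Lp_space_measurable[OF base_weight_Lp]
  have [measurable]: "H n \<in> borel_measurable halfline" for n
    by (rule Lp_space_measurable[OF approximable_in_Lp[OF H]])
  have hm [measurable]: "h \<in> borel_measurable halfline"
    unfolding h_def by measurable
  have diff: "norm (H n t - h t) \<le> norm (base_weight t) * (1 / real (Suc n))" if "0 < t" for n t
  proof -
    have "H n t - h t = base_weight t * complex_of_real ((\<Sum>i\<le>m n. b n i * exp (- t) ^ i) - c (exp (- t)))"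
      by (simp add: H_def h_def algebra_simps)
    moreover have "\<bar>(\<Sum>i\<le>m n. b n i * exp (- t) ^ i) - c (exp (- t))\<bar> \<le> 1 / real (Suc n)"
      using bm[of "exp (- t)" n] that by (simp add: abs_minus_commute)
    ultimately show ?thesis by (simp only: norm_mult norm_of_real mult_left_mono[OF _ norm_ge_zero])
  qed
  have diff1: "norm (H n t - h t) \<le> norm (base_weight t)" if "0 < t" for n t
    by (rule order_trans[OF diff[OF that]], rule mult_left_le) auto
  have hL: "h \<in> Lp_space p"
  proof -
    have "(\<lambda>t. H 0 t - h t) \<in> Lp_space p"
      by (rule Lp_space_bound[OF base_weight_Lp]) (use p diff1 in auto)
    from Lp_space_diff[OF _ this p, of "H 0"] H[of 0] show ?thesis by (simp add: approximable_def)
  qed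
  have "(\<lambda>n. Lp_norm p (\<lambda>t. H n t - h t)) \<longlonglongrightarrow> 0"
  proof (rule Lp_dominated[OF base_weight_Lp p])
    show "AE t in halfline. (\<lambda>n. H n t - h t) \<longlonglongrightarrow> 0"
    proof (rule AE_I2)
      fix t assume "t \<in> space halfline"
      then have t: "0 < t" by simp
      have "(\<lambda>n. norm (base_weight t) * (1 / real (Suc n))) \<longlonglongrightarrow> norm (base_weight t) * 0"
        by (rule tendsto_mult_left[OF LIMSEQ_Suc[OF lim_1_over_n]])
      then have "(\<lambda>n. norm (base_weight t) * (1 / real (Suc n))) \<longlonglongrightarrow> 0"
        by (simp only: mult_zero_right)
      then show "(\<lambda>n. H n t - h t) \<longlonglongrightarrow> 0"
        by (rule Lim_null_comparison[OF always_eventually[OF allI[OF diff[OF t]]]])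
    qed
  qed (use diff1 in auto)
  then have "approximable a p h" by (rule approximable_limit[OF hL H])
  then show ?thesis by (simp only: h_def[abs_def])
qed

lemma approximable_dominated:
  assumes g: "g \<in> Lp_space p" and H: "\<And>n. approximable a p (H n)"
    and [measurable]: "h \<in> borel_measurable halfline"
    and bd: "\<And>n t. 0 < t \<Longrightarrow> norm (H n t) \<le> norm (g t)"
    and lim: "\<And>t. 0 < t \<Longrightarrow> (\<lambda>n. H n t) \<longlonglongrightarrow> h t"
  shows "approximable a p h"
proof -
  have hb: "norm (h t) \<le> norm (g t)" if "0 < t" for t
    using bd[OF that] by (intro LIMSEQ_le_const2[OF tendsto_norm[OF lim[OF that]]]) auto
  have hL: "h \<in> Lp_space p"
    by (rule Lp_space_bound[OF g]) (use p hb in auto)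
  have [measurable]: "H n \<in> borel_measurable halfline" for n
    by (rule Lp_space_measurable[OF approximable_in_Lp[OF H]])
  have "(\<lambda>n. Lp_norm p (\<lambda>t. H n t - h t)) \<longlonglongrightarrow> 0"
  proof (rule Lp_dominated[OF Lp_space_cmult[OF g, of 2] p])
    show "AE t in halfline. norm (H n t - h t) \<le> norm (2 * g t)" for n
    proof (rule AE_I2)
      fix t assume "t \<in> space halfline"
      then have t: "0 < t" by simp
      show "norm (H n t - h t) \<le> norm (2 * g t)"
        using norm_triangle_ineq4[of "H n t" "h t"] bd[OF t, of n] hb[OF t] by (simp add: norm_mult)
    qed
    show "AE t in halfline. (\<lambda>n. H n t - h t) \<longlonglongrightarrow> 0"
      using lim by (intro AE_I2) (auto simp: LIM_zero_iff)
  qed measurable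
  then show ?thesis by (rule approximable_limit[OF hL H])
qed

text \<open>Dynkin's induction over Borel sets from the generators {..b}; approximability survives
  complements by linearity and disjoint unions by domination.\<close>

lemma approximable_indicator:
  assumes "A \<in> sets borel"
  shows "approximable a p (\<lambda>t. base_weight t * complex_of_real (indicator A t))"
proof -
  note [measurable] = Lp_space_measurable[OF base_weight_Lp]
  have ind [measurable]: "(indicator A :: real \<Rightarrow> real) \<in> borel_measurable halfline" if "A \<in> sets borel" for A
    using that by (intro measurable_restrict_space1) simp
  have "Int_stable (range (\<lambda>b::real. {..b}))" by (auto simp: Int_stable_def)
  moreover have "range (\<lambda>b::real. {..b}) \<subseteq> Pow UNIV" by simp
  moreover have "A \<in> sigma_sets UNIV (range (\<lambda>b::real. {..b}))"
    using assms by (simp add: borel_eq_atMost)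
  ultimately show ?thesis
  proof (induction A rule: sigma_sets_induct_disjoint)
    case (basic A)
    then obtain b where A: "A = {..b}" by auto
    \<comment> \<open>A continuous ramp: it is 1 for x at least e^(-b), that is, t at most b, and
      falls off below with slope n.\<close>
    define c where "c n x = max 0 (1 - real n * max 0 (exp (- b) - x))" for n :: nat and x
    show ?case unfolding A
    proof (rule approximable_dominated[OF base_weight_Lp])
      show "approximable a p (\<lambda>t. base_weight t * complex_of_real (c n (exp (- t))))" for n
        unfolding c_def by (intro approximable_continuous continuous_intros)
      show "norm (base_weight t * complex_of_real (c n (exp (- t)))) \<le> norm (base_weight t)" for n t
        unfolding norm_mult norm_of_real by (intro mult_left_le) (auto simp: c_def)
      show "(\<lambda>n. base_weight t * complex_of_real (c n (exp (- t)))) \<longlonglongrightarrow> base_weight t * complex_of_real (indicator {..b} t)" for t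
      proof (intro tendsto_intros)
        show "(\<lambda>n. c n (exp (- t))) \<longlonglongrightarrow> indicator {..b} t"
        proof (cases "t \<le> b")
          case True
          then show ?thesis by (simp add: c_def)
        next
          case False
          then have d: "exp (- b) - exp (- t) > 0" by simp
          have "eventually (\<lambda>n. c n (exp (- t)) = 0) sequentially"
          proof -
            obtain N :: nat where N: "1 / (exp (- b) - exp (- t)) < real N" using reals_Archimedean2 by blast
            have "c n (exp (- t)) = 0" if "n \<ge> N" for n
            proof -
              have "1 / (exp (- b) - exp (- t)) < real n" using N that by simp
              then have "1 < real n * (exp (- b) - exp (- t))" using d by (simp add: field_simps)
              then show ?thesis using d by (simp add: c_def max_def)
            qed
            then show ?thesis by (auto simp: eventually_sequentially)
          qed
          then have "(\<lambda>n. c n (exp (- t))) \<longlonglongrightarrow> 0" by (rule tendsto_eventually)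
          then show ?thesis using False by simp
        qed
      qed
    qed measurable
  next
    case empty
    show ?case using approximable_sum[of "{}"] by simp
  next
    case (compl A)
    have "approximable a p (\<lambda>t. base_weight t * complex_of_real 1)"
      using approximable_continuous[of "\<lambda>x. 1"] by simp
    from approximable_lin[OF this compl(2), of "-1"] show ?case
      by (rule approximable_cong) (auto simp: indicator_def)
  next
    case (union A)
    have Ab: "A i \<in> sets borel" for i using union(2) by (auto simp: borel_eq_atMost)
    have "(\<Union>i. A i) \<in> sets borel" using Ab by auto
    note [measurable] = ind[OF this]
    show ?case
    proof (rule approximable_dominated[OF base_weight_Lp])
      show "approximable a p (\<lambda>t. \<Sum>i<n. base_weight t * complex_of_real (indicator (A i) t))" for n
        by (intro approximable_sum union) auto
      \<comment> \<open>Disjointness makes the partial sums indicators again, so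
        \<open>base_weight\<close> dominates all of them.\<close>
      have eq: "(\<Sum>i<n. base_weight t * complex_of_real (indicator (A i) t)) = base_weight t * complex_of_real (indicator (\<Union>i<n. A i) t)" for n t
      proof -
        have "indicator (\<Union>i<n. A i) t = (\<Sum>i<n. indicator (A i) t :: real)"
          using union(1) by (intro indicator_UN_disjoint) (auto simp: disjoint_family_on_def)
        then show ?thesis by (simp add: sum_distrib_left)
      qed
      show "norm (\<Sum>i<n. base_weight t * complex_of_real (indicator (A i) t)) \<le> norm (base_weight t)" for n t
        unfolding eq norm_mult norm_of_real by (intro mult_left_le) (auto simp: indicator_def)
      show "(\<lambda>n. \<Sum>i<n. base_weight t * complex_of_real (indicator (A i) t))
          \<longlonglongrightarrow> base_weight t * complex_of_real (indicator (\<Union>i. A i) t)" for t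
        unfolding eq by (intro tendsto_intros LIMSEQ_indicator_UN)
      show "(\<lambda>t. base_weight t * complex_of_real (indicator (\<Union>i. A i) t)) \<in> borel_measurable halfline"
        by measurable
    qed
  qed
qed

text \<open>Divide by \<open>base_weight\<close>, approximate the quotient by simple functions of at
  most twice its size, and multiply back; then twice h dominates.\<close>

lemma approximable_Lp:
  assumes h: "h \<in> Lp_space p"
  shows "approximable a p h"
proof -
  note [measurable] = Lp_space_measurable[OF base_weight_Lp] Lp_space_measurable[OF h]
  have w: "base_weight t \<noteq> 0" if "0 < t" for t using that by (simp add: base_weight_def)
  define g where "g t = h t / base_weight t" for t
  have "g \<in> borel_measurable halfline" unfolding g_def by measurable
  then obtain F where F': "\<forall>i. simple_function halfline (F i)"
      "\<forall>t\<in>space halfline. (\<lambda>i. F i t) \<longlonglongrightarrow> g t"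
      "\<forall>i. \<forall>t\<in>space halfline. dist (F i t) 0 \<le> 2 * dist (g t) 0"
    using borel_measurable_implies_sequence_metric[of g halfline 0] by blast
  then have F: "\<And>i. simple_function halfline (F i)"
      "\<And>t. 0 < t \<Longrightarrow> (\<lambda>i. F i t) \<longlonglongrightarrow> g t"
      "\<And>i t. 0 < t \<Longrightarrow> dist (F i t) 0 \<le> 2 * dist (g t) 0"
    by auto
  show ?thesis
  proof (rule approximable_dominated[OF Lp_space_cmult[OF h, of 2]])
    show "approximable a p (\<lambda>t. base_weight t * F i t)" for i
    proof (rule approximable_cong)
      let ?A = "\<lambda>y. F i -` {y} \<inter> space halfline"
      have A: "?A y \<in> sets borel" for y
      proof -
        have "?A y \<in> sets halfline" by (rule simple_functionD(2)[OF F(1)])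
        then show ?thesis by (simp add: sets_restrict_space_iff)
      qed
      have "approximable a p (\<lambda>t. \<Sum>y\<in>F i ` space halfline. y * (base_weight t * complex_of_real (indicator (?A y) t)))"
      proof (rule approximable_sum)
        show "finite (F i ` space halfline)" by (rule simple_functionD(1)[OF F(1)])
        have 0: "approximable a p (\<lambda>t. 0)" using approximable_sum[of "{}"] by simp
        fix y
        from approximable_lin[OF 0 approximable_indicator[OF A], of y y]
        show "approximable a p (\<lambda>t. y * (base_weight t * complex_of_real (indicator (?A y) t)))" by simp
      qed
      then show "approximable a p (\<lambda>t. \<Sum>y\<in>F i ` space halfline. y * (base_weight t * complex_of_real (indicator (?A y) t)))" .
      fix t :: real assume t: "0 < t"
      have "F i t = (\<Sum>y\<in>F i ` space halfline. indicator (?A y) t *\<^sub>R y)"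
        using t by (intro simple_function_indicator_representation_banach[OF F(1)]) simp
      then have "base_weight t * F i t = base_weight t * (\<Sum>y\<in>F i ` space halfline. indicator (?A y) t *\<^sub>R y)"
        by (rule arg_cong)
      then show "base_weight t * F i t = (\<Sum>y\<in>F i ` space halfline. y * (base_weight t * complex_of_real (indicator (?A y) t)))"
        by (simp add: sum_distrib_left scaleR_conv_of_real mult_ac)
    qed
    show "norm (base_weight t * F i t) \<le> norm (2 * h t)" if "0 < t" for i t
    proof -
      have "norm (base_weight t) * norm (F i t) \<le> norm (base_weight t) * (2 * norm (g t))"
        using F(3)[OF that] by (intro mult_left_mono) auto
      then show ?thesis using w[OF that] by (simp add: g_def norm_mult norm_divide)
    qed
    show "(\<lambda>i. base_weight t * F i t) \<longlonglongrightarrow> h t" if "0 < t" for t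
      using tendsto_mult_left[OF F(2)[OF that], of "base_weight t"] w[OF that] by (simp add: g_def)
  qed measurable
qed

end

section \<open>The space as the range of a fractional integral\<close>

text \<open>The inverse of \<open>D_+^\<alpha>\<close>, extended by the identity at \<alpha> = 0 so
  that later statements treat both cases together.\<close>

definition frac_rep :: "real \<Rightarrow> (real \<Rightarrow> complex) \<Rightarrow> real \<Rightarrow> complex" where
  "frac_rep \<alpha> h = (if \<alpha> = 0 then h else (\<lambda>t. \<alpha> *\<^sub>R hom_op (weyl_kernel \<alpha> \<alpha>) h t))"

lemma hom_op_scaleR: "hom_op k (\<lambda>s. c *\<^sub>R h s) t = c *\<^sub>R hom_op k h t"
  unfolding hom_op_def by (simp only: scaleR_left_commute[of _ c] integral_scaleR_right)

lemma Lp_space_scaleR: "f \<in> Lp_space p \<Longrightarrow> (\<lambda>t. c *\<^sub>R f t) \<in> Lp_space p"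
  using Lp_space_cmult[of f p "complex_of_real c"] by (simp add: scaleR_conv_of_real)

lemma Lp_norm_scaleR: "1 \<le> p \<Longrightarrow> Lp_norm p (\<lambda>t. c *\<^sub>R f t) = \<bar>c\<bar> * Lp_norm p f"
  using Lp_norm_cmult[of p "complex_of_real c" f] by (simp add: scaleR_conv_of_real)

lemma hom_kernel_weyl_self: "0 < \<alpha> \<Longrightarrow> 1 \<le> p \<Longrightarrow> hom_kernel p (weyl_kernel \<alpha> \<alpha>)"
  by (intro hom_kernel_weyl) auto

lemma frac_rep_Lp: "0 \<le> \<alpha> \<Longrightarrow> 1 \<le> p \<Longrightarrow> h \<in> Lp_space p \<Longrightarrow> frac_rep \<alpha> h \<in> Lp_space p"
  unfolding frac_rep_def using hom_kernel_weyl_self[of \<alpha> p] by (auto intro!: Lp_space_scaleR hom_op_Lp)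

context
  fixes a p :: real
  assumes a: "0 < a" and p: "1 \<le> p"
begin

text \<open>The constant is \<open>a\<close> times the mass of the Weyl kernel. In terms of the
  space this is its continuous embedding into L^p.\<close>

lemma frac_rep_norm:
  obtains K where "0 \<le> K" "\<And>h. h \<in> Lp_space p \<Longrightarrow> Lp_norm p (frac_rep a h) \<le> K * Lp_norm p h"
proof (rule that)
  show "0 \<le> a * kernel_mass p (weyl_kernel a a)" using a by (simp add: kernel_mass_nonneg)
  fix h assume h: "h \<in> Lp_space p"
  have "Lp_norm p (frac_rep a h) = a * Lp_norm p (hom_op (weyl_kernel a a) h)"
    using a p by (simp add: frac_rep_def Lp_norm_scaleR)
  also have "\<dots> \<le> a * (kernel_mass p (weyl_kernel a a) * Lp_norm p h)"
    using a p h by (intro mult_left_mono hom_op_norm hom_kernel_weyl_self) auto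
  finally show "Lp_norm p (frac_rep a h) \<le> a * kernel_mass p (weyl_kernel a a) * Lp_norm p h" by simp
qed

lemma frac_rep_diff:
  assumes "h \<in> Lp_space p" "k \<in> Lp_space p"
  shows "AE t in halfline. frac_rep a (\<lambda>s. h s - k s) t = frac_rep a h t - frac_rep a k t"
  using hom_op_diff[OF p assms hom_kernel_weyl_self[OF a p]]
  by eventually_elim (use a in \<open>simp add: frac_rep_def scaleR_diff_right\<close>)

lemma frac_rep_inj:
  assumes h: "h \<in> Lp_space p" and k: "k \<in> Lp_space p"
    and eq: "AE t in halfline. frac_rep a h t = frac_rep a k t"
  shows "AE t in halfline. h t = k t"
proof -
  have "AE t in halfline. hom_op (weyl_kernel a a) (\<lambda>s. h s - k s) t = 0"
    using frac_rep_diff[OF h k] eq by eventually_elim (use a in \<open>simp add: frac_rep_def\<close>)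
  from weyl_kernel_injective[OF p Lp_space_diff[OF h k p] a this] show ?thesis
    by eventually_elim simp
qed

lemma frac_rep_weighted_deriv:
  "\<phi> \<in> schwartz_plus \<Longrightarrow> 0 < t \<Longrightarrow> frac_rep a (weighted_deriv a \<phi>) t = \<phi> t"
  using hom_op_weighted_deriv[OF _ a] a by (simp add: frac_rep_def)

lemma schwartz_Lp:
  assumes \<phi>: "\<phi> \<in> schwartz_plus"
  shows "\<phi> \<in> Lp_space p"
proof (rule Lp_space_cong_pos)
  show "frac_rep a (weighted_deriv a \<phi>) \<in> Lp_space p"
    using a by (intro frac_rep_Lp p weighted_deriv_Lp[OF \<phi>]) auto
qed (rule frac_rep_weighted_deriv[OF \<phi>, symmetric])

lemma prenorm_diff:
  assumes "\<phi> \<in> schwartz_plus" "\<psi> \<in> schwartz_plus"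
  shows "sobolev_prenorm a p (\<lambda>t. \<phi> t - \<psi> t) = Lp_norm p (\<lambda>t. weighted_deriv a \<phi> t - weighted_deriv a \<psi> t)"
proof -
  have "sobolev_prenorm a p (\<lambda>t. \<phi> t - \<psi> t) = Lp_norm p (weighted_deriv a (\<lambda>t. \<phi> t - \<psi> t))"
    by (rule sobolev_prenorm_eq[OF a p])
  also have "\<dots> = Lp_norm p (\<lambda>t. weighted_deriv a \<phi> t - weighted_deriv a \<psi> t)"
    using weighted_deriv_lin[OF assms a, of _ "-1"] by (intro Lp_norm_cong_pos) simp
  finally show ?thesis .
qed

text \<open>The difference of \<phi> and g represents the difference of the weighted derivative of
  \<phi> and h, so convergence of weighted derivatives forces convergence of the functions.\<close>

lemma schwartz_frac_rep_dist:
  assumes "\<And>h. h \<in> Lp_space p \<Longrightarrow> Lp_norm p (frac_rep a h) \<le> K * Lp_norm p h"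
    and \<phi>: "\<phi> \<in> schwartz_plus" and h: "h \<in> Lp_space p" and g: "g \<in> Lp_space p"
    and eq: "AE t in halfline. g t = frac_rep a h t"
  shows "Lp_norm p (\<lambda>t. \<phi> t - g t) \<le> K * Lp_norm p (\<lambda>t. weighted_deriv a \<phi> t - h t)"
proof -
  note W = weighted_deriv_Lp[OF \<phi> a p]
  note D = Lp_space_diff[OF W h p]
  have "Lp_norm p (\<lambda>t. \<phi> t - g t) = Lp_norm p (frac_rep a (\<lambda>t. weighted_deriv a \<phi> t - h t))"
  proof (rule Lp_norm_cong)
    have "AE t in halfline. 0 < t" by (intro AE_I2) simp
    with frac_rep_diff[OF W h] eq
    show "AE t in halfline. norm (\<phi> t - g t) = norm (frac_rep a (\<lambda>t. weighted_deriv a \<phi> t - h t) t)"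
      by eventually_elim (simp add: frac_rep_weighted_deriv[OF \<phi>])
    show "(\<lambda>t. \<phi> t - g t) \<in> borel_measurable halfline"
      by (rule Lp_space_measurable[OF Lp_space_diff[OF schwartz_Lp[OF \<phi>] g p]])
    show "frac_rep a (\<lambda>t. weighted_deriv a \<phi> t - h t) \<in> borel_measurable halfline"
      by (rule Lp_space_measurable[OF frac_rep_Lp[OF less_imp_le[OF a] p D]])
  qed
  also have "\<dots> \<le> K * Lp_norm p (\<lambda>t. weighted_deriv a \<phi> t - h t)" by (rule assms(1)[OF D])
  finally show ?thesis .
qed

lemma prenorm_tendsto:
  assumes S: "\<And>n. \<phi> n \<in> schwartz_plus" and h: "h \<in> Lp_space p"
    and d0: "(\<lambda>n. Lp_norm p (\<lambda>t. weighted_deriv a (\<phi> n) t - h t)) \<longlonglongrightarrow> 0"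
  shows "(\<lambda>n. sobolev_prenorm a p (\<phi> n)) \<longlonglongrightarrow> Lp_norm p h"
proof -
  have "\<bar>sobolev_prenorm a p (\<phi> n) - Lp_norm p h\<bar> \<le> Lp_norm p (\<lambda>t. weighted_deriv a (\<phi> n) t - h t)" for n
    unfolding sobolev_prenorm_eq[OF a p] by (rule Lp_norm_diff_abs[OF weighted_deriv_Lp[OF S a p] h p])
  then have "(\<lambda>n. sobolev_prenorm a p (\<phi> n) - Lp_norm p h) \<longlonglongrightarrow> 0"
    by (intro Lim_null_comparison[OF _ d0] always_eventually allI) (simp only: real_norm_def)
  then show ?thesis by (simp add: LIM_zero_iff)
qed

text \<open>Density supplies Schwartz functions whose weighted derivatives tend to h. They are
  Cauchy because the pre-norm is the L^p distance of weighted derivatives, and their limit is f by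
  continuity of \<open>frac_rep\<close>.\<close>

lemma approximates_exists:
  assumes f: "f \<in> Lp_space p" and h: "h \<in> Lp_space p" and eq: "AE t in halfline. f t = frac_rep a h t"
  shows "\<exists>\<phi>. approximates a p \<phi> f \<and> (\<lambda>n. sobolev_prenorm a p (\<phi> n)) \<longlonglongrightarrow> Lp_norm p h"
proof -
  have "\<exists>\<phi>\<in>schwartz_plus. Lp_norm p (\<lambda>t. weighted_deriv a \<phi> t - h t) < inverse (real (Suc n))" for n
    using approximable_Lp[OF a p h] by (simp add: approximable_def)
  then obtain \<phi> where S: "\<And>n. \<phi> n \<in> schwartz_plus"
    and lt: "\<And>n. Lp_norm p (\<lambda>t. weighted_deriv a (\<phi> n) t - h t) < inverse (real (Suc n))"
    by metis
  define d where "d n = Lp_norm p (\<lambda>t. weighted_deriv a (\<phi> n) t - h t)" for n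
  note W = weighted_deriv_Lp[OF S a p]
  have d0: "d \<longlonglongrightarrow> 0"
    by (rule tendsto_sandwich[OF _ _ tendsto_const LIMSEQ_inverse_real_of_nat])
      (use lt in \<open>auto simp: d_def intro!: always_eventually less_imp_le\<close>)
  have cauchy: "\<exists>N. \<forall>m\<ge>N. \<forall>n\<ge>N. sobolev_prenorm a p (\<lambda>t. \<phi> m t - \<phi> n t) < e" if e: "e > 0" for e
  proof -
    have "\<forall>\<^sub>F n in sequentially. d n < e / 2" using e by (intro order_tendstoD(2)[OF d0]) auto
    then obtain N where N: "\<And>n. n \<ge> N \<Longrightarrow> d n < e / 2" by (auto simp: eventually_sequentially)
    have "sobolev_prenorm a p (\<lambda>t. \<phi> m t - \<phi> n t) < e" if "m \<ge> N" "n \<ge> N" for m n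
    proof -
      have "sobolev_prenorm a p (\<lambda>t. \<phi> m t - \<phi> n t) \<le> d m + Lp_norm p (\<lambda>t. h t - weighted_deriv a (\<phi> n) t)"
        unfolding prenorm_diff[OF S S] d_def by (rule Lp_norm_diff_triangle[OF W h W p])
      also have "Lp_norm p (\<lambda>t. h t - weighted_deriv a (\<phi> n) t) = d n"
        unfolding d_def by (rule Lp_norm_minus_commute)
      finally show ?thesis using N[OF that(1)] N[OF that(2)] by simp
    qed
    then show ?thesis by blast
  qed
  obtain K where K: "0 \<le> K" "\<And>h. h \<in> Lp_space p \<Longrightarrow> Lp_norm p (frac_rep a h) \<le> K * Lp_norm p h"
    using frac_rep_norm by blast
  have "Lp_norm p (\<lambda>t. \<phi> n t - f t) \<le> K * d n" for n
    unfolding d_def by (rule schwartz_frac_rep_dist[OF K(2) S h f eq])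
  then have bd: "norm (Lp_norm p (\<lambda>t. \<phi> n t - f t)) \<le> K * d n" for n
    by simp
  have "(\<lambda>n. K * d n) \<longlonglongrightarrow> 0"
    using tendsto_mult_left[OF d0, of K] by (simp only: mult_zero_right)
  from Lim_null_comparison[OF always_eventually[OF allI[OF bd]] this]
  have "approximates a p \<phi> f" using S cauchy by (simp add: approximates_def)
  moreover have "(\<lambda>n. sobolev_prenorm a p (\<phi> n)) \<longlonglongrightarrow> Lp_norm p h"
    using d0 unfolding d_def by (rule prenorm_tendsto[OF S h])
  ultimately show ?thesis by blast
qed

text \<open>The weighted derivatives form a Cauchy sequence in L^p, so they have a limit h;
  continuity of \<open>frac_rep\<close> identifies its image with the L^p limit f.\<close>

lemma approximates_limit:
  assumes f: "f \<in> Lp_space p" and ap: "approximates a p \<phi> f"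
  shows "\<exists>h\<in>Lp_space p. (AE t in halfline. f t = frac_rep a h t) \<and>
    (\<lambda>n. sobolev_prenorm a p (\<phi> n)) \<longlonglongrightarrow> Lp_norm p h"
proof -
  have S: "\<phi> n \<in> schwartz_plus" for n using ap by (simp add: approximates_def)
  note W = weighted_deriv_Lp[OF S a p]
  obtain h where h: "h \<in> Lp_space p" and d0: "(\<lambda>n. Lp_norm p (\<lambda>t. weighted_deriv a (\<phi> n) t - h t)) \<longlonglongrightarrow> 0"
  proof (rule Lp_complete[OF p W])
    show "\<exists>N. \<forall>m\<ge>N. \<forall>n\<ge>N. Lp_norm p (\<lambda>t. weighted_deriv a (\<phi> m) t - weighted_deriv a (\<phi> n) t) < e" if "0 < e" for e
      using ap that unfolding approximates_def prenorm_diff[OF S S] by blast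
  qed
  obtain K where K: "0 \<le> K" "\<And>h. h \<in> Lp_space p \<Longrightarrow> Lp_norm p (frac_rep a h) \<le> K * Lp_norm p h"
    using frac_rep_norm by blast
  have rL: "frac_rep a h \<in> Lp_space p" using a by (intro frac_rep_Lp p h) auto
  have le: "Lp_norm p (\<lambda>t. f t - frac_rep a h t) \<le> Lp_norm p (\<lambda>t. \<phi> n t - f t) + K * Lp_norm p (\<lambda>t. weighted_deriv a (\<phi> n) t - h t)" for n
  proof -
    have "Lp_norm p (\<lambda>t. f t - frac_rep a h t) \<le> Lp_norm p (\<lambda>t. f t - \<phi> n t) + Lp_norm p (\<lambda>t. \<phi> n t - frac_rep a h t)"
      by (rule Lp_norm_diff_triangle[OF f schwartz_Lp[OF S] rL p])
    also have "Lp_norm p (\<lambda>t. f t - \<phi> n t) = Lp_norm p (\<lambda>t. \<phi> n t - f t)" by (rule Lp_norm_minus_commute)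
    also have "Lp_norm p (\<lambda>t. \<phi> n t - frac_rep a h t) \<le> K * Lp_norm p (\<lambda>t. weighted_deriv a (\<phi> n) t - h t)"
      by (rule schwartz_frac_rep_dist[OF K(2) S h rL]) simp_all
    finally show ?thesis by simp
  qed
  have "(\<lambda>n. Lp_norm p (\<lambda>t. \<phi> n t - f t) + K * Lp_norm p (\<lambda>t. weighted_deriv a (\<phi> n) t - h t)) \<longlonglongrightarrow> 0 + K * 0"
    using ap by (intro tendsto_add tendsto_mult_left d0) (simp add: approximates_def)
  then have "Lp_norm p (\<lambda>t. f t - frac_rep a h t) \<le> 0 + K * 0"
    by (rule LIMSEQ_le_const) (use le in blast)
  then have "Lp_norm p (\<lambda>t. f t - frac_rep a h t) = 0"
    using Lp_norm_nonneg[of p "\<lambda>t. f t - frac_rep a h t"] by linarith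
  then have "AE t in halfline. f t - frac_rep a h t = 0"
    by (subst (asm) Lp_norm_eq_0_iff[OF Lp_space_diff[OF f rL p] p])
  then have "AE t in halfline. f t = frac_rep a h t" by eventually_elim simp
  then show ?thesis using prenorm_tendsto[OF S h d0] h by blast
qed

end

lemma sobolev_Lp: "f \<in> sobolev \<alpha> p \<Longrightarrow> f \<in> Lp_space p"
  by (auto simp: sobolev_def split: if_splits)

lemma sobolev_rep:
  assumes "0 \<le> \<alpha>" "1 \<le> p" "f \<in> sobolev \<alpha> p"
  obtains h where "h \<in> Lp_space p" "AE t in halfline. f t = frac_rep \<alpha> h t"
proof (cases "\<alpha> = 0")
  case True
  then show ?thesis using that[of f] assms by (simp add: sobolev_def frac_rep_def)
next
  case False
  then obtain \<phi> where "f \<in> Lp_space p" "approximates \<alpha> p \<phi> f"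
    using assms by (auto simp: sobolev_def)
  then show ?thesis
    using approximates_limit[of \<alpha> p f \<phi>] assms False that by auto
qed

text \<open>The definite description is resolved by injectivity: another approximating sequence
  leads to some k with the same image as h, hence k = h almost everywhere and the limits of the
  pre-norms agree.\<close>

lemma sobolev_memI:
  assumes \<alpha>: "0 \<le> \<alpha>" and p: "1 \<le> p" and f: "f \<in> Lp_space p" and h: "h \<in> Lp_space p"
    and eq: "AE t in halfline. f t = frac_rep \<alpha> h t"
  shows "f \<in> sobolev \<alpha> p" "sobolev_norm \<alpha> p f = Lp_norm p h"
proof -
  have "f \<in> sobolev \<alpha> p \<and> sobolev_norm \<alpha> p f = Lp_norm p h"
  proof (cases "\<alpha> = 0")
    case True
    then have "Lp_norm p f = Lp_norm p h"
      using eq by (intro Lp_norm_cong Lp_space_measurable[OF f] Lp_space_measurable[OF h])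
        (auto simp: frac_rep_def elim: eventually_mono)
    then show ?thesis using True f by (simp add: sobolev_def sobolev_norm_def)
  next
    case False
    then have a: "0 < \<alpha>" using \<alpha> by simp
    note ex = approximates_exists[OF a p f h eq]
    have "N = Lp_norm p h" if N: "approximates \<alpha> p \<phi> f" "(\<lambda>n. sobolev_prenorm \<alpha> p (\<phi> n)) \<longlonglongrightarrow> N" for \<phi> N
    proof -
      obtain k where k: "k \<in> Lp_space p" "AE t in halfline. f t = frac_rep \<alpha> k t"
        "(\<lambda>n. sobolev_prenorm \<alpha> p (\<phi> n)) \<longlonglongrightarrow> Lp_norm p k"
        using approximates_limit[OF a p f N(1)] by blast
      have "AE t in halfline. frac_rep \<alpha> k t = frac_rep \<alpha> h t"
        using k(2) eq by eventually_elim simp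
      then have "AE t in halfline. k t = h t" by (rule frac_rep_inj[OF a p k(1) h])
      then have "Lp_norm p k = Lp_norm p h"
        by (intro Lp_norm_cong Lp_space_measurable[OF k(1)] Lp_space_measurable[OF h]) (auto elim: eventually_mono)
      then show ?thesis using LIMSEQ_unique[OF N(2) k(3)] by simp
    qed
    then have "(THE N. \<exists>\<phi>. approximates \<alpha> p \<phi> f \<and> (\<lambda>n. sobolev_prenorm \<alpha> p (\<phi> n)) \<longlonglongrightarrow> N) = Lp_norm p h"
      using ex by (intro the_equality) blast+
    then show ?thesis using False ex f by (auto simp: sobolev_def sobolev_norm_def)
  qed
  then show "f \<in> sobolev \<alpha> p" "sobolev_norm \<alpha> p f = Lp_norm p h" by auto
qed

lemma frac_rep_commute:
  assumes \<alpha>: "0 \<le> \<alpha>" and p: "1 \<le> p" and h: "h \<in> Lp_space p" and k: "hom_kernel p k"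
  shows "AE t in halfline. hom_op k (frac_rep \<alpha> h) t = frac_rep \<alpha> (hom_op k h) t"
proof (cases "\<alpha> = 0")
  case False
  then have "hom_kernel p (weyl_kernel \<alpha> \<alpha>)" using \<alpha> p by (intro hom_kernel_weyl_self) auto
  from hom_op_commute[OF p h k this] show ?thesis
    by eventually_elim (use False in \<open>simp add: frac_rep_def hom_op_scaleR\<close>)
qed (simp add: frac_rep_def)

section \<open>The Stieltjes operator\<close>

text \<open>What remains of the Stieltjes kernel after s = tu: all powers of t cancel against the
  prefactor.\<close>

definition stieltjes_kernel :: "real \<Rightarrow> real \<Rightarrow> real \<Rightarrow> real" where
  "stieltjes_kernel \<beta> \<mu> u = u powr (\<beta> - 1) / (1 + u) powr \<mu>"

lemma halfline_dilate:
  fixes F :: "real \<Rightarrow> 'a :: {banach, second_countable_topology}"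
  assumes c: "0 < c"
  shows "integrable halfline (\<lambda>u. F (c * u)) \<longleftrightarrow> integrable halfline F"
    and "(LINT u|halfline. F (c * u)) = (1 / c) *\<^sub>R integral\<^sup>L halfline F"
proof -
  define G where "G s = indicator {0<..} s *\<^sub>R F s" for s
  have G: "G (0 + c * u) = indicator {0<..} u *\<^sub>R F (c * u)" for u
    using c by (simp add: G_def indicator_def zero_less_mult_iff)
  have "integrable lborel (\<lambda>u. G (0 + c * u)) \<longleftrightarrow> integrable lborel G"
    using c by (intro lborel_integrable_real_affine_iff) auto
  then show "integrable halfline (\<lambda>u. F (c * u)) \<longleftrightarrow> integrable halfline F"
    unfolding G by (simp add: integrable_halfline_iff set_integrable_def G_def[abs_def])
  have "integral\<^sup>L lborel G = \<bar>c\<bar> *\<^sub>R (LINT u|lborel. G (0 + c * u))"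
    using c by (intro lborel_integral_real_affine) auto
  then show "(LINT u|halfline. F (c * u)) = (1 / c) *\<^sub>R integral\<^sup>L halfline F"
    unfolding G using c by (simp add: integral_halfline_eq set_lebesgue_integral_def G_def[abs_def])
qed

context
  fixes p \<beta> \<mu> :: real
  assumes p: "1 \<le> p" and \<beta>: "0 < \<beta> - 1 / p" and \<mu>: "\<beta> - 1 / p < \<mu>"
begin

text \<open>The weight u^(-1/p) shifts the exponent \<beta> to \<beta> - 1/p, and the second Beta
  parameter is the complement to \<mu>; the hypotheses say that both are positive.\<close>

lemma stieltjes_kernel_integral:
  "has_bochner_integral halfline (\<lambda>u. \<bar>stieltjes_kernel \<beta> \<mu> u\<bar> * u powr (-1 / p)) (Beta (\<mu> - \<beta> + 1 / p) (\<beta> - 1 / p))"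
proof -
  have "has_bochner_integral halfline (\<lambda>u. u powr ((\<beta> - 1 / p) - 1) / (1 + u) powr ((\<beta> - 1 / p) + (\<mu> - \<beta> + 1 / p)))
      (Beta (\<beta> - 1 / p) (\<mu> - \<beta> + 1 / p))"
    using \<beta> \<mu> by (intro has_bochner_integral_Beta_halfline) auto
  then have 1: "has_bochner_integral halfline (\<lambda>u. u powr ((\<beta> - 1 / p) - 1) / (1 + u) powr \<mu>)
      (Beta (\<mu> - \<beta> + 1 / p) (\<beta> - 1 / p))"
    by (simp add: Beta_commute)
  show ?thesis
  proof (rule has_bochner_integral_cong[THEN iffD1, OF refl _ refl 1])
    fix u assume "u \<in> space halfline"
    then have u: "u > 0" by simp
    have "u powr (\<beta> - 1 / p - 1) = u powr (\<beta> - 1) * u powr (-1 / p)"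
      by (simp add: powr_add[symmetric] algebra_simps)
    then show "u powr (\<beta> - 1 / p - 1) / (1 + u) powr \<mu> = \<bar>stieltjes_kernel \<beta> \<mu> u\<bar> * u powr (-1 / p)"
      by (simp add: stieltjes_kernel_def)
  qed
qed

lemma hom_kernel_stieltjes: "hom_kernel p (stieltjes_kernel \<beta> \<mu>)"
  and kernel_mass_stieltjes: "kernel_mass p (stieltjes_kernel \<beta> \<mu>) = Beta (\<mu> - \<beta> + 1 / p) (\<beta> - 1 / p)"
proof -
  have "stieltjes_kernel \<beta> \<mu> \<in> borel_measurable halfline" unfolding stieltjes_kernel_def by measurable
  then show "hom_kernel p (stieltjes_kernel \<beta> \<mu>)" "kernel_mass p (stieltjes_kernel \<beta> \<mu>) = Beta (\<mu> - \<beta> + 1 / p) (\<beta> - 1 / p)"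
    using stieltjes_kernel_integral by (auto simp: hom_kernel_def kernel_mass_def has_bochner_integral_iff)
qed

lemma stieltjes_kernel_dilate:
  assumes t: "0 < t" and u: "0 < u"
  shows "(t * u) powr (\<beta> - 1) / (t * u + t) powr \<mu> = t powr (\<beta> - 1 - \<mu>) * stieltjes_kernel \<beta> \<mu> u"
proof -
  have "(t * u) powr (\<beta> - 1) = t powr (\<beta> - 1) * u powr (\<beta> - 1)" using t u by (intro powr_mult)
  moreover have "t * u + t = t * (1 + u)" by (simp add: algebra_simps)
  moreover have "(t * (1 + u)) powr \<mu> = t powr \<mu> * (1 + u) powr \<mu>" using t u by (intro powr_mult)
  moreover have "t powr (\<beta> - 1 - \<mu>) = t powr (\<beta> - 1) / t powr \<mu>" by (rule powr_diff)
  ultimately show ?thesis by (simp add: stieltjes_kernel_def)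
qed

lemma stieltjes_eq:
  assumes t: "0 < t"
  shows "stieltjes \<beta> \<mu> f t = hom_op (stieltjes_kernel \<beta> \<mu>) f t"
proof -
  have "(LINT s|halfline. (s powr (\<beta> - 1) / (s + t) powr \<mu>) *\<^sub>R f s)
      = t *\<^sub>R (LINT u|halfline. ((t * u) powr (\<beta> - 1) / (t * u + t) powr \<mu>) *\<^sub>R f (t * u))"
    using halfline_dilate(2)[OF t, of "\<lambda>s. (s powr (\<beta> - 1) / (s + t) powr \<mu>) *\<^sub>R f s"] t by simp
  also have "(LINT u|halfline. ((t * u) powr (\<beta> - 1) / (t * u + t) powr \<mu>) *\<^sub>R f (t * u))
      = (LINT u|halfline. t powr (\<beta> - 1 - \<mu>) *\<^sub>R (stieltjes_kernel \<beta> \<mu> u *\<^sub>R f (t * u)))"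
    by (intro Bochner_Integration.integral_cong refl) (simp only: stieltjes_kernel_dilate[OF t] space_halfline greaterThan_iff scaleR_scaleR)
  also have "\<dots> = t powr (\<beta> - 1 - \<mu>) *\<^sub>R hom_op (stieltjes_kernel \<beta> \<mu>) f t"
    unfolding hom_op_def by (rule integral_scaleR_right)
  finally have "stieltjes \<beta> \<mu> f t = (t powr (\<mu> - \<beta>) * (t * t powr (\<beta> - 1 - \<mu>))) *\<^sub>R hom_op (stieltjes_kernel \<beta> \<mu>) f t"
    by (simp only: stieltjes_def scaleR_scaleR)
  also have "t powr (\<mu> - \<beta>) * (t * t powr (\<beta> - 1 - \<mu>)) = t powr (\<mu> - \<beta>) * (t powr 1 * t powr (\<beta> - 1 - \<mu>))"
    using t by simp
  also have "\<dots> = 1" using t by (simp only: powr_add[symmetric]) simp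
  finally show ?thesis by simp
qed

text \<open>Valid at every positive t, which makes additivity pointwise. The first weight condition
  reduces to the kernel mass by dilation; for the second, s^(\<beta> - 1/p) is enlarged to the power
  of s + t, and the remaining exponent \<beta> - 1/p - \<mu> is negative.\<close>

lemma stieltjes_integrable:
  assumes f: "f \<in> Lp_space p" and t: "0 < t"
  shows "integrable halfline (\<lambda>s. (s powr (\<beta> - 1) / (s + t) powr \<mu>) *\<^sub>R f s)"
proof (rule Lp_integrable_weight[OF p f, where K="t powr (\<beta> - 1 / p - \<mu>)"])
  show "(\<lambda>s. s powr (\<beta> - 1) / (s + t) powr \<mu>) \<in> borel_measurable halfline" by measurable
  have "integrable halfline (\<lambda>u. (t powr (\<beta> - 1 - \<mu>) * t powr (-1 / p)) * (\<bar>stieltjes_kernel \<beta> \<mu> u\<bar> * u powr (-1 / p)))"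
    using stieltjes_kernel_integral unfolding has_bochner_integral_iff by (intro integrable_mult_right) blast
  then have "integrable halfline (\<lambda>u. \<bar>(t * u) powr (\<beta> - 1) / (t * u + t) powr \<mu>\<bar> * (t * u) powr (-1 / p))"
  proof (rule Bochner_Integration.integrable_cong[THEN iffD1, rotated 2])
    fix u assume "u \<in> space halfline"
    then have u: "u > 0" by simp
    have "(t * u) powr (-1 / p) = t powr (-1 / p) * u powr (-1 / p)" using t u by (intro powr_mult)
    then show "(t powr (\<beta> - 1 - \<mu>) * t powr (-1 / p)) * (\<bar>stieltjes_kernel \<beta> \<mu> u\<bar> * u powr (-1 / p))
        = \<bar>(t * u) powr (\<beta> - 1) / (t * u + t) powr \<mu>\<bar> * (t * u) powr (-1 / p)"
      unfolding stieltjes_kernel_dilate[OF t u] by (simp add: abs_mult)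
  qed simp
  then show "integrable halfline (\<lambda>s. \<bar>s powr (\<beta> - 1) / (s + t) powr \<mu>\<bar> * s powr (-1 / p))"
    by (rule halfline_dilate(1)[OF t, of "\<lambda>s. \<bar>s powr (\<beta> - 1) / (s + t) powr \<mu>\<bar> * s powr (-1 / p)", THEN iffD1])
  show "\<bar>s powr (\<beta> - 1) / (s + t) powr \<mu>\<bar> * s powr (1 - 1 / p) \<le> t powr (\<beta> - 1 / p - \<mu>)" if s: "0 < s" for s
  proof -
    have "\<bar>s powr (\<beta> - 1) / (s + t) powr \<mu>\<bar> * s powr (1 - 1 / p) = s powr (\<beta> - 1 / p) / (s + t) powr \<mu>"
      by (simp add: powr_add[symmetric])
    also have "\<dots> \<le> (s + t) powr (\<beta> - 1 / p) / (s + t) powr \<mu>"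
      using s t \<beta> by (intro divide_right_mono powr_mono2) auto
    also have "\<dots> = (s + t) powr (\<beta> - 1 / p - \<mu>)" by (rule powr_diff[symmetric])
    also have "\<dots> \<le> t powr (\<beta> - 1 / p - \<mu>)" using s t \<mu> by (intro powr_mono2') auto
    finally show ?thesis .
  qed
qed

text \<open>Substitute s = e^(-r) t, which maps the line onto the half-line with Jacobian s. The
  term 1/p in the first parameter of \<open>phi\<close> compensates the normalisation e^(-r/p) of
  the dilation.\<close>

lemma stieltjes_dilation_integral:
  assumes f: "f \<in> Lp_space p" and t: "0 < t"
  shows "integrable lborel (\<lambda>r. phi (\<mu> - \<beta> + 1 / p) \<mu> r *\<^sub>R dilation r p f t)"
    and "stieltjes \<beta> \<mu> f t = (LINT r|lborel. phi (\<mu> - \<beta> + 1 / p) \<mu> r *\<^sub>R dilation r p f t)"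
proof -
  define F where "F s = (s powr (\<beta> - 1) / (s + t) powr \<mu>) *\<^sub>R f s" for s
  define g where "g r = exp (- r) * t" for r
  have img: "g ` UNIV = {0<..}"
  proof
    show "{0<..} \<subseteq> g ` UNIV"
    proof
      fix s :: real assume s: "s \<in> {0<..}"
      then have "s = g (ln (t / s))" using t by (simp add: g_def exp_minus)
      then show "s \<in> g ` UNIV" by blast
    qed
  qed (use t in \<open>auto simp: g_def\<close>)
  have der: "(g has_field_derivative - g r) (at r within UNIV)" for r
    unfolding g_def by (auto intro!: derivative_eq_intros)
  have inj: "inj_on g UNIV" using t by (auto simp: inj_on_def g_def)
  have Fm: "F \<in> borel_measurable halfline"
    using stieltjes_integrable[OF f t] unfolding F_def by (rule borel_measurable_integrable)
  have gm: "g \<in> borel \<rightarrow>\<^sub>M halfline"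
    by (rule measurable_restrict_space2) (use t in \<open>auto simp: g_def[abs_def]\<close>)
  then have [measurable]: "(\<lambda>r. F (g r)) \<in> borel_measurable borel"
    by (rule measurable_compose) (rule Fm)
  have [measurable]: "g \<in> borel_measurable borel" unfolding g_def by measurable
  have m: "set_borel_measurable borel (g ` UNIV) F" "set_borel_measurable borel UNIV (\<lambda>r. \<bar>- g r\<bar> *\<^sub>R F (g r))"
    using Fm unfolding img measurable_halfline_iff by (auto simp: set_borel_measurable_def)
  note cv = lborel_change_of_variables[OF _ _ der inj m, unfolded img, simplified]
  have eq: "t powr (\<mu> - \<beta>) *\<^sub>R (\<bar>- g r\<bar> *\<^sub>R F (g r)) = phi (\<mu> - \<beta> + 1 / p) \<mu> r *\<^sub>R dilation r p f t" for r
  proof -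
    have g0: "g r > 0" using t by (simp add: g_def)
    have d: "g r powr (\<beta> - 1) / (g r + t) powr \<mu> = t powr (\<beta> - 1 - \<mu>) * stieltjes_kernel \<beta> \<mu> (exp (- r))"
      using stieltjes_kernel_dilate[OF t, of "exp (- r)"] by (simp add: g_def mult.commute)
    \<comment> \<open>Factoring out e^(-r) converts the kernel at e^(-r) into the denominator of
      \<open>phi\<close>.\<close>
    have e: "1 + exp (- r) = exp (- r) * (1 + exp r)" by (simp add: distrib_left exp_add[symmetric])
    have s: "stieltjes_kernel \<beta> \<mu> (exp (- r)) = exp (- r * (\<beta> - 1)) / (exp (- r * \<mu>) * (1 + exp r) powr \<mu>)"
      unfolding stieltjes_kernel_def e
      by (subst powr_mult) (auto simp: powr_def add_pos_pos algebra_simps)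
    have "t powr (\<mu> - \<beta>) * (g r * (t powr (\<beta> - 1 - \<mu>) * stieltjes_kernel \<beta> \<mu> (exp (- r))))
        = (t powr (\<mu> - \<beta>) * (t powr 1 * t powr (\<beta> - 1 - \<mu>))) * (exp (- r) * stieltjes_kernel \<beta> \<mu> (exp (- r)))"
      using t by (simp add: g_def mult_ac)
    also have "t powr (\<mu> - \<beta>) * (t powr 1 * t powr (\<beta> - 1 - \<mu>)) = 1"
      using t by (simp only: powr_add[symmetric]) simp
    also have "1 * (exp (- r) * stieltjes_kernel \<beta> \<mu> (exp (- r))) = phi (\<mu> - \<beta> + 1 / p) \<mu> r * exp (- r / p)"
    proof -
      have "exp (- r) * exp (- r * (\<beta> - 1)) / exp (- r * \<mu>) = exp ((\<mu> - \<beta> + 1 / p) * r) * exp (- r / p)"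
        by (simp add: exp_add[symmetric] exp_diff[symmetric] algebra_simps)
      then show ?thesis unfolding s phi_def by (simp add: field_simps)
    qed
    finally show ?thesis
      using g0 unfolding F_def d dilation_def by (simp add: g_def mult_ac)
  qed
  have i: "integrable lborel (\<lambda>r. \<bar>- g r\<bar> *\<^sub>R F (g r))"
    using cv(1) stieltjes_integrable[OF f t] unfolding F_def[symmetric]
    by (simp add: integrable_halfline_iff set_integrable_def)
  then show "integrable lborel (\<lambda>r. phi (\<mu> - \<beta> + 1 / p) \<mu> r *\<^sub>R dilation r p f t)"
    unfolding eq[symmetric] by (intro integrable_scaleR_right)
  have "stieltjes \<beta> \<mu> f t = t powr (\<mu> - \<beta>) *\<^sub>R (LINT r|lborel. \<bar>- g r\<bar> *\<^sub>R F (g r))"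
    unfolding stieltjes_def F_def[symmetric] integral_halfline_eq
    using cv(2) by (simp add: set_lebesgue_integral_def)
  also have "\<dots> = (LINT r|lborel. phi (\<mu> - \<beta> + 1 / p) \<mu> r *\<^sub>R dilation r p f t)"
    unfolding eq[symmetric] by (rule integral_scaleR_right[symmetric])
  finally show "stieltjes \<beta> \<mu> f t = (LINT r|lborel. phi (\<mu> - \<beta> + 1 / p) \<mu> r *\<^sub>R dilation r p f t)" .
qed

end

text \<open>The test functions for sharpness: the cut-off at \<open>R\<close> handles the origin, an
  exponent \<open>e\<close> above 1/p handles infinity.\<close>

definition power_tail :: "real \<Rightarrow> real \<Rightarrow> real \<Rightarrow> complex" where
  "power_tail e R t = complex_of_real (indicator {R<..} t * t powr (- e))"

lemma power_tail_Lp: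
  assumes p: "1 \<le> p" and e: "1 / p < e" and R: "0 < R"
  shows "power_tail e R \<in> Lp_space p"
    and "Lp_norm p (power_tail e R) = (LINT t|halfline. indicator {R<..} t * t powr (- (e * p))) powr (1 / p)"
proof -
  have eq: "norm (power_tail e R t) powr p = indicator {R<..} t * t powr (- (e * p))" if "0 < t" for t
    using p by (simp add: power_tail_def indicator_def powr_powr)
  have "0 < e * p - 1" using p e by (simp add: field_simps)
  from integrable_powr_tail[OF this R]
  have "integrable halfline (\<lambda>t. indicator {R<..} t * t powr (- (e * p)))" by simp
  then have "integrable halfline (\<lambda>t. norm (power_tail e R t) powr p)"
    by (rule Bochner_Integration.integrable_cong[THEN iffD1, rotated 2]) (simp_all add: eq)
  moreover have "power_tail e R \<in> borel_measurable halfline"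
    unfolding power_tail_def by measurable
  ultimately show "power_tail e R \<in> Lp_space p" by (simp add: Lp_space_def)
  show "Lp_norm p (power_tail e R) = (LINT t|halfline. indicator {R<..} t * t powr (- (e * p))) powr (1 / p)"
    unfolding Lp_norm_def
    by (intro arg_cong[where f="\<lambda>x. x powr (1 / p)"] Bochner_Integration.integral_cong) (simp_all add: eq)
qed

text \<open>Dilating by R carries the tail beyond R to the tail beyond 1: the power contributes
  R^(-e), the L^p norm R^(1/p).\<close>

lemma power_tail_norm:
  assumes p: "1 \<le> p" and e: "1 / p < e" and R: "0 < R"
  shows "Lp_norm p (power_tail e R) = R powr (1 / p - e) * Lp_norm p (power_tail e 1)"
proof -
  define I where "I R = (LINT t|halfline. indicator {R<..} t * t powr (- (e * p)))" for R :: real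
  have "(LINT t|halfline. indicator {R<..} (R * t) * (R * t) powr (- (e * p))) = (1 / R) *\<^sub>R I R"
    unfolding I_def by (rule halfline_dilate(2)[OF R])
  also have "(LINT t|halfline. indicator {R<..} (R * t) * (R * t) powr (- (e * p)))
      = (LINT t|halfline. R powr (- (e * p)) * (indicator {1<..} t * t powr (- (e * p))))"
    using R by (intro Bochner_Integration.integral_cong) (auto simp: powr_mult indicator_def)
  also have "\<dots> = R powr (- (e * p)) * I 1" unfolding I_def by (rule integral_mult_right_zero)
  finally have "I R = R powr (1 - e * p) * I 1"
    using R by (simp add: powr_diff powr_minus field_simps)
  moreover have "I 1 \<ge> 0" unfolding I_def by (intro integral_nonneg_AE AE_I2) auto
  ultimately have "I R powr (1 / p) = R powr ((1 - e * p) / p) * I 1 powr (1 / p)"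
    by (simp add: powr_mult powr_powr)
  moreover have "(1 - e * p) / p = 1 / p - e" using p by (simp add: field_simps)
  ultimately show ?thesis by (simp add: power_tail_Lp[OF p e] R I_def)
qed

lemma power_tail_norm_pos:
  assumes p: "1 \<le> p" and e: "1 / p < e"
  shows "0 < Lp_norm p (power_tail e 1)"
proof -
  have "Lp_norm p (power_tail e 1) \<noteq> 0"
  proof
    assume "Lp_norm p (power_tail e 1) = 0"
    then have "AE t in halfline. power_tail e 1 t = 0"
      using Lp_norm_eq_0_iff[OF power_tail_Lp(1)[OF p e zero_less_one] p] by simp
    then have "AE t in lborel. 0 < t \<longrightarrow> power_tail e 1 t = 0" by (simp add: AE_halfline_iff)
    from AE_lborel_ex_interval[OF this, of 1 2] show False by (auto simp: power_tail_def)
  qed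
  then show ?thesis using Lp_norm_nonneg[of p "power_tail e 1"] by linarith
qed

text \<open>For t > R and u in (1/R, R) the test function is not cut off at tu, so the operator
  reproduces t^(-e) with a factor at least R^(-\<epsilon>) times the truncated mass. Restricting to
  t > R costs R^(-\<epsilon>) again, whence the exponent -2\<epsilon>.\<close>

lemma hom_op_norm_lower_aux:
  assumes p: "1 \<le> p" and k: "hom_kernel p k" and nn: "\<And>u. 0 < u \<Longrightarrow> 0 \<le> k u"
    and C: "\<And>h. h \<in> Lp_space p \<Longrightarrow> Lp_norm p (hom_op k h) \<le> C * Lp_norm p h"
    and R: "1 < R" and \<epsilon>: "0 < \<epsilon>"
  shows "R powr (- 2 * \<epsilon>) * (LINT u|halfline. indicator {1/R<..<R} u * (k u * u powr (-1 / p))) \<le> C"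
proof -
  define e where "e = 1 / p + \<epsilon>"
  define M where "M = (LINT u|halfline. indicator {1/R<..<R} u * (k u * u powr (-1 / p)))"
  have e: "1 / p < e" using \<epsilon> by (simp add: e_def)
  have R0: "R > 0" using R by simp
  have [measurable]: "k \<in> borel_measurable halfline" using k by (simp add: hom_kernel_def)
  have "integrable halfline (\<lambda>u. \<bar>k u\<bar> * u powr (-1 / p))" using k by (simp add: hom_kernel_def)
  then have ki: "integrable halfline (\<lambda>u. k u * u powr (-1 / p))"
    by (rule Bochner_Integration.integrable_cong[THEN iffD1, rotated 2]) (simp_all add: nn)
  have Mi: "integrable halfline (\<lambda>u. indicator {1/R<..<R} u * (k u * u powr (-1 / p)))"
    by (rule Bochner_Integration.integrable_bound[OF ki]) (auto simp: indicator_def)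
  have M0: "M \<ge> 0" unfolding M_def using nn by (intro integral_nonneg_AE AE_I2) auto
  let ?h = "power_tail e 1"
  note hL = power_tail_Lp(1)[OF p e zero_less_one]
  have "AE t in halfline. norm (power_tail e R t * complex_of_real (R powr (- \<epsilon>) * M)) \<le> norm (hom_op k ?h t)"
    using hom_op_integrable[OF p hL k]
  proof eventually_elim
    case (elim t)
    show ?case
    proof (cases "R < t")
      case False
      then show ?thesis by (simp add: power_tail_def)
    next
      case True
      then have t: "0 < t" using R by simp
      define q where "q u = k u * (indicator {1<..} (t * u) * (t * u) powr (- e))" for u
      have q: "k u *\<^sub>R ?h (t * u) = complex_of_real (q u)" for u
        by (simp add: q_def power_tail_def scaleR_conv_of_real)
      have qi: "integrable halfline q" using elim unfolding q by (simp only: complex_of_real_integrable_eq)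
      have H: "hom_op k ?h t = complex_of_real (integral\<^sup>L halfline q)"
        unfolding hom_op_def q by (rule integral_complex_of_real)
      have "t powr (- e) * (R powr (- \<epsilon>) * M) = (LINT u|halfline. (t powr (- e) * R powr (- \<epsilon>)) * (indicator {1/R<..<R} u * (k u * u powr (-1 / p))))"
        unfolding M_def by (simp add: integral_mult_right_zero mult.assoc)
      also have "\<dots> \<le> integral\<^sup>L halfline q"
      proof (rule integral_mono[OF _ qi])
        show "integrable halfline (\<lambda>u. (t powr (- e) * R powr (- \<epsilon>)) * (indicator {1/R<..<R} u * (k u * u powr (-1 / p))))"
          using Mi by (intro integrable_mult_right)
        fix u assume "u \<in> space halfline"
        then have u: "0 < u" by simp
        show "(t powr (- e) * R powr (- \<epsilon>)) * (indicator {1/R<..<R} u * (k u * u powr (-1 / p))) \<le> q u"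
        proof (cases "1 / R < u \<and> u < R")
          case False
          then have "indicator {1/R<..<R} u = (0 :: real)" by auto
          then show ?thesis using nn[OF u] by (simp add: q_def)
        next
          case True
          \<comment> \<open>This is where the two cut-offs match: t > R and u > 1/R put tu in the
            region where \<open>power_tail e 1\<close> is a pure power.\<close>
          have "1 = R * (1 / R)" using R by simp
          also have "\<dots> < t * u" using True \<open>R < t\<close> R u by (intro mult_strict_mono) auto
          finally have tu: "1 < t * u" .
          have "R powr (- \<epsilon>) \<le> u powr (- \<epsilon>)" using True u \<epsilon> by (intro powr_mono2') auto
          then have "(t powr (- e) * (k u * u powr (-1 / p))) * R powr (- \<epsilon>) \<le> (t powr (- e) * (k u * u powr (-1 / p))) * u powr (- \<epsilon>)"
            using nn[OF u] by (intro mult_left_mono) auto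
          also have "\<dots> = k u * (t powr (- e) * (u powr (-1 / p) * u powr (- \<epsilon>)))" by (simp add: mult_ac)
          also have "u powr (-1 / p) * u powr (- \<epsilon>) = u powr (- e)"
            by (simp add: powr_add[symmetric] e_def)
          also have "t powr (- e) * u powr (- e) = (t * u) powr (- e)"
            using t u by (intro powr_mult[symmetric])
          finally show ?thesis using True tu by (simp add: q_def mult_ac)
        qed
      qed
      finally have "t powr (- e) * (R powr (- \<epsilon>) * M) \<le> integral\<^sup>L halfline q" .
      then show ?thesis
        unfolding H using M0 True by (simp add: power_tail_def norm_mult)
    qed
  qed
  then have "Lp_norm p (\<lambda>t. power_tail e R t * complex_of_real (R powr (- \<epsilon>) * M)) \<le> Lp_norm p (hom_op k ?h)"
    by (intro Lp_norm_mono[OF hom_op_Lp[OF p hL k] p])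
  also have "\<dots> \<le> C * Lp_norm p ?h" by (rule C[OF hL])
  finally have "R powr (- \<epsilon>) * M * (R powr (1 / p - e) * Lp_norm p ?h) \<le> C * Lp_norm p ?h"
    using M0 Lp_norm_cmult[OF p, of "complex_of_real (R powr (- \<epsilon>) * M)" "power_tail e R"]
    by (simp add: mult.commute[of "power_tail e R _"] power_tail_norm[OF p e R0] norm_mult)
  then have "(R powr (- \<epsilon>) * R powr (1 / p - e) * M) * Lp_norm p ?h \<le> C * Lp_norm p ?h"
    by (simp add: mult_ac)
  then have "R powr (- \<epsilon>) * R powr (1 / p - e) * M \<le> C"
    using power_tail_norm_pos[OF p e] by (simp only: mult_le_cancel_right_pos)
  moreover have "R powr (- \<epsilon>) * R powr (1 / p - e) = R powr (- 2 * \<epsilon>)"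
    by (simp add: powr_add[symmetric] e_def)
  ultimately show ?thesis by (simp add: M_def)
qed

text \<open>The order of limits matters: \<epsilon> tends to 0 with R fixed, which removes the loss
  R^(-2\<epsilon>); then R tends to infinity and the truncated masses exhaust the full one.\<close>

lemma hom_op_norm_lower:
  assumes p: "1 \<le> p" and k: "hom_kernel p k" and nn: "\<And>u. 0 < u \<Longrightarrow> 0 \<le> k u"
    and C: "\<And>h. h \<in> Lp_space p \<Longrightarrow> Lp_norm p (hom_op k h) \<le> C * Lp_norm p h"
  shows "kernel_mass p k \<le> C"
proof -
  define M where "M R = (LINT u|halfline. indicator {1/R<..<R} u * (k u * u powr (-1 / p)))" for R :: real
  have MC: "M R \<le> C" if R: "1 < R" for R
  proof -
    have "(\<lambda>n. R powr (- 2 * inverse (real (Suc n))) * M R) \<longlonglongrightarrow> R powr (- 2 * 0) * M R"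
      using R by (intro tendsto_mult tendsto_powr tendsto_const tendsto_mult_left LIMSEQ_inverse_real_of_nat) auto
    then have "R powr (- 2 * 0) * M R \<le> C"
    proof (rule LIMSEQ_le_const2)
      show "\<exists>N. \<forall>n\<ge>N. R powr (- 2 * inverse (real (Suc n))) * M R \<le> C"
        unfolding M_def by (intro exI allI impI hom_op_norm_lower_aux[OF p k nn C R]) simp_all
    qed
    then show ?thesis using R by simp
  qed
  have [measurable]: "k \<in> borel_measurable halfline" using k by (simp add: hom_kernel_def)
  have ki: "integrable halfline (\<lambda>u. \<bar>k u\<bar> * u powr (-1 / p))" using k by (simp add: hom_kernel_def)
  have "(\<lambda>n. M (real (n + 2))) \<longlonglongrightarrow> (LINT u|halfline. k u * u powr (-1 / p))"
    unfolding M_def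
  proof (rule integral_dominated_convergence[where w="\<lambda>u. \<bar>k u\<bar> * u powr (-1 / p)"])
    show "integrable halfline (\<lambda>u. \<bar>k u\<bar> * u powr (-1 / p))" by (rule ki)
    show "AE u in halfline. (\<lambda>n. indicator {1/real (n + 2)<..<real (n + 2)} u * (k u * u powr (-1 / p))) \<longlonglongrightarrow> k u * u powr (-1 / p)"
    proof (rule AE_I2)
      fix u assume "u \<in> space halfline"
      then have u: "u > 0" by simp
      obtain N :: nat where N: "max u (1 / u) < real N" using reals_Archimedean2 by blast
      have "indicator {1/real (n + 2)<..<real (n + 2)} u * (k u * u powr (-1 / p)) = k u * u powr (-1 / p)" if "n \<ge> N" for n
      proof -
        have n: "u < real (n + 2)" "1 / u < real (n + 2)" using N that by simp_all
        then have "1 / real (n + 2) < u" using u by (simp add: field_simps)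
        then show ?thesis using n by simp
      qed
      then show "(\<lambda>n. indicator {1/real (n + 2)<..<real (n + 2)} u * (k u * u powr (-1 / p))) \<longlonglongrightarrow> k u * u powr (-1 / p)"
        by (intro tendsto_eventually) (auto simp: eventually_sequentially)
    qed
    show "AE u in halfline. norm (indicator {1/real (n + 2)<..<real (n + 2)} u * (k u * u powr (-1 / p))) \<le> \<bar>k u\<bar> * u powr (-1 / p)" for n
      by (intro AE_I2) (simp add: indicator_def abs_mult)
  qed measurable
  then have "(LINT u|halfline. k u * u powr (-1 / p)) \<le> C"
    by (rule LIMSEQ_le_const2) (auto intro!: exI[of _ 0] MC)
  moreover have "(LINT u|halfline. k u * u powr (-1 / p)) = kernel_mass p k"
    unfolding kernel_mass_def using nn by (intro Bochner_Integration.integral_cong) auto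
  ultimately show ?thesis by simp
qed

theorem theorem3:
  fixes \<alpha> p \<beta> \<mu> :: real
  assumes "0 \<le> \<alpha>" and "1 \<le> p" and "0 < \<beta> - 1 / p" and "\<beta> - 1 / p < \<mu>"
  shows "(\<forall>f\<in>sobolev \<alpha> p. \<forall>t>0.
            integrable halfline (\<lambda>s. (s powr (\<beta> - 1) / (s + t) powr \<mu>) *\<^sub>R f s)) \<and>
         sobolev_bounded_operator \<alpha> p (stieltjes \<beta> \<mu>) \<and>
         sobolev_onorm \<alpha> p (stieltjes \<beta> \<mu>) = Beta (\<mu> - \<beta> + 1 / p) (\<beta> - 1 / p) \<and>
         (\<forall>f\<in>sobolev \<alpha> p. AE t in halfline.
            integrable lborel (\<lambda>r. phi (\<mu> - \<beta> + 1 / p) \<mu> r *\<^sub>R dilation r p f t) \<and>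
            stieltjes \<beta> \<mu> f t =
              (LINT r|lborel. phi (\<mu> - \<beta> + 1 / p) \<mu> r *\<^sub>R dilation r p f t))"
proof -
  note \<alpha> = assms(1) and p = assms(2) and \<beta>\<mu> = assms(2-4)
  define k where "k = stieltjes_kernel \<beta> \<mu>"
  define B where "B = Beta (\<mu> - \<beta> + 1 / p) (\<beta> - 1 / p)"
  have k: "hom_kernel p k" "kernel_mass p k = B"
    using hom_kernel_stieltjes[OF \<beta>\<mu>] kernel_mass_stieltjes[OF \<beta>\<mu>] by (simp_all add: k_def B_def)
  have km: "k \<in> borel_measurable halfline" using k by (simp add: hom_kernel_def)
  have knn: "0 \<le> k u" for u by (simp add: k_def stieltjes_kernel_def)
  have B0: "0 \<le> B" using kernel_mass_nonneg[of p k] k by simp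
  have S_eq: "stieltjes \<beta> \<mu> f t = hom_op k f t" if "0 < t" for f t
    unfolding k_def by (rule stieltjes_eq[OF \<beta>\<mu> that])
  have pos: "AE t in halfline. 0 < t" by (intro AE_I2) simp
  have int: "integrable halfline (\<lambda>s. (s powr (\<beta> - 1) / (s + t) powr \<mu>) *\<^sub>R f s)"
    if "f \<in> sobolev \<alpha> p" "0 < t" for f t
    by (rule stieltjes_integrable[OF \<beta>\<mu> sobolev_Lp[OF that(1)] that(2)])
  \<comment> \<open>Commutation gives S G h = G S h, so both norms are L^p norms on the side of h,
    and \<alpha> has disappeared from the problem.\<close>
  have transfer: "stieltjes \<beta> \<mu> f \<in> sobolev \<alpha> p \<and> sobolev_norm \<alpha> p f = Lp_norm p h \<and>
      sobolev_norm \<alpha> p (stieltjes \<beta> \<mu> f) = Lp_norm p (hom_op k h)"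
    if f: "f \<in> Lp_space p" and h: "h \<in> Lp_space p" and eq: "AE t in halfline. f t = frac_rep \<alpha> h t" for f h
  proof -
    have "stieltjes \<beta> \<mu> f \<in> Lp_space p"
      by (rule Lp_space_cong_pos[OF hom_op_Lp[OF p f k(1)]]) (rule S_eq)
    moreover have "AE t in halfline. stieltjes \<beta> \<mu> f t = frac_rep \<alpha> (hom_op k h) t"
      using frac_rep_commute[OF \<alpha> p h k(1)] pos
    proof eventually_elim
      case (elim t)
      have "hom_op k f t = hom_op k (frac_rep \<alpha> h) t"
        by (intro hom_op_cong_AE eq elim km Lp_space_measurable[OF f] Lp_space_measurable[OF frac_rep_Lp[OF \<alpha> p h]])
      then show ?case using elim by (simp add: S_eq)
    qed
    ultimately show ?thesis
      using sobolev_memI[OF \<alpha> p f h eq] sobolev_memI[OF \<alpha> p _ hom_op_Lp[OF p h k(1)]] by blast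
  qed
  have S_norm: "sobolev_norm \<alpha> p (stieltjes \<beta> \<mu> f) \<le> B * sobolev_norm \<alpha> p f" and S_mem: "stieltjes \<beta> \<mu> f \<in> sobolev \<alpha> p"
    and norm_nn: "0 \<le> sobolev_norm \<alpha> p f"
    if f: "f \<in> sobolev \<alpha> p" for f
  proof -
    obtain h where h: "h \<in> Lp_space p" "AE t in halfline. f t = frac_rep \<alpha> h t"
      by (rule sobolev_rep[OF \<alpha> p f])
    note T = transfer[OF sobolev_Lp[OF f] h]
    show "sobolev_norm \<alpha> p (stieltjes \<beta> \<mu> f) \<le> B * sobolev_norm \<alpha> p f"
      using T hom_op_norm[OF p h(1) k(1)] k(2) by simp
    show "stieltjes \<beta> \<mu> f \<in> sobolev \<alpha> p" "0 \<le> sobolev_norm \<alpha> p f" using T by auto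
  qed
  have bounded: "sobolev_bounded_operator \<alpha> p (stieltjes \<beta> \<mu>)"
    unfolding sobolev_bounded_operator_def
  proof (intro conjI ballI allI impI)
    fix f g assume fg: "f \<in> sobolev \<alpha> p" "g \<in> sobolev \<alpha> p"
    {
      assume eq: "AE t in halfline. f t = g t"
      show "AE t in halfline. stieltjes \<beta> \<mu> f t = stieltjes \<beta> \<mu> g t"
        using pos
      proof eventually_elim
        case (elim t)
        have "hom_op k f t = hom_op k g t"
          by (rule hom_op_cong_AE[OF eq elim Lp_space_measurable[OF sobolev_Lp[OF fg(1)]]
              Lp_space_measurable[OF sobolev_Lp[OF fg(2)]] km])
        then show ?case using elim by (simp add: S_eq)
      qed
    }
    \<comment> \<open>The integrals split because each converges at every positive t.\<close>
    show "AE t in halfline. stieltjes \<beta> \<mu> (\<lambda>s. f s + g s) t = stieltjes \<beta> \<mu> f t + stieltjes \<beta> \<mu> g t"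
      using pos by eventually_elim (simp add: stieltjes_def scaleR_add_right int fg)
  next
    fix c f assume f: "f \<in> sobolev \<alpha> p"
    show "AE t in halfline. stieltjes \<beta> \<mu> (\<lambda>s. c * f s) t = c * stieltjes \<beta> \<mu> f t"
    proof (rule AE_I2)
      fix t
      have "(LINT s|halfline. (s powr (\<beta> - 1) / (s + t) powr \<mu>) *\<^sub>R (c * f s))
          = (LINT s|halfline. c * ((s powr (\<beta> - 1) / (s + t) powr \<mu>) *\<^sub>R f s))"
        by (simp only: mult_scaleR_right)
      also have "\<dots> = c * (LINT s|halfline. (s powr (\<beta> - 1) / (s + t) powr \<mu>) *\<^sub>R f s)"
        by (rule integral_mult_right_zero)
      finally show "stieltjes \<beta> \<mu> (\<lambda>s. c * f s) t = c * stieltjes \<beta> \<mu> f t"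
        by (simp only: stieltjes_def mult_scaleR_right)
    qed
  next
    show "\<exists>C. \<forall>f\<in>sobolev \<alpha> p. sobolev_norm \<alpha> p (stieltjes \<beta> \<mu> f) \<le> C * sobolev_norm \<alpha> p f"
      using S_norm by blast
  qed (rule S_mem)
  \<comment> \<open>For an element of norm 0 the quotient is 0 by convention, which is at most
    \<open>B\<close> since \<open>B\<close> is nonnegative.\<close>
  have ratio: "sobolev_norm \<alpha> p (stieltjes \<beta> \<mu> f) / sobolev_norm \<alpha> p f \<le> B" if "f \<in> sobolev \<alpha> p" for f
    using S_norm[OF that] norm_nn[OF that] B0 by (cases "sobolev_norm \<alpha> p f = 0") (auto simp: divide_le_eq)
  have bdd: "bdd_above ((\<lambda>f. sobolev_norm \<alpha> p (stieltjes \<beta> \<mu> f) / sobolev_norm \<alpha> p f) ` sobolev \<alpha> p)"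
    using ratio by (auto intro!: bdd_aboveI2)
  have rep: "frac_rep \<alpha> h \<in> sobolev \<alpha> p" if "h \<in> Lp_space p" for h
    by (rule sobolev_memI(1)[OF \<alpha> p frac_rep_Lp[OF \<alpha> p that] that]) simp
  \<comment> \<open>The zero function only serves to show that the supremum is over a nonempty
    set.\<close>
  have "sobolev_onorm \<alpha> p (stieltjes \<beta> \<mu>) \<le> B"
    unfolding sobolev_onorm_def using rep[of "\<lambda>t. 0"] ratio by (intro cSUP_least) auto
  \<comment> \<open>Every h in L^p is tested through f = \<open>frac_rep \<alpha> h\<close>, whose
    norm is that of h; the supremum therefore bounds the operator on all of L^p, where the mass is
    sharp.\<close>
  moreover have "B \<le> sobolev_onorm \<alpha> p (stieltjes \<beta> \<mu>)"
    unfolding k(2)[symmetric]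
  proof (rule hom_op_norm_lower[OF p k(1) knn])
    fix h assume h: "h \<in> Lp_space p"
    note T = transfer[OF frac_rep_Lp[OF \<alpha> p h] h AE_I2[OF refl]]
    have le: "Lp_norm p (hom_op k h) / Lp_norm p h \<le> sobolev_onorm \<alpha> p (stieltjes \<beta> \<mu>)"
      unfolding sobolev_onorm_def using cSUP_upper[OF rep[OF h] bdd] T by simp
    show "Lp_norm p (hom_op k h) \<le> sobolev_onorm \<alpha> p (stieltjes \<beta> \<mu>) * Lp_norm p h"
    proof (cases "Lp_norm p h = 0")
      case True
      then show ?thesis using hom_op_norm[OF p h k(1)] by simp
    next
      case False
      then have "0 < Lp_norm p h" using Lp_norm_nonneg[of p h] by linarith
      then show ?thesis using le by (simp add: divide_le_eq)
    qed
  qed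
  ultimately have onorm: "sobolev_onorm \<alpha> p (stieltjes \<beta> \<mu>) = B" by simp
  have "AE t in halfline. integrable lborel (\<lambda>r. phi (\<mu> - \<beta> + 1 / p) \<mu> r *\<^sub>R dilation r p f t) \<and>
      stieltjes \<beta> \<mu> f t = (LINT r|lborel. phi (\<mu> - \<beta> + 1 / p) \<mu> r *\<^sub>R dilation r p f t)"
    if "f \<in> sobolev \<alpha> p" for f
    using pos by eventually_elim (use stieltjes_dilation_integral[OF \<beta>\<mu> sobolev_Lp[OF that]] in blast)
  then show ?thesis using int bounded onorm unfolding B_def by blast
qed

end
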